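(* If $y>\exp(3.42\sqrt{\log x})$, then there exists a positive constant $c_2$ such that, as $x\to\infty$, $$ \frac1y\sum_{a\leq y}N_a(x)=\sum_{n\leq x}\frac{R(n)}{n}+O\!\left(x\exp(-c_2\sqrt{\log x})\right). $$
   Context: $a$ and $n$ run over positive integers. Carmichael's function $\lambda(n)$ is the exponent of the group $(\mathbb{Z}/n\mathbb{Z})^*$. For $a$ coprime to $n$, $\ell_a(n)$ is the multiplicative order of $a$ modulo $n$, and $a$ is called a $\lambda$-primitive root modulo $n$ if $\gcd(a,n)=1$ and $\ell_a(n)=\lambda(n)$. $R(n)=\#\{a\in(\mathbb{Z}/n\mathbb{Z})^*: a \text{ is a } \lambda\text{-primitive root modulo } n\}$ and $N_a(x)=\#\{n\leq x: a \text{ is a } \lambda\text{-primitive root modulo } n\}$. *)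

theory Defs
  imports "HOL-Number_Theory.Number_Theory"
begin

definition lambda_primroot :: "nat \<Rightarrow> nat \<Rightarrow> bool" where
  "lambda_primroot n a \<longleftrightarrow> coprime a n \<and> ord n a = Carmichael n"

definition R_count :: "nat \<Rightarrow> nat" where
  "R_count n = card {a \<in> totatives n. lambda_primroot n a}"

definition N_count :: "nat \<Rightarrow> real \<Rightarrow> nat" where
  "N_count a x = card {n. 1 \<le> n \<and> real n \<le> x \<and> lambda_primroot n a}"

end

theory Submission
  imports Defs "HOL-Real_Asymp.Real_Asymp" "HOL-Analysis.Convex"
begin

text \<open>
  Being a \<open>\<lambda>\<close>-primitive root modulo \<open>n\<close> means avoiding, for every prime \<open>q\<close> dividing \<open>\<lambda>(n)\<close>, the
  subgroup of solutions of \<open>a\<^bsup>\<lambda>(n)/q\<^esup> = 1\<close>. Bonferroni's inequalities, truncated at about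
  \<open>\<surd>(log x) / log log x\<close> primes, reduce the claim to one subgroup \<open>H\<^sub>n\<close> for each \<open>n \<le> x\<close>: the
  numbers \<open>a \<le> y\<close> in \<open>H\<^sub>n\<close> have to be as frequent as expected, on average over \<open>n\<close>.

  The difference is a sum of \<open>\<Sum>\<^bsub>a \<le> y\<^esub> \<chi>(a)\<close> over the nonprincipal characters that are trivial on \<open>H\<^sub>n\<close>.
  Characters of small conductor are treated by periodicity. Those with conductor of size \<open>M\<close> are
  treated by raising the sum to the power \<open>k\<close>, with \<open>y\<^sup>k\<close> slightly larger than \<open>M\<^sup>2\<close>, and a large
  sieve inequality; since \<open>y\<^sup>k\<close> may exceed \<open>M\<^sup>2\<close> by a small power of \<open>M\<close>, neither Gauss sums nor
  the additive large sieve are needed. The coincidences \<open>a\<^sub>1 \<cdots> a\<^sub>k = b\<^sub>1 \<cdots> b\<^sub>k\<close> with factors at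
  most \<open>y\<close> number at most \<open>(\<Sum>\<^bsub>a \<le> y\<^esub> \<tau>\<^sub>k(a))\<^sup>k \<le> (y\<^bsup>1+s\<^esup> \<zeta>(1+s)\<^sup>k)\<^sup>k\<close>, and \<open>s = 0.15\<close> suffices.
\<close>

section \<open>Dirichlet characters and subgroups\<close>

text \<open>The moment bounds run over all nonprincipal characters of a block of conductors, so they
  are uniform in the choice of one subgroup per modulus. For each \<open>n\<close> the set
  \<open>D\<close> of largest discrepancy may therefore be taken. This costs a factor for the number
  of truncated sets, about exp(R/16000) with R = sqrt(log x), against a saving of exp(-R/8000).

  The constant 3.42 comes from the moments. Put \<nu> = log y and \<mu> = log M. A block of
  conductors near M gains a factor M from the number of possible cofactors n/M, while coincidences
  lose y^(s k) (1 + 1/s)^(k^2), so that k (s \<nu> + k log(1 + 1/s)) < \<mu> is required. Here k is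
  about 2 \<mu>/\<nu>, and \<mu> \<le> log x \<le> (\<nu>/3.42)^2. For large k the condition becomes
  s + c log(1 + 1/s) < 1/2 with c = 2/3.42^2 = 0.17099... The left side is least where s (s + 1) =
  c, that is for s near 0.149, with value about 0.498; hence s = 0.15. The small remaining room pays
  for the surplus of y^k over M^2, for rounding k up, and for the final saving.\<close>

definition dcharacter :: "nat \<Rightarrow> (nat \<Rightarrow> complex) \<Rightarrow> bool" where
  "dcharacter n \<chi> \<longleftrightarrow> (\<forall>a. \<chi> a = 0 \<longleftrightarrow> \<not> coprime a n) \<and> (\<forall>a b. \<chi> (a * b) = \<chi> a * \<chi> b) \<and>
     (\<forall>a b. [a = b] (mod n) \<longrightarrow> \<chi> a = \<chi> b)"

lemma dcharacterD:
  assumes "dcharacter n \<chi>"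
  shows "\<chi> a = 0 \<longleftrightarrow> \<not> coprime a n" "\<chi> (a * b) = \<chi> a * \<chi> b" "[a = b] (mod n) \<Longrightarrow> \<chi> a = \<chi> b"
  using assms by (auto simp: dcharacter_def)

lemma dcharacter_1:
  assumes "dcharacter n \<chi>"
  shows "\<chi> 1 = 1"
proof -
  have "\<chi> 1 = \<chi> 1 * \<chi> 1" using dcharacterD(2)[OF assms, of 1 1] by simp
  moreover have "\<chi> 1 \<noteq> 0" using dcharacterD(1)[OF assms, of 1] by simp
  ultimately show ?thesis by simp
qed

lemma dcharacter_power:
  assumes "dcharacter n \<chi>"
  shows "\<chi> (a ^ k) = \<chi> a ^ k"
  by (induction k) (use dcharacter_1[OF assms] dcharacterD(2)[OF assms] in auto)

lemma dcharacter_power_totient: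
  assumes "dcharacter n \<chi>" "coprime a n"
  shows "\<chi> a ^ totient n = 1"
proof -
  have "[a ^ totient n = 1] (mod n)" using assms(2) by (rule euler_theorem)
  then have "\<chi> (a ^ totient n) = \<chi> 1" by (rule dcharacterD(3)[OF assms(1)])
  then show ?thesis using dcharacter_power[OF assms(1)] dcharacter_1[OF assms(1)] by simp
qed

lemma dcharacter_norm:
  assumes "dcharacter n \<chi>" "n > 0" "coprime a n"
  shows "norm (\<chi> a) = 1"
proof -
  have "norm (\<chi> a) ^ totient n = 1"
    using dcharacter_power_totient[OF assms(1,3)] by (metis norm_one norm_power)
  then show ?thesis using assms(2)
    by (metis norm_ge_zero power_eq_1_iff abs_of_nonneg totient_gt_0_iff not_gr_zero real_norm_def)
qed

lemma dcharacter_norm_le: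
  assumes "dcharacter n \<chi>" "n > 0"
  shows "norm (\<chi> a) \<le> 1"
  using dcharacter_norm[OF assms] dcharacterD(1)[OF assms(1), of a] by (cases "coprime a n") auto

lemma dcharacter_cnj: "dcharacter n \<chi> \<Longrightarrow> dcharacter n (\<lambda>a. cnj (\<chi> a))"
  by (auto simp: dcharacter_def)

lemma dcharacter_mult:
  assumes "dcharacter m \<chi>" "dcharacter n \<psi>"
  shows "dcharacter (m * n) (\<lambda>a. \<chi> a * \<psi> a)"
  unfolding dcharacter_def
proof (intro conjI allI impI)
  fix a b
  show "(\<chi> a * \<psi> a = 0) = (\<not> coprime a (m * n))"
    using dcharacterD(1)[OF assms(1), of a] dcharacterD(1)[OF assms(2), of a] by auto
  show "\<chi> (a * b) * \<psi> (a * b) = \<chi> a * \<psi> a * (\<chi> b * \<psi> b)"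
    using dcharacterD(2)[OF assms(1), of a b] dcharacterD(2)[OF assms(2), of a b] by simp
  assume "[a = b] (mod (m * n))"
  then have "[a = b] (mod m)" "[a = b] (mod n)"
    by (metis cong_modulus_mult_nat, metis cong_modulus_mult_nat mult.commute)
  then show "\<chi> a * \<psi> a = \<chi> b * \<psi> b"
    using dcharacterD(3)[OF assms(1)] dcharacterD(3)[OF assms(2)] by simp
qed

lemma dcharacter_times:
  assumes "dcharacter n \<chi>" "dcharacter n \<psi>"
  shows "dcharacter n (\<lambda>a. \<chi> a * \<psi> a)"
  using assms unfolding dcharacter_def by auto

lemma dcharacter_sum_0:
  assumes "dcharacter n \<chi>" "n > 0" "coprime b n" "\<chi> b \<noteq> 1"
  shows "(\<Sum>a<n. \<chi> a) = 0"
proof -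
  have inj: "inj_on (\<lambda>a. a * b mod n) {..<n}"
  proof (rule inj_onI)
    fix x y assume xy: "x \<in> {..<n}" "y \<in> {..<n}" "x * b mod n = y * b mod n"
    then have "[x * b = y * b] (mod n)" unfolding Cong.cong_def by metis
    then have "[x = y] (mod n)" using assms(3) by (simp add: cong_mult_rcancel_nat coprime_commute)
    then show "x = y" using xy by (simp add: Cong.cong_def)
  qed
  have img: "(\<lambda>a. a * b mod n) ` {..<n} = {..<n}"
    by (rule card_subset_eq) (use assms(2) card_image[OF inj] in auto)
  have "(\<Sum>a<n. \<chi> a) = (\<Sum>a<n. \<chi> (a * b mod n))"
    by (subst img[symmetric], subst sum.reindex[OF inj]) (simp add: o_def)
  also have "\<dots> = (\<Sum>a<n. \<chi> a * \<chi> b)"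
    by (intro sum.cong refl) (metis dcharacterD(2,3)[OF assms(1)] cong_mod_left cong_refl)
  also have "\<dots> = (\<Sum>a<n. \<chi> a) * \<chi> b" by (simp add: sum_distrib_right)
  finally show ?thesis using assms(4) by simp
qed

text \<open>A character is determined by its values on \<open>{..<n}\<close>, and these are 0 or
  roots of unity of order dividing \<open>totient n\<close>.\<close>

lemma finite_dcharacters:
  assumes "n > 0"
  shows "finite {\<chi>. dcharacter n \<chi>}"
proof -
  let ?V = "insert 0 {z::complex. z ^ totient n = 1}"
  have finV: "finite ?V" using assms by (intro finite.insertI finite_nth_roots) auto
  have inj: "inj_on (\<lambda>\<chi>. restrict \<chi> {..<n}) {\<chi>. dcharacter n \<chi>}"
  proof (rule inj_onI, rule ext)
    fix \<chi> \<psi> :: "nat \<Rightarrow> complex" and a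
    assume h: "\<chi> \<in> {\<chi>. dcharacter n \<chi>}" "\<psi> \<in> {\<chi>. dcharacter n \<chi>}"
      "restrict \<chi> {..<n} = restrict \<psi> {..<n}"
    have "\<chi> a = \<chi> (a mod n)" "\<psi> a = \<psi> (a mod n)"
      using h dcharacterD(3)[of n _ a "a mod n"] by (auto simp: Cong.cong_def)
    moreover have "restrict \<chi> {..<n} (a mod n) = restrict \<psi> {..<n} (a mod n)" using h by simp
    ultimately show "\<chi> a = \<psi> a" using assms by simp
  qed
  have "(\<lambda>\<chi>. restrict \<chi> {..<n}) ` {\<chi>. dcharacter n \<chi>} \<subseteq> {..<n} \<rightarrow>\<^sub>E ?V"
  proof -
    have "\<chi> a \<in> ?V" if "dcharacter n \<chi>" for \<chi> a
      using dcharacterD(1)[OF that, of a] dcharacter_power_totient[OF that, of a] by auto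
    then show ?thesis by (intro image_subsetI restrict_PiE_iff[THEN iffD2]) simp
  qed
  then have "finite ((\<lambda>\<chi>. restrict \<chi> {..<n}) ` {\<chi>. dcharacter n \<chi>})"
    by (rule finite_subset) (intro finite_PiE finite_lessThan finV)
  then show ?thesis using inj by (rule finite_imageD)
qed

section \<open>Subgroups modulo n and extension of their characters\<close>

definition mod_subgroup :: "nat \<Rightarrow> nat set \<Rightarrow> bool" where
  "mod_subgroup n H \<longleftrightarrow> H \<subseteq> {a. coprime a n} \<and> 1 \<in> H \<and> (\<forall>a\<in>H. \<forall>b\<in>H. a * b \<in> H) \<and>
     (\<forall>a\<in>H. \<forall>b. [a = b] (mod n) \<longrightarrow> b \<in> H)"

lemma mod_subgroupD:
  assumes "mod_subgroup n H"
  shows "a \<in> H \<Longrightarrow> coprime a n" "1 \<in> H" "a \<in> H \<Longrightarrow> b \<in> H \<Longrightarrow> a * b \<in> H"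
    "a \<in> H \<Longrightarrow> [a = b] (mod n) \<Longrightarrow> b \<in> H"
  using assms unfolding mod_subgroup_def by auto

lemma mod_subgroup_power:
  assumes "mod_subgroup n H" "a \<in> H"
  shows "a ^ k \<in> H"
  by (induction k) (use assms mod_subgroupD[OF assms(1)] in auto)

text \<open>By Euler's theorem the inverse of \<open>a\<close> is a power of \<open>a\<close>, which
  is why \<open>mod_subgroup\<close> only asks for closure under products.\<close>

lemma mod_subgroup_cancel:
  assumes "mod_subgroup n H" "n > 0" "a \<in> H" "a * b \<in> H"
  shows "b \<in> H"
proof -
  obtain k where k: "totient n = Suc k" using assms(2) by (metis gr0_implies_Suc totient_gt_0_iff)
  have "a ^ k * (a * b) \<in> H"
    using assms mod_subgroup_power[OF assms(1)] mod_subgroupD(3)[OF assms(1)] by blast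
  moreover have "[a ^ k * (a * b) = 1 * b] (mod n)"
    using cong_mult[OF euler_theorem[OF mod_subgroupD(1)[OF assms(1,3)]] cong_refl, of b] k
    by (simp add: mult_ac)
  ultimately show ?thesis using mod_subgroupD(4)[OF assms(1)] by simp
qed

text \<open>A homomorphism from \<open>H\<close> to the nonzero complex numbers. Values outside
  \<open>H\<close> are left arbitrary, so that an extension may be any function that agrees on
  \<open>H\<close>.\<close>

definition partial_character :: "nat \<Rightarrow> nat set \<Rightarrow> (nat \<Rightarrow> complex) \<Rightarrow> bool" where
  "partial_character n H \<chi> \<longleftrightarrow> mod_subgroup n H \<and> (\<forall>a\<in>H. \<chi> a \<noteq> 0) \<and>
     (\<forall>a\<in>H. \<forall>b\<in>H. \<chi> (a * b) = \<chi> a * \<chi> b) \<and> (\<forall>a\<in>H. \<forall>b. [a = b] (mod n) \<longrightarrow> \<chi> a = \<chi> b)"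

lemma partial_characterD:
  assumes "partial_character n H \<chi>"
  shows "mod_subgroup n H" "a \<in> H \<Longrightarrow> \<chi> a \<noteq> 0" "a \<in> H \<Longrightarrow> b \<in> H \<Longrightarrow> \<chi> (a * b) = \<chi> a * \<chi> b"
    "a \<in> H \<Longrightarrow> [a = b] (mod n) \<Longrightarrow> \<chi> a = \<chi> b"
  using assms unfolding partial_character_def by auto

lemma partial_character_power:
  assumes "partial_character n H \<chi>" "a \<in> H"
  shows "\<chi> (a ^ k) = \<chi> a ^ k"
proof (induction k)
  case 0
  have "\<chi> (1 * 1) = \<chi> 1 * \<chi> 1" "\<chi> 1 \<noteq> 0"
    using partial_characterD(2,3)[OF assms(1)] mod_subgroupD(2)[OF partial_characterD(1)[OF assms(1)]] by blast+
  then show ?case by simp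
next
  case (Suc k)
  then show ?case
    using partial_characterD(3)[OF assms(1), of a "a ^ k"] assms
      mod_subgroup_power[OF partial_characterD(1)[OF assms(1)]] by simp
qed

lemma least_power_in_subgroup_dvd:
  assumes "mod_subgroup n H" "n > 0" "coprime b n"
    and r: "r > 0" "b ^ r \<in> H" "\<And>i. 0 < i \<Longrightarrow> i < r \<Longrightarrow> b ^ i \<notin> H"
    and "b ^ i \<in> H"
  shows "r dvd i"
proof -
  have "b ^ i = (b ^ r) ^ (i div r) * b ^ (i mod r)"
    by (metis mult_div_mod_eq power_add power_mult)
  then have "b ^ (i mod r) \<in> H"
    using mod_subgroup_cancel[OF assms(1,2) mod_subgroup_power[OF assms(1) r(2)]] assms(7) by metis
  then have "i mod r = 0" using r(1) r(3)[of "i mod r"] by auto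
  then show ?thesis by auto
qed

text \<open>Adjoining one element \<open>b\<close> whose order modulo \<open>H\<close> is
  \<open>r\<close>: the value at \<open>k * b ^ i\<close> has to be
  \<open>\<chi> k * \<zeta> ^ i\<close>, and the equation for \<open>\<zeta>\<close> is exactly what
  makes this well defined. The root \<open>\<zeta>\<close> is a parameter because a separating
  character needs a nontrivial choice of it.\<close>

lemma partial_character_extend:
  assumes \<chi>: "partial_character n H \<chi>" and n: "n > 0" and b: "coprime b n"
    and r: "r > 0" "b ^ r \<in> H" "\<And>i. 0 < i \<Longrightarrow> i < r \<Longrightarrow> b ^ i \<notin> H"
    and \<zeta>: "\<zeta> ^ r = \<chi> (b ^ r)"
  obtains H' \<chi>' where "partial_character n H' \<chi>'" "H \<subseteq> H'" "b \<in> H'" "\<chi>' b = \<zeta>"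
    "\<And>a. a \<in> H \<Longrightarrow> \<chi>' a = \<chi> a"
proof -
  note H = partial_characterD(1)[OF \<chi>]
  note HD = mod_subgroupD[OF H]
  note \<chi>D = partial_characterD[OF \<chi>]
  define R where "R = (\<lambda>x k i. k \<in> H \<and> [x = k * b ^ i] (mod n))"
  have \<zeta>0: "\<zeta> \<noteq> 0" using \<zeta> \<chi>D(2)[OF r(2)] r(1) by (metis power_0_left less_not_refl)
  have \<zeta>i: "\<zeta> ^ i = \<chi> (b ^ i)" if i: "b ^ i \<in> H" for i
  proof -
    obtain j where j: "i = r * j" using least_power_in_subgroup_dvd[OF H n b r i] by auto
    show ?thesis using partial_character_power[OF \<chi> r(2), of j] \<zeta> by (simp add: j power_mult)
  qed
  \<comment> \<open>Two representations of the same residue differ by \<open>b ^ (i - j)\<close>,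
    which then lies in \<open>H\<close>, where powers of \<open>\<zeta>\<close> and values of
    \<open>\<chi>\<close> agree.\<close>
  have wd': "\<chi> k * \<zeta> ^ i = \<chi> k' * \<zeta> ^ j" if R1: "R x k i" and R2: "R x k' j" and le: "j \<le> i" for x k i k' j
  proof -
    have "[k * b ^ i = k' * b ^ j] (mod n)"
      using R1 R2 unfolding R_def by (metis cong_sym cong_trans)
    moreover have "b ^ i = b ^ (i - j) * b ^ j" using le by (simp flip: power_add)
    ultimately have "[(k * b ^ (i - j)) * b ^ j = k' * b ^ j] (mod n)" by (simp add: mult.assoc)
    then have c: "[k * b ^ (i - j) = k'] (mod n)"
      using b by (simp add: cong_mult_rcancel_nat coprime_commute)
    then have inH: "k * b ^ (i - j) \<in> H" using HD(4)[of k'] R2 unfolding R_def by (meson cong_sym)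
    then have bH: "b ^ (i - j) \<in> H" using mod_subgroup_cancel[OF H n] R1 unfolding R_def by blast
    have "\<chi> k' = \<chi> k * \<zeta> ^ (i - j)"
      using \<chi>D(4)[OF inH c] \<chi>D(3)[OF _ bH, of k] \<zeta>i[OF bH] R1 unfolding R_def by simp
    then show ?thesis using le by (simp add: mult.assoc flip: power_add)
  qed
  have wd: "\<chi> k * \<zeta> ^ i = \<chi> k' * \<zeta> ^ j" if "R x k i" "R x k' j" for x k i k' j
    using wd'[of x k i k' j] wd'[of x k' j k i] that by (cases "j \<le> i") auto
  define H' where "H' = {x. \<exists>k i. R x k i}"
  define \<chi>' where "\<chi>' = (\<lambda>x. THE v. \<exists>k i. R x k i \<and> v = \<chi> k * \<zeta> ^ i)"
  have \<chi>'eq: "\<chi>' x = \<chi> k * \<zeta> ^ i" if "R x k i" for x k i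
    unfolding \<chi>'_def
  proof (rule the_equality)
    show "\<exists>k' i'. R x k' i' \<and> \<chi> k * \<zeta> ^ i = \<chi> k' * \<zeta> ^ i'" using that by blast
    show "v = \<chi> k * \<zeta> ^ i" if "\<exists>k' i'. R x k' i' \<and> v = \<chi> k' * \<zeta> ^ i'" for v
      using that wd[OF _ \<open>R x k i\<close>] by blast
  qed
  have Rcong: "R y k i" if "R x k i" "[x = y] (mod n)" for x y k i
    using that unfolding R_def by (meson cong_sym cong_trans)
  have Rmult: "R (x * y) (k * k') (i + j)" if "R x k i" "R y k' j" for x y k k' i j
    using that HD(3) cong_mult[of x "k * b ^ i" n y "k' * b ^ j"] unfolding R_def
    by (auto simp: power_add mult_ac)
  have RH: "R a a 0" if "a \<in> H" for a using that by (simp add: R_def)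
  have Rb: "R b 1 1" using HD(2) by (simp add: R_def)
  have \<chi>1: "\<chi> 1 = 1" using partial_character_power[OF \<chi> HD(2), of 0] by simp
  have "partial_character n H' \<chi>'" unfolding partial_character_def
  proof (intro conjI ballI allI impI)
    show "mod_subgroup n H'"
      unfolding mod_subgroup_def
    proof (intro conjI ballI allI impI subsetI)
      fix x assume "x \<in> H'"
      then obtain k i where "k \<in> H" "[x = k * b ^ i] (mod n)" by (auto simp: H'_def R_def)
      then show "x \<in> {a. coprime a n}" using HD(1)[of k] b
        by (metis coprime_mult_left_iff coprime_power_left_iff mem_Collect_eq cong_imp_coprime cong_sym)
    next
      show "1 \<in> H'" using RH[OF HD(2)] by (auto simp: H'_def)
    next
      fix x y assume "x \<in> H'" "y \<in> H'"
      then show "x * y \<in> H'" using Rmult unfolding H'_def by blast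
    next
      fix x y assume "x \<in> H'" "[x = y] (mod n)"
      then show "y \<in> H'" using Rcong unfolding H'_def by blast
    qed
  next
    fix x assume "x \<in> H'"
    then obtain k i where "R x k i" by (auto simp: H'_def)
    then show "\<chi>' x \<noteq> 0" using \<chi>'eq[of x k i] \<zeta>0 \<chi>D(2)[of k] by (auto simp: R_def)
  next
    fix x y assume "x \<in> H'" "y \<in> H'"
    then obtain k i k' j where *: "R x k i" "R y k' j" by (auto simp: H'_def)
    then show "\<chi>' (x * y) = \<chi>' x * \<chi>' y"
      using \<chi>'eq[OF Rmult[OF *]] \<chi>'eq[OF *(1)] \<chi>'eq[OF *(2)] \<chi>D(3)[of k k']
      by (simp add: power_add R_def mult_ac)
  next
    fix x y assume "x \<in> H'" "[x = y] (mod n)"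
    then obtain k i where "R x k i" "R y k i" using Rcong by (auto simp: H'_def)
    then show "\<chi>' x = \<chi>' y" using \<chi>'eq by simp
  qed
  moreover have "H \<subseteq> H'" using RH by (auto simp: H'_def)
  moreover have "b \<in> H'" using Rb by (auto simp: H'_def)
  moreover have "\<chi>' b = \<zeta>" using \<chi>'eq[OF Rb] \<chi>1 by simp
  moreover have "\<chi>' a = \<chi> a" if "a \<in> H" for a using \<chi>'eq[OF RH[OF that]] by simp
  ultimately show ?thesis using that by blast
qed

lemma least_power_in_subgroup:
  assumes "mod_subgroup n H" "n > 0" "coprime b n"
  obtains r where "r > 0" "b ^ r \<in> H" "\<And>i. 0 < i \<Longrightarrow> i < r \<Longrightarrow> b ^ i \<notin> H"
proof -
  define P where "P = (\<lambda>r. r > 0 \<and> b ^ r \<in> H)"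
  have "P (totient n)"
    using assms mod_subgroupD(4)[OF assms(1) mod_subgroupD(2)[OF assms(1)] cong_sym[OF euler_theorem[OF assms(3)]]]
    by (simp add: P_def)
  then have "P (LEAST r. P r)" by (rule LeastI)
  moreover have "\<not> P i" if "i < (LEAST r. P r)" for i using that by (rule not_less_Least)
  ultimately show ?thesis using that unfolding P_def by blast
qed

lemma complex_nth_root_exists:
  fixes z :: complex
  assumes "r > 0"
  obtains w where "w ^ r = z"
proof -
  have "rcis (root r (norm z)) (Arg z / real r) ^ r = rcis (norm z) (Arg z)"
    using assms by (simp add: DeMoivre2)
  then show ?thesis using that by (simp add: rcis_cmod_Arg)
qed

text \<open>Each adjunction lowers the number of reduced residues outside \<open>H\<close>. When
  none is left, the function is set to 0 at arguments not coprime to \<open>n\<close>.\<close>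

lemma partial_character_extend_full:
  assumes "partial_character n H \<chi>" "n > 0"
  obtains \<psi> where "dcharacter n \<psi>" "\<And>a. a \<in> H \<Longrightarrow> \<psi> a = \<chi> a"
  using assms(1)
proof (induction "card {a. a < n \<and> coprime a n \<and> a \<notin> H}" arbitrary: H \<chi> thesis rule: less_induct)
  case less
  note H = partial_characterD(1)[OF less.prems(2)]
  show ?case
  proof (cases "\<exists>b<n. coprime b n \<and> b \<notin> H")
    case True
    then obtain b where b: "b < n" "coprime b n" "b \<notin> H" by auto
    obtain r where r: "r > 0" "b ^ r \<in> H" "\<And>i. 0 < i \<Longrightarrow> i < r \<Longrightarrow> b ^ i \<notin> H"
      using least_power_in_subgroup[OF H assms(2) b(2)] by blast
    obtain \<zeta> where \<zeta>: "\<zeta> ^ r = \<chi> (b ^ r)" using complex_nth_root_exists[OF r(1)] by blast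
    obtain H' \<chi>' where H': "partial_character n H' \<chi>'" "H \<subseteq> H'" "b \<in> H'" 
        "\<And>a. a \<in> H \<Longrightarrow> \<chi>' a = \<chi> a"
      using partial_character_extend[OF less.prems(2) assms(2) b(2) r \<zeta>] by blast
    have "card {a. a < n \<and> coprime a n \<and> a \<notin> H'} < card {a. a < n \<and> coprime a n \<and> a \<notin> H}"
      by (rule psubset_card_mono) (use H' b in auto)
    from less.hyps[OF this _ H'(1)] obtain \<psi> where "dcharacter n \<psi>" "\<And>a. a \<in> H' \<Longrightarrow> \<psi> a = \<chi>' a" by blast
    then show ?thesis using less.prems(1)[of \<psi>] H' by (metis subsetD)
  next
    case False
    have inH: "a \<in> H" if "coprime a n" for a
    proof -
      have "a mod n \<in> H" using False that assms(2) by auto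
      then show ?thesis using mod_subgroupD(4)[OF H, of "a mod n" a] by simp
    qed
    define \<psi> where "\<psi> = (\<lambda>a. if coprime a n then \<chi> a else 0)"
    have "dcharacter n \<psi>"
      unfolding dcharacter_def
    proof (intro conjI allI impI)
      fix a b
      show "(\<psi> a = 0) = (\<not> coprime a n)"
        using partial_characterD(2)[OF less.prems(2)] inH by (auto simp: \<psi>_def)
      show "\<psi> (a * b) = \<psi> a * \<psi> b"
        using partial_characterD(3)[OF less.prems(2)] inH by (auto simp: \<psi>_def)
      assume "[a = b] (mod n)"
      then show "\<psi> a = \<psi> b" using partial_characterD(4)[OF less.prems(2)] inH
        by (metis \<psi>_def cong_imp_coprime cong_sym)
    qed
    then show ?thesis using less.prems(1)[of \<psi>] mod_subgroupD(1)[OF H] by (auto simp: \<psi>_def)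
  qed
qed

section \<open>Annihilators and orthogonality\<close>

definition annihilator :: "nat \<Rightarrow> nat set \<Rightarrow> (nat \<Rightarrow> complex) set" where
  "annihilator n H = {\<chi>. dcharacter n \<chi> \<and> (\<forall>a\<in>H. \<chi> a = 1)}"

text \<open>The trivial character of \<open>H\<close> is extended to \<open>b\<close> by a primitive
  \<open>r\<close>-th root of unity, where \<open>r \<ge> 2\<close> is the order of \<open>b\<close>
  modulo \<open>H\<close>.\<close>

lemma separating_character:
  assumes H: "mod_subgroup n H" and n: "n > 0" and b: "coprime b n" "b \<notin> H"
  obtains \<chi> where "\<chi> \<in> annihilator n H" "\<chi> b \<noteq> 1"
proof -
  obtain r where r: "r > 0" "b ^ r \<in> H" "\<And>i. 0 < i \<Longrightarrow> i < r \<Longrightarrow> b ^ i \<notin> H"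
    using least_power_in_subgroup[OF H n b(1)] by blast
  have r2: "r \<ge> 2"
  proof (rule ccontr)
    assume "\<not> r \<ge> 2"
    then have "r = 1" using r(1) by simp
    then show False using r(2) b(2) by simp
  qed
  have triv: "partial_character n H (\<lambda>_. 1)" using H by (simp add: partial_character_def)
  define \<zeta> where "\<zeta> = cis (2 * pi / real r)"
  have "\<zeta> ^ r = 1" using r(1) by (simp add: \<zeta>_def DeMoivre)
  have "\<zeta> \<noteq> 1"
  proof
    assume "\<zeta> = 1"
    then have "cos (2 * pi / real r) = 1" by (simp add: \<zeta>_def complex_eq_iff)
    moreover have "cos (2 * pi / real r) < cos 0"
    proof (cases "r = 2")
      case False
      then show ?thesis using r2 
        by (intro cos_monotone_0_pi) (auto simp: field_simps)
    qed simp
    ultimately show False by simp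
  qed
  obtain H' \<chi>' where H': "partial_character n H' \<chi>'" "H \<subseteq> H'" "b \<in> H'" "\<chi>' b = \<zeta>"
      "\<And>a. a \<in> H \<Longrightarrow> \<chi>' a = 1"
    using partial_character_extend[OF triv n b(1) r] \<open>\<zeta> ^ r = 1\<close> by metis
  obtain \<psi> where "dcharacter n \<psi>" "\<And>a. a \<in> H' \<Longrightarrow> \<psi> a = \<chi>' a"
    using partial_character_extend_full[OF H'(1) n] by blast
  moreover have "\<psi> a = 1" if "a \<in> H" for a using calculation(2)[of a] H'(2,5) that by auto
  ultimately show ?thesis using that[of \<psi>] H'(3,4) \<open>\<zeta> \<noteq> 1\<close> by (simp add: annihilator_def)
qed

lemma finite_annihilator: "n > 0 \<Longrightarrow> finite (annihilator n H)"
  by (rule finite_subset[OF _ finite_dcharacters]) (auto simp: annihilator_def)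

text \<open>For a reduced residue outside \<open>H\<close>, multiplication by a separating character
  permutes the annihilator and multiplies the sum by a number other than 1.\<close>

lemma sum_annihilator:
  assumes H: "mod_subgroup n H" and n: "n > 0"
  shows "(\<Sum>\<chi>\<in>annihilator n H. \<chi> a) = (if a \<in> H then of_nat (card (annihilator n H)) else 0)"
proof -
  consider "a \<in> H" | "\<not> coprime a n" | "coprime a n" "a \<notin> H" by blast
  then show ?thesis
  proof cases
    case 1
    then show ?thesis by (simp add: annihilator_def)
  next
    case 2
    then have "a \<notin> H" using mod_subgroupD(1)[OF H] by auto
    moreover have "\<chi> a = 0" if "\<chi> \<in> annihilator n H" for \<chi>
      using that 2 dcharacterD(1)[of n \<chi> a] by (simp add: annihilator_def)
    ultimately show ?thesis by (simp add: sum.neutral)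
  next
    case 3
    obtain \<psi> where \<psi>: "\<psi> \<in> annihilator n H" "\<psi> a \<noteq> 1" using separating_character[OF H n 3] by blast
    let ?f = "\<lambda>\<chi> c. \<psi> c * \<chi> c"
    have inj: "inj_on ?f (annihilator n H)"
    proof (rule inj_onI, rule ext)
      fix \<chi>1 \<chi>2 c assume h: "\<chi>1 \<in> annihilator n H" "\<chi>2 \<in> annihilator n H" "?f \<chi>1 = ?f \<chi>2"
      have e: "\<psi> c * \<chi>1 c = \<psi> c * \<chi>2 c" using h(3) by meson
      show "\<chi>1 c = \<chi>2 c"
      proof (cases "coprime c n")
        case True
        then have "\<psi> c \<noteq> 0" using \<psi>(1) dcharacterD(1)[of n \<psi> c] by (simp add: annihilator_def)
        then show ?thesis using e by simp
      next
        case False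
        then have "\<chi>1 c = 0" "\<chi>2 c = 0" using h dcharacterD(1)[of n _ c] by (simp_all add: annihilator_def)
        then show ?thesis by simp
      qed
    qed
    have img: "?f ` annihilator n H = annihilator n H"
      by (rule card_subset_eq)
         (use finite_annihilator[OF n] card_image[OF inj] \<psi>(1) dcharacter_times in \<open>auto simp: annihilator_def\<close>)
    have "(\<Sum>\<chi>\<in>annihilator n H. \<chi> a) = (\<Sum>\<chi>\<in>annihilator n H. \<psi> a * \<chi> a)"
      by (subst img[symmetric], subst sum.reindex[OF inj]) simp
    also have "\<dots> = \<psi> a * (\<Sum>\<chi>\<in>annihilator n H. \<chi> a)" by (simp add: sum_distrib_left)
    finally show ?thesis using \<psi>(2) 3 by simp
  qed
qed

definition principal_character :: "nat \<Rightarrow> nat \<Rightarrow> complex" where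
  "principal_character n a = (if coprime a n then 1 else 0)"

lemma dcharacter_principal: "dcharacter n (principal_character n)"
  unfolding dcharacter_def principal_character_def by (auto dest: cong_imp_coprime cong_sym)

lemma principal_in_annihilator: "mod_subgroup n H \<Longrightarrow> principal_character n \<in> annihilator n H"
  using dcharacter_principal mod_subgroupD(1) by (auto simp: annihilator_def principal_character_def)

lemma nonprincipal_witness:
  assumes "dcharacter n \<chi>" "\<chi> \<noteq> principal_character n"
  obtains b where "coprime b n" "\<chi> b \<noteq> 1"
proof -
  obtain b where "\<chi> b \<noteq> principal_character n b" using assms(2) by auto
  then show ?thesis using that[of b] dcharacterD(1)[OF assms(1), of b]
    by (auto simp: principal_character_def split: if_splits)
qed

text \<open>Totatives lie in 1..n and the periodic sums run over 0..n-1. The ranges differ by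
  \<open>n\<close> against 0, which matters for \<open>n = 1\<close>.\<close>

lemma sum_periodic_totatives:
  fixes f :: "nat \<Rightarrow> 'a :: comm_monoid_add"
  assumes "n > 0" "f n = f 0" "\<And>a. \<not> coprime a n \<Longrightarrow> f a = 0"
  shows "(\<Sum>a\<in>totatives n. f a) = (\<Sum>a<n. f a)"
proof -
  have "(\<Sum>a\<in>totatives n. f a) = (\<Sum>a\<in>{1..n}. f a)"
    by (rule sum.mono_neutral_left) (use assms in \<open>auto simp: totatives_def\<close>)
  also have "\<dots> = (\<Sum>a\<in>{1..<n}. f a) + f n"
    using assms(1) by (cases n) (auto simp: atLeastLessThanSuc_atLeastAtMost)
  also have "\<dots> = (\<Sum>a\<in>{0..<n}. f a)"
    using assms(1,2) by (simp add: sum.atLeast_Suc_lessThan add.commute)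
  finally show ?thesis by (simp add: atLeast0LessThan)
qed

lemma dcharacter_sum_totatives:
  assumes "dcharacter n \<chi>" "n > 0"
  shows "(\<Sum>a\<in>totatives n. \<chi> a) = (if \<chi> = principal_character n then of_nat (totient n) else 0)"
proof (cases "\<chi> = principal_character n")
  case True
  then show ?thesis by (simp add: principal_character_def totatives_def totient_def)
next
  case False
  obtain b where "coprime b n" "\<chi> b \<noteq> 1" using nonprincipal_witness[OF assms(1) False] by blast
  then have "(\<Sum>a<n. \<chi> a) = 0" using dcharacter_sum_0 assms by blast
  moreover have "\<chi> n = \<chi> 0" by (rule dcharacterD(3)[OF assms(1)]) (simp add: Cong.cong_def)
  ultimately show ?thesis using False sum_periodic_totatives[of n \<chi>] assms(2) dcharacterD(1)[OF assms(1)]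
    by simp
qed

text \<open>Summing all values of the annihilator over the totatives in both orders. It identifies
  the density of \<open>H\<close> among the reduced residues as the reciprocal of the size of the
  annihilator.\<close>

lemma card_annihilator:
  assumes H: "mod_subgroup n H" and n: "n > 0"
  shows "card (annihilator n H) * card (totatives n \<inter> H) = totient n"
proof -
  have "of_nat (card (annihilator n H) * card (totatives n \<inter> H)) =
      (\<Sum>a\<in>totatives n. if a \<in> H then of_nat (card (annihilator n H)) else 0 :: complex)"
    by (simp add: sum.If_cases)
  also have "\<dots> = (\<Sum>\<chi>\<in>annihilator n H. \<Sum>a\<in>totatives n. \<chi> a)"
    by (subst sum.swap) (simp add: sum_annihilator[OF H n])
  also have "\<dots> = (\<Sum>\<chi>\<in>annihilator n H. if \<chi> = principal_character n then of_nat (totient n) else 0)"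
    by (intro sum.cong refl dcharacter_sum_totatives) (use n in \<open>auto simp: annihilator_def\<close>)
  also have "\<dots> = of_nat (totient n)"
    using principal_in_annihilator[OF H] finite_annihilator[OF n] by (simp add: sum.delta)
  finally show ?thesis by (simp only: of_nat_eq_iff)
qed

text \<open>Every character annihilates the residue class of 1, so the count of an annihilator
  applies to that subgroup.\<close>

lemma card_dcharacters_le:
  assumes "n > 0"
  shows "card {\<chi>. dcharacter n \<chi>} \<le> n"
proof -
  let ?H = "{a. [a = 1] (mod n)}"
  have H: "mod_subgroup n ?H"
    unfolding mod_subgroup_def
  proof (intro conjI ballI allI impI subsetI)
    show "a \<in> {a. coprime a n}" if "a \<in> ?H" for a
      using that cong_imp_coprime[of 1 a n] by (simp add: cong_sym_eq)
    show "a * b \<in> ?H" if "a \<in> ?H" "b \<in> ?H" for a b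
      using that cong_mult[of a 1 n b 1] by simp
    show "b \<in> ?H" if "a \<in> ?H" "[a = b] (mod n)" for a b
      using that by (metis cong_sym cong_trans mem_Collect_eq)
  qed simp
  have "annihilator n ?H = {\<chi>. dcharacter n \<chi>}"
    using dcharacterD(3) dcharacter_1 by (auto simp: annihilator_def) metis
  then have "card {\<chi>. dcharacter n \<chi>} * card (totatives n \<inter> ?H) = totient n"
    using card_annihilator[OF H assms] by simp
  then have "card {\<chi>. dcharacter n \<chi>} dvd totient n" by (metis dvd_triv_left)
  then have "card {\<chi>. dcharacter n \<chi>} \<le> totient n" using assms by (intro dvd_imp_le) auto
  then show ?thesis using totient_le[of n] by linarith
qed

section \<open>Primitive characters\<close>

definition primitive_character :: "nat \<Rightarrow> (nat \<Rightarrow> complex) \<Rightarrow> bool" where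
  "primitive_character m \<psi> \<longleftrightarrow> dcharacter m \<psi> \<and>
     (\<forall>d \<psi>'. d dvd m \<longrightarrow> dcharacter d \<psi>' \<longrightarrow> (\<forall>a. coprime a m \<longrightarrow> \<psi> a = \<psi>' a) \<longrightarrow> d = m)"

lemma induced_by_primitive:
  assumes "dcharacter n \<chi>" "n > 0"
  obtains m \<psi> where "m dvd n" "primitive_character m \<psi>" "\<And>a. coprime a n \<Longrightarrow> \<chi> a = \<psi> a"
proof -
  define P where "P = (\<lambda>m. m dvd n \<and> (\<exists>\<psi>. dcharacter m \<psi> \<and> (\<forall>a. coprime a n \<longrightarrow> \<chi> a = \<psi> a)))"
  have "P n" using assms(1) by (auto simp: P_def)
  define m where "m = (LEAST m. P m)"
  have "P m" unfolding m_def using \<open>P n\<close> by (rule LeastI)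
  then obtain \<psi> where \<psi>: "m dvd n" "dcharacter m \<psi>" "\<And>a. coprime a n \<Longrightarrow> \<chi> a = \<psi> a"
    by (auto simp: P_def)
  have "primitive_character m \<psi>" unfolding primitive_character_def
  proof (intro conjI allI impI)
    fix d \<psi>' assume d: "d dvd m" "dcharacter d \<psi>'" "\<forall>a. coprime a m \<longrightarrow> \<psi> a = \<psi>' a"
    have "\<chi> a = \<psi>' a" if "coprime a n" for a
      using that \<psi> d by (metis coprime_divisors dvd_refl)
    then have "P d" using d \<psi>(1) unfolding P_def by (metis dvd_trans)
    then have "m \<le> d" unfolding m_def by (rule Least_le)
    moreover have "d \<le> m" using d(1) \<psi>(1) assms(2) by (intro dvd_imp_le) (auto intro: Nat.gr0I)
    ultimately show "d = m" by simp
  qed (rule \<psi>(2))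
  then show ?thesis using that \<psi> by blast
qed

text \<open>Let \<open>t\<close> be the product of the primes of \<open>N\<close> that do not divide
  \<open>a\<close>. Then every prime of \<open>N\<close> divides exactly one of \<open>a\<close> and
  \<open>g * t\<close>, hence not their sum.\<close>

lemma coprime_representative:
  fixes a g N :: nat
  assumes "coprime a g" "N > 0"
  obtains b where "[b = a] (mod g)" "coprime b N"
proof -
  define t where "t = \<Prod>{p \<in> prime_factors N. \<not> p dvd a}"
  define b where "b = a + g * t"
  have fin: "finite {p \<in> prime_factors N. \<not> p dvd a}" by simp
  have "coprime b N"
  proof (rule ccontr)
    assume "\<not> coprime b N"
    then obtain p where p: "prime p" "p dvd b" "p dvd N"
      by (metis prime_factor_nat coprime_iff_gcd_eq_1 gcd_dvd1 gcd_dvd2 dvd_trans)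
    show False
    proof (cases "p dvd a")
      case True
      then have "p dvd g * t" using p(2) by (simp add: b_def dvd_add_right_iff)
      moreover have "\<not> p dvd g" using True assms(1) p(1) by (metis coprime_common_divisor not_prime_unit)
      ultimately have "p dvd t" using p(1) by (simp add: prime_dvd_mult_iff)
      then obtain q where q: "q \<in> prime_factors N" "\<not> q dvd a" "p dvd q"
        using prime_dvd_prod_iff[OF fin p(1), of "\<lambda>x. x"] unfolding t_def by auto
      then have "p = q" using p(1) by (metis in_prime_factors_imp_prime primes_dvd_imp_eq)
      then show False using q True by simp
    next
      case False
      then have "p \<in> {p \<in> prime_factors N. \<not> p dvd a}" using p assms(2) by (simp add: in_prime_factors_iff)
      then have "p dvd t" unfolding t_def using dvd_prodI[OF fin, of p "\<lambda>x. x"] by auto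
      then have "p dvd g * t" by simp
      then show False using False p(2) by (simp add: b_def dvd_add_left_iff)
    qed
  qed
  moreover have "[b = a] (mod g)" by (simp add: b_def Cong.cong_def)
  ultimately show ?thesis using that by blast
qed

lemma chinese_remainder_gcd:
  fixes a b m n :: nat
  assumes "[a = b] (mod gcd m n)" "n > 0"
  obtains c where "[c = a] (mod m)" "[c = b] (mod n)"
proof -
  \<comment> \<open>A representative of \<open>b\<close> modulo \<open>n\<close> that is at least
    \<open>a\<close>, so that the difference exists in the natural numbers.\<close>
  define b' where "b' = b + n * a"
  have "a \<le> b'" using assms(2) by (simp add: b'_def trans_le_add2)
  have bb: "[b' = b] (mod n)" by (simp add: b'_def Cong.cong_def)
  then have "[b' = b] (mod gcd m n)" by (meson cong_dvd_modulus_nat gcd_dvd2)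
  then have "[a = b'] (mod gcd m n)" using assms(1) by (metis cong_sym cong_trans)
  then obtain w where w: "b' = a + gcd m n * w"
    using \<open>a \<le> b'\<close> by (metis cong_altdef_nat' cong_sym dvdE le_add_diff_inverse dvd_diff_nat cong_altdef_nat)
  obtain u where u: "[m * u = gcd m n] (mod n)"
    using cong_solve_nat[of m n] by blast
  have "[m * u * w = gcd m n * w] (mod n)" using u by (rule cong_mult) simp
  then have "[a + m * u * w = b'] (mod n)" unfolding w by (rule cong_add[OF cong_refl])
  then have "[a + m * u * w = b] (mod n)" using bb by (rule cong_trans)
  moreover have "[a + m * u * w = a] (mod m)" by (simp add: Cong.cong_def mult.assoc)
  ultimately show ?thesis using that by blast
qed

text \<open>For \<open>a\<close> and \<open>b\<close> congruent modulo the gcd, take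
  \<open>c\<close> congruent to \<open>a\<close> modulo \<open>m\<close> and to \<open>b\<close>
  modulo \<open>n\<close>. Passing from \<open>\<psi>1 a\<close> through
  \<open>\<psi>1 c = \<psi>2 c\<close> and \<open>\<psi>2 b\<close> to \<open>\<psi>1 b\<close>
  shows that \<open>\<psi>1\<close> depends only on the residue modulo the gcd. Arguments coprime
  only to the gcd are evaluated at a representative coprime to \<open>m * n\<close>.\<close>

lemma dcharacter_gcd_descent:
  assumes \<psi>1: "dcharacter m \<psi>1" and \<psi>2: "dcharacter n \<psi>2" and pos: "m > 0" "n > 0"
    and eq: "\<And>a. coprime a (m * n) \<Longrightarrow> \<psi>1 a = \<psi>2 a"
  obtains \<psi> where "dcharacter (gcd m n) \<psi>" "\<And>a. coprime a m \<Longrightarrow> \<psi>1 a = \<psi> a"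
proof -
  have key: "\<psi>1 a = \<psi>1 b" if a: "coprime a m" and b: "coprime b (m * n)" and ab: "[a = b] (mod gcd m n)" for a b
  proof -
    obtain c where c: "[c = a] (mod m)" "[c = b] (mod n)" using chinese_remainder_gcd[OF ab pos(2)] by blast
    have "coprime c m" "coprime c n"
      using c a b cong_imp_coprime[OF cong_sym] by auto
    then have "\<psi>1 c = \<psi>2 c" by (intro eq) simp
    moreover have "\<psi>1 c = \<psi>1 a" "\<psi>2 c = \<psi>2 b" using c dcharacterD(3) \<psi>1 \<psi>2 by blast+
    moreover have "\<psi>1 b = \<psi>2 b" using eq b by blast
    ultimately show ?thesis by simp
  qed
  define rep where "rep = (\<lambda>a. SOME b. [b = a] (mod gcd m n) \<and> coprime b (m * n))"
  have rep: "[rep a = a] (mod gcd m n)" "coprime (rep a) (m * n)" if "coprime a (gcd m n)" for a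
  proof -
    have "\<exists>b. [b = a] (mod gcd m n) \<and> coprime b (m * n)"
      using coprime_representative[OF that, of "m * n"] pos by (metis nat_0_less_mult_iff)
    then have "[rep a = a] (mod gcd m n) \<and> coprime (rep a) (m * n)"
      unfolding rep_def by (rule someI_ex)
    then show "[rep a = a] (mod gcd m n)" "coprime (rep a) (m * n)" by auto
  qed
  define \<psi> where "\<psi> = (\<lambda>a. if coprime a (gcd m n) then \<psi>1 (rep a) else 0)"
  have key2: "\<psi>1 a = \<psi> a" if "coprime a m" for a
  proof -
    have "coprime a (gcd m n)" using that by (metis coprime_divisors dvd_refl gcd_dvd1)
    then show ?thesis using key[OF that rep(2) cong_sym[OF rep(1)]] by (simp add: \<psi>_def)
  qed
  have repm: "coprime (rep a) m" if "coprime a (gcd m n)" for a using rep(2)[OF that] by simp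
  have "dcharacter (gcd m n) \<psi>" unfolding dcharacter_def
  proof (intro conjI allI impI)
    fix a b
    show "(\<psi> a = 0) = (\<not> coprime a (gcd m n))"
      using dcharacterD(1)[OF \<psi>1, of "rep a"] repm[of a] by (auto simp: \<psi>_def)
    show "\<psi> (a * b) = \<psi> a * \<psi> b"
    proof (cases "coprime a (gcd m n) \<and> coprime b (gcd m n)")
      case True
      then have ab: "coprime (a * b) (gcd m n)" by simp
      have "[rep a * rep b = rep (a * b)] (mod gcd m n)"
        using rep(1) True ab by (metis cong_mult cong_sym cong_trans)
      moreover have "coprime (rep a * rep b) m"
        using repm[OF conjunct1[OF True]] repm[OF conjunct2[OF True]] by simp
      ultimately have "\<psi>1 (rep a * rep b) = \<psi>1 (rep (a * b))"
        using key[OF _ rep(2)[OF ab]] by blast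
      then show ?thesis using True ab dcharacterD(2)[OF \<psi>1] by (simp add: \<psi>_def)
    qed (auto simp: \<psi>_def)
    assume ab: "[a = b] (mod gcd m n)"
    show "\<psi> a = \<psi> b"
    proof (cases "coprime a (gcd m n)")
      case True
      then have b: "coprime b (gcd m n)" using ab cong_imp_coprime by blast
      have "[rep a = rep b] (mod gcd m n)"
        using rep(1)[OF True] rep(1)[OF b] ab by (meson cong_sym cong_trans)
      then show ?thesis using key[OF repm[OF True] rep(2)[OF b]] True b by (simp add: \<psi>_def)
    next
      case False
      then show ?thesis using ab cong_imp_coprime[OF cong_sym[OF ab]] by (auto simp: \<psi>_def)
    qed
  qed
  then show ?thesis using that key2 by blast
qed

lemma primitive_character_unique:
  assumes "primitive_character m \<psi>1" "primitive_character n \<psi>2" "m > 0" "n > 0"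
    and eq: "\<And>a. coprime a (m * n) \<Longrightarrow> \<psi>1 a = \<psi>2 a"
  shows "m = n" "\<psi>1 = \<psi>2"
proof -
  have d: "dcharacter m \<psi>1" "dcharacter n \<psi>2" using assms by (auto simp: primitive_character_def)
  obtain \<psi> where "dcharacter (gcd m n) \<psi>" "\<And>a. coprime a m \<Longrightarrow> \<psi>1 a = \<psi> a"
    using dcharacter_gcd_descent[OF d assms(3,4) eq] by blast
  then have m: "gcd m n = m" using assms(1) unfolding primitive_character_def by (meson gcd_dvd1)
  have eq': "\<psi>2 a = \<psi>1 a" if "coprime a (n * m)" for a using eq[of a] that by (simp add: mult.commute)
  obtain \<psi>' where "dcharacter (gcd n m) \<psi>'" "\<And>a. coprime a n \<Longrightarrow> \<psi>2 a = \<psi>' a"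
    using dcharacter_gcd_descent[OF d(2,1) assms(4,3) eq'] by blast
  then have "gcd n m = n" using assms(2) unfolding primitive_character_def by (meson gcd_dvd1)
  then show mn: "m = n" using m by (simp add: gcd.commute)
  show "\<psi>1 = \<psi>2"
  proof
    fix a show "\<psi>1 a = \<psi>2 a"
      using eq[of a] dcharacterD(1)[OF d(1), of a] dcharacterD(1)[OF d(2), of a] mn
      by (cases "coprime a m") auto
  qed
qed

text \<open>Supplies the cancellation in the off-diagonal terms of the large sieve: the product of
  one primitive character with the conjugate of another sums to 0 over a period.\<close>

lemma primitive_product_nonprincipal:
  assumes "primitive_character m \<psi>1" "primitive_character n \<psi>2" "m > 0" "n > 0" "(m, \<psi>1) \<noteq> (n, \<psi>2)"
  obtains b where "coprime b (m * n)" "\<psi>1 b * cnj (\<psi>2 b) \<noteq> 1"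
proof -
  have d: "dcharacter m \<psi>1" "dcharacter n \<psi>2" using assms by (auto simp: primitive_character_def)
  obtain b where b: "coprime b (m * n)" "\<psi>1 b \<noteq> \<psi>2 b"
    using primitive_character_unique[OF assms(1-4)] assms(5) by blast
  have "norm (\<psi>2 b) = 1" using dcharacter_norm[OF d(2) assms(4)] b(1) by simp
  then have "cnj (\<psi>2 b) * \<psi>2 b = 1" by (metis complex_norm_square mult.commute of_real_1 power_one)
  then have "\<psi>1 b * cnj (\<psi>2 b) \<noteq> 1" using b(2) by (metis mult.assoc mult_1 mult_1_right)
  then show ?thesis using that b(1) by blast
qed

section \<open>A large sieve inequality\<close>

text \<open>Convolution with an interval of length \<open>L\<close>. The \<open>A\<close>-fold
  iterate has total mass \<open>L ^ A\<close>, but on a function of period \<open>q\<close> and mean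
  zero each application contributes only a factor \<open>q\<close>. Iterating thus gains
  \<open>(q / L) ^ A\<close>.\<close>

definition box_sum :: "nat \<Rightarrow> (nat \<Rightarrow> 'a :: comm_monoid_add) \<Rightarrow> nat \<Rightarrow> 'a" where
  "box_sum L f s = (\<Sum>u<L. f (s + u))"

lemma box_sum_iter_nonneg:
  fixes f :: "nat \<Rightarrow> real"
  assumes "\<And>s. f s \<ge> 0"
  shows "(box_sum L ^^ A) f s \<ge> 0"
  using assms by (induction A arbitrary: s) (auto simp: box_sum_def intro!: sum_nonneg)

text \<open>Each \<open>a\<close> in the interval lies in the \<open>L\<close> windows that start at
  \<open>a - u\<close> with \<open>u < L\<close>. The condition \<open>L \<le> C\<close> keeps the
  subtraction from being truncated at 0.\<close>

lemma sum_box_sum_ge: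
  fixes f :: "nat \<Rightarrow> real"
  assumes "\<And>s. f s \<ge> 0" "L \<le> C"
  shows "real L * (\<Sum>a\<in>{C<..D}. f a) \<le> (\<Sum>v\<in>{C - L<..D}. box_sum L f v)"
proof -
  have "real L * (\<Sum>a\<in>{C<..D}. f a) = (\<Sum>u<L. \<Sum>a\<in>{C<..D}. f a)" by simp
  also have "\<dots> \<le> (\<Sum>u<L. \<Sum>v\<in>{C - L<..D}. f (v + u))"
  proof (rule sum_mono)
    fix u assume "u \<in> {..<L}"
    have "(\<Sum>v\<in>{C - L<..D}. f (v + u)) = (\<Sum>a\<in>(\<lambda>v. v + u) ` {C - L<..D}. f a)"
      by (subst sum.reindex) (auto simp: inj_on_def)
    also have "(\<Sum>a\<in>{C<..D}. f a) \<le> \<dots>"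
    proof (rule sum_mono2)
      show "{C<..D} \<subseteq> (\<lambda>v. v + u) ` {C - L<..D}"
      proof
        fix a assume "a \<in> {C<..D}"
        then show "a \<in> (\<lambda>v. v + u) ` {C - L<..D}"
          using \<open>u \<in> {..<L}\<close> assms(2) by (intro image_eqI[of _ _ "a - u"]) auto
      qed
    qed (use assms in auto)
    finally show "(\<Sum>a\<in>{C<..D}. f a) \<le> (\<Sum>v\<in>{C - L<..D}. f (v + u))" .
  qed
  also have "\<dots> = (\<Sum>v\<in>{C - L<..D}. box_sum L f v)" unfolding box_sum_def by (rule sum.swap)
  finally show ?thesis .
qed

lemma sum_box_sum_iter_ge:
  fixes f :: "nat \<Rightarrow> real"
  assumes "\<And>s. f s \<ge> 0" "A * L \<le> C"
  shows "real L ^ A * (\<Sum>a\<in>{C<..D}. f a) \<le> (\<Sum>v\<in>{C - A * L<..D}. (box_sum L ^^ A) f v)"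
  using assms(2)
proof (induction A)
  case (Suc A)
  have "real L ^ Suc A * (\<Sum>a\<in>{C<..D}. f a) = real L * (real L ^ A * (\<Sum>a\<in>{C<..D}. f a))" by simp
  also have "\<dots> \<le> real L * (\<Sum>v\<in>{C - A * L<..D}. (box_sum L ^^ A) f v)"
    using Suc by (intro mult_left_mono) auto
  also have "\<dots> \<le> (\<Sum>v\<in>{C - A * L - L<..D}. box_sum L ((box_sum L ^^ A) f) v)"
    using Suc.prems by (intro sum_box_sum_ge box_sum_iter_nonneg assms) auto
  finally show ?case by (simp add: add.commute)
qed simp

lemma box_sum_iter_linear:
  fixes g :: "'i \<Rightarrow> nat \<Rightarrow> complex"
  shows "(box_sum L ^^ A) (\<lambda>s. \<Sum>i\<in>I. c i * g i s) = (\<lambda>s. \<Sum>i\<in>I. c i * (box_sum L ^^ A) (g i) s)"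
proof (induction A)
  case (Suc A)
  show ?case unfolding funpow.simps o_def Suc
    unfolding box_sum_def sum_distrib_left by (intro ext) (rule sum.swap)
qed simp

lemma box_sum_iter_of_real:
  "(box_sum L ^^ A) (\<lambda>s. complex_of_real (f s)) = (\<lambda>s. of_real ((box_sum L ^^ A) f s))"
  by (induction A) (auto simp: box_sum_def)

lemma norm_box_sum_iter_le:
  fixes f :: "nat \<Rightarrow> complex"
  assumes "\<And>s. norm (f s) \<le> 1"
  shows "norm ((box_sum L ^^ A) f s) \<le> real L ^ A"
proof (induction A arbitrary: s)
  case (Suc A)
  have "norm ((box_sum L ^^ Suc A) f s) \<le> (\<Sum>u<L. norm ((box_sum L ^^ A) f (s + u)))"
    by (simp add: box_sum_def norm_sum)
  also have "\<dots> \<le> (\<Sum>u<L. real L ^ A)" by (intro sum_mono Suc)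
  finally show ?case by simp
qed (use assms in simp)

lemma sum_lessThan_add:
  fixes f :: "nat \<Rightarrow> 'a :: comm_monoid_add"
  shows "(\<Sum>u<m + n. f u) = (\<Sum>u<m. f u) + (\<Sum>u<n. f (m + u))"
  by (induction n) (auto simp: add.assoc)

section \<open>Periodic functions of mean zero\<close>

definition mean_zero_periodic :: "nat \<Rightarrow> (nat \<Rightarrow> complex) \<Rightarrow> bool" where
  "mean_zero_periodic q \<xi> \<longleftrightarrow> (\<forall>s. \<xi> (s + q) = \<xi> s) \<and> (\<forall>s. (\<Sum>u<q. \<xi> (s + u)) = 0)"

lemma mean_zero_periodicI:
  assumes "\<And>s. \<xi> (s + q) = \<xi> s" "(\<Sum>u<q. \<xi> u) = 0"
  shows "mean_zero_periodic q \<xi>"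
proof -
  have "(\<Sum>u<q. \<xi> (s + u)) = 0" for s
  proof (induction s)
    case (Suc s)
    have "\<xi> s + (\<Sum>u<q. \<xi> (Suc s + u)) = (\<Sum>u<Suc q. \<xi> (s + u))"
      by (subst sum.lessThan_Suc_shift) simp
    also have "\<dots> = \<xi> s" using Suc assms(1)[of s] by simp
    finally show ?case by simp
  qed (use assms in simp)
  then show ?thesis using assms by (simp add: mean_zero_periodic_def)
qed

text \<open>Complete periods cancel, and fewer than \<open>q\<close> terms remain.\<close>

lemma norm_sum_mean_zero_periodic:
  assumes \<xi>: "mean_zero_periodic q \<xi>" and q: "q > 0" and c: "\<And>s. norm (\<xi> s) \<le> c"
  shows "norm (\<Sum>u<L. \<xi> (s + u)) \<le> real q * c"
proof -
  have "(\<Sum>u<q * k + r. \<xi> (s + u)) = (\<Sum>u<r. \<xi> (s + u))" for k r s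
  proof (induction k arbitrary: s)
    case (Suc k)
    have "(\<Sum>u<q + (q * k + r). \<xi> (s + u)) = (\<Sum>u<q * k + r. \<xi> (s + u))"
    proof -
      have per: "\<xi> (s + (q + u)) = \<xi> (s + u)" for u
        using \<xi> unfolding mean_zero_periodic_def by (metis add.assoc add.commute)
      have "(\<Sum>u<q. \<xi> (s + u)) = 0" using \<xi> unfolding mean_zero_periodic_def by blast
      then show ?thesis unfolding sum_lessThan_add per by simp
    qed
    then show ?case using Suc by (simp add: add.assoc)
  qed simp
  from this[of s "L div q" "L mod q"] have "norm (\<Sum>u<L. \<xi> (s + u)) = norm (\<Sum>u<L mod q. \<xi> (s + u))" by simp
  also have "\<dots> \<le> (\<Sum>u<L mod q. c)" by (rule order_trans[OF norm_sum]) (intro sum_mono c)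
  also have "\<dots> \<le> real q * c"
    using q order_trans[OF norm_ge_zero c] by (auto intro!: mult_right_mono simp: less_imp_le)
  finally show ?thesis .
qed

lemma mean_zero_periodic_box_sum:
  assumes \<xi>: "mean_zero_periodic q \<xi>"
  shows "mean_zero_periodic q (box_sum L \<xi>)"
  unfolding mean_zero_periodic_def
proof (intro conjI allI)
  fix s
  have "\<xi> (s + q + u) = \<xi> (s + u)" for u
    using \<xi> unfolding mean_zero_periodic_def by (metis add.assoc add.commute)
  then show "box_sum L \<xi> (s + q) = box_sum L \<xi> s" by (simp add: box_sum_def)
  have "(\<Sum>u<q. box_sum L \<xi> (s + u)) = (\<Sum>v<L. \<Sum>u<q. \<xi> (s + v + u))"
    unfolding box_sum_def by (subst sum.swap) (simp add: add_ac)
  also have "\<dots> = 0" using \<xi> unfolding mean_zero_periodic_def by simp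
  finally show "(\<Sum>u<q. box_sum L \<xi> (s + u)) = 0" .
qed

lemma mean_zero_periodic_box_sum_iter:
  "mean_zero_periodic q \<xi> \<Longrightarrow> mean_zero_periodic q ((box_sum L ^^ A) \<xi>)"
  by (induction A) (auto intro: mean_zero_periodic_box_sum)

text \<open>A box sum again has period \<open>q\<close> and mean zero, so the bound for incomplete
  periods can be applied at every iteration.\<close>

lemma norm_box_sum_iter_mean_zero:
  assumes \<xi>: "mean_zero_periodic q \<xi>" and q: "q > 0" and c: "\<And>s. norm (\<xi> s) \<le> 1"
  shows "norm ((box_sum L ^^ A) \<xi> s) \<le> real q ^ A"
proof (induction A arbitrary: s)
  case (Suc A)
  have "norm (\<Sum>u<L. (box_sum L ^^ A) \<xi> (s + u)) \<le> real q * real q ^ A"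
    by (rule norm_sum_mean_zero_periodic[OF mean_zero_periodic_box_sum_iter[OF \<xi>] q Suc])
  then show ?case by (simp add: box_sum_def[of L "(box_sum L ^^ A) \<xi>"])
qed (use c in simp)

lemma mean_zero_periodic_dcharacter:
  assumes "dcharacter n \<chi>" "n > 0" "coprime b n" "\<chi> b \<noteq> 1"
  shows "mean_zero_periodic n \<chi>"
proof (rule mean_zero_periodicI)
  show "\<chi> (s + n) = \<chi> s" for s by (rule dcharacterD(3)[OF assms(1)]) (simp add: Cong.cong_def)
  show "(\<Sum>u<n. \<chi> u) = 0" by (rule dcharacter_sum_0[OF assms])
qed

text \<open>The dual form: a box-sum majorant of the interval is long compared with the moduli, so that
  mean-zero products of two characters are almost annihilated by it.\<close>
lemma dual_large_sieve:
  fixes \<chi> :: "'i \<Rightarrow> nat \<Rightarrow> complex" and m :: "'i \<Rightarrow> nat" and c :: "'i \<Rightarrow> complex"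
  assumes fin: "finite I" and L: "L > 0"
    and m: "\<And>i. i \<in> I \<Longrightarrow> 0 < m i \<and> m i \<le> Q"
    and prim: "\<And>i. i \<in> I \<Longrightarrow> primitive_character (m i) (\<chi> i)"
    and inj: "inj_on (\<lambda>i. (m i, \<chi> i)) I"
  shows "(\<Sum>a\<in>{0<..N}. (norm (\<Sum>i\<in>I. c i * \<chi> i a))\<^sup>2)
       \<le> real (N + A * L) * (1 + real (card I) * (real Q ^ 2 / real L) ^ A) * (\<Sum>i\<in>I. (norm (c i))\<^sup>2)"
proof -
  have dch: "dcharacter (m i) (\<chi> i)" if "i \<in> I" for i using prim[OF that] by (simp add: primitive_character_def)
  \<comment> \<open>A common multiple of all moduli that is at least \<open>A * L\<close>: shifting
    the interval by \<open>B\<close> changes no character value and leaves room below it for the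
    \<open>A\<close> box sums.\<close>
  define B where "B = A * L * fact Q"
  have BAL: "A * L \<le> B" unfolding B_def by (simp add: Suc_leI)
  have shift: "\<chi> i (B + a) = \<chi> i a" if "i \<in> I" for i a
  proof (rule dcharacterD(3)[OF dch[OF that]])
    have "m i dvd fact Q" using m[OF that] by (intro dvd_fact) auto
    then have "m i dvd B" unfolding B_def by simp
    then show "[B + a = a] (mod m i)" by (auto simp: Cong.cong_def elim!: dvdE)
  qed
  define f where "f = (\<lambda>a. (norm (\<Sum>i\<in>I. c i * \<chi> i a))\<^sup>2)"
  define S where "S = (\<Sum>i\<in>I. (norm (c i))\<^sup>2)"
  define \<xi> where "\<xi> = (\<lambda>i j a. \<chi> i a * cnj (\<chi> j a))"
  have f_eq: "complex_of_real (f s) = (\<Sum>p\<in>I \<times> I. (c (fst p) * cnj (c (snd p))) * \<xi> (fst p) (snd p) s)" for s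
  proof -
    have "complex_of_real (f s) = (\<Sum>i\<in>I. c i * \<chi> i s) * (\<Sum>i\<in>I. cnj (c i) * cnj (\<chi> i s))"
      unfolding f_def complex_norm_square by simp
    also have "\<dots> = (\<Sum>p\<in>I \<times> I. (c (fst p) * cnj (c (snd p))) * \<xi> (fst p) (snd p) s)"
      unfolding sum_product sum.cartesian_product by (simp add: \<xi>_def case_prod_beta mult_ac)
    finally show ?thesis .
  qed
  have box: "(box_sum L ^^ A) f v \<le> (real L ^ A + real (card I) * (real Q ^ 2) ^ A) * S" for v
  proof -
    \<comment> \<open>On the diagonal the trivial bound \<open>L ^ A\<close> holds. Off it the
      product is nonprincipal of modulus at most \<open>Q\<^sup>2\<close>, so each box sum costs at
      most \<open>Q\<^sup>2\<close>.\<close>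
    have xi: "norm ((box_sum L ^^ A) (\<xi> i j) v) \<le> (if i = j then real L ^ A else 0) + (real Q ^ 2) ^ A"
      if "i \<in> I" "j \<in> I" for i j
    proof (cases "i = j")
      case True
      have "norm (\<xi> i j s) \<le> 1" for s
        using dcharacter_norm_le[OF dch[OF that(1)], of s] dcharacter_norm_le[OF dch[OF that(2)], of s] m that
        unfolding \<xi>_def norm_mult complex_mod_cnj by (meson mult_le_one norm_ge_zero)
      from norm_box_sum_iter_le[of "\<xi> i j", OF this] show ?thesis
        using True by (simp add: add_increasing2)
    next
      case False
      note ij = that
      from False have "(m i, \<chi> i) \<noteq> (m j, \<chi> j)" using inj that by (auto simp: inj_on_def)
      then obtain b where b: "coprime b (m i * m j)" "\<xi> i j b \<noteq> 1"
        using primitive_product_nonprincipal[OF prim[OF ij(1)] prim[OF ij(2)]] m[OF ij(1)] m[OF ij(2)]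
        unfolding \<xi>_def by metis
      have d: "dcharacter (m i * m j) (\<xi> i j)"
        unfolding \<xi>_def by (intro dcharacter_mult dcharacter_cnj dch that)
      have q: "m i * m j > 0" using m that by simp
      have "norm ((box_sum L ^^ A) (\<xi> i j) v) \<le> real (m i * m j) ^ A"
        by (rule norm_box_sum_iter_mean_zero[OF mean_zero_periodic_dcharacter[OF d q b] q
              dcharacter_norm_le[OF d q]])
      also have "\<dots> \<le> (real Q ^ 2) ^ A"
      proof (rule power_mono)
        have "m i * m j \<le> Q * Q" using m that by (intro mult_le_mono) auto
        then show "real (m i * m j) \<le> real Q ^ 2" unfolding power2_eq_square by (metis of_nat_le_iff of_nat_mult)
      qed simp
      finally show ?thesis using False by simp
    qed
    have "(box_sum L ^^ A) f v \<le> norm (complex_of_real ((box_sum L ^^ A) f v))" by simp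
    also have "complex_of_real ((box_sum L ^^ A) f v) = (box_sum L ^^ A) (\<lambda>s. complex_of_real (f s)) v"
      by (simp add: box_sum_iter_of_real)
    also have "\<dots> = (\<Sum>p\<in>I \<times> I. (c (fst p) * cnj (c (snd p))) * (box_sum L ^^ A) (\<xi> (fst p) (snd p)) v)"
      unfolding f_eq box_sum_iter_linear ..
    also have "norm \<dots> \<le> (\<Sum>p\<in>I \<times> I. norm (c (fst p)) * norm (c (snd p)) *
        ((if fst p = snd p then real L ^ A else 0) + (real Q ^ 2) ^ A))"
    proof (rule sum_norm_le)
      fix p assume "p \<in> I \<times> I"
      then have "norm ((box_sum L ^^ A) (\<xi> (fst p) (snd p)) v)
          \<le> (if fst p = snd p then real L ^ A else 0) + (real Q ^ 2) ^ A" by (intro xi) auto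
      from mult_left_mono[OF this, of "norm (c (fst p)) * norm (c (snd p))"]
      show "norm (c (fst p) * cnj (c (snd p)) * (box_sum L ^^ A) (\<xi> (fst p) (snd p)) v)
          \<le> norm (c (fst p)) * norm (c (snd p)) * ((if fst p = snd p then real L ^ A else 0) + (real Q ^ 2) ^ A)"
        by (simp add: norm_mult)
    qed
    also have "\<dots> = (\<Sum>i\<in>I. \<Sum>j\<in>I. norm (c i) * norm (c j) * ((if i = j then real L ^ A else 0) + (real Q ^ 2) ^ A))"
      by (simp add: sum.cartesian_product case_prod_beta)
    also have "\<dots> = (\<Sum>i\<in>I. \<Sum>j\<in>I. (if i = j then (norm (c i))\<^sup>2 * real L ^ A else 0) + norm (c i) * norm (c j) * (real Q ^ 2) ^ A)"
      by (intro sum.cong refl) (auto simp: power2_eq_square algebra_simps)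
    also have "\<dots> = S * real L ^ A + (\<Sum>i\<in>I. norm (c i)) * (\<Sum>j\<in>I. norm (c j)) * (real Q ^ 2) ^ A"
      unfolding sum_product sum.distrib S_def using fin by (simp add: sum_distrib_right)
    also have "\<dots> \<le> S * real L ^ A + (real (card I) * S) * (real Q ^ 2) ^ A"
    proof -
      have "(\<Sum>i\<in>I. norm (c i)) * (\<Sum>j\<in>I. norm (c j)) = (\<Sum>i\<in>I. \<Sum>j\<in>I. norm (c i) * norm (c j))"
        by (simp add: sum_product)
      also have "\<dots> \<le> (\<Sum>i\<in>I. \<Sum>j\<in>I. (norm (c i))\<^sup>2 / 2 + (norm (c j))\<^sup>2 / 2)"
      proof (intro sum_mono)
        fix i j
        show "norm (c i) * norm (c j) \<le> (norm (c i))\<^sup>2 / 2 + (norm (c j))\<^sup>2 / 2"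
          using sum_squares_bound[of "norm (c i)" "norm (c j)"] by simp
      qed
      also have "\<dots> = real (card I) * S"
        by (simp add: sum.distrib S_def sum_distrib_left flip: sum_divide_distrib)
      finally show ?thesis by (intro add_left_mono mult_right_mono) auto
    qed
    finally show ?thesis by (simp add: algebra_simps)
  qed
  have "real L ^ A * (\<Sum>a\<in>{0<..N}. f a) = real L ^ A * (\<Sum>a\<in>{B<..B + N}. f a)"
  proof -
    have "(\<Sum>a\<in>{B<..B + N}. f a) = (\<Sum>a\<in>(\<lambda>a. B + a) ` {0<..N}. f a)" by simp
    also have "\<dots> = (\<Sum>a\<in>{0<..N}. f (B + a))" by (subst sum.reindex) (auto simp: inj_on_def)
    also have "\<dots> = (\<Sum>a\<in>{0<..N}. f a)" unfolding f_def by (simp add: shift cong: sum.cong)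
    finally show ?thesis by simp
  qed
  also have "\<dots> \<le> (\<Sum>v\<in>{B - A * L<..B + N}. (box_sum L ^^ A) f v)"
    by (rule sum_box_sum_iter_ge[OF _ BAL]) (simp add: f_def)
  also have "\<dots> \<le> (\<Sum>v\<in>{B - A * L<..B + N}. (real L ^ A + real (card I) * (real Q ^ 2) ^ A) * S)"
    by (intro sum_mono box)
  also have "\<dots> = real (N + A * L) * (real L ^ A + real (card I) * (real Q ^ 2) ^ A) * S"
    using BAL by (simp add: algebra_simps)
  also have "\<dots> = real L ^ A * (real (N + A * L) * (1 + real (card I) * (real Q ^ 2 / real L) ^ A) * S)"
    using L by (simp add: power_divide field_simps)
  finally show ?thesis using L unfolding f_def S_def by simp
qed

lemma norm_sum_mult_Cauchy_Schwarz:
  fixes f g :: "'i \<Rightarrow> complex"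
  shows "(norm (\<Sum>i\<in>I. f i * g i))\<^sup>2 \<le> (\<Sum>i\<in>I. (norm (f i))\<^sup>2) * (\<Sum>i\<in>I. (norm (g i))\<^sup>2)"
proof -
  have "norm (\<Sum>i\<in>I. f i * g i) \<le> (\<Sum>i\<in>I. norm (f i) * norm (g i))"
    by (rule sum_norm_le) (simp add: norm_mult)
  then have "(norm (\<Sum>i\<in>I. f i * g i))\<^sup>2 \<le> (\<Sum>i\<in>I. norm (f i) * norm (g i))\<^sup>2" by (intro power_mono) auto
  also have "\<dots> \<le> (\<Sum>i\<in>I. (norm (f i))\<^sup>2) * (\<Sum>i\<in>I. (norm (g i))\<^sup>2)"
    by (rule Cauchy_Schwarz_ineq_sum)
  finally show ?thesis .
qed

text \<open>Duality: \<open>T\<close> is the pairing of \<open>b\<close> with the combination of the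
  characters that has coefficients \<open>cnj (V i)\<close>. By Cauchy-Schwarz and the dual
  inequality, the square of \<open>T\<close> is at most \<open>T\<close> times the bound to be
  proved.\<close>

lemma large_sieve:
  fixes \<chi> :: "'i \<Rightarrow> nat \<Rightarrow> complex" and m :: "'i \<Rightarrow> nat" and b :: "nat \<Rightarrow> complex"
  assumes fin: "finite I" and L: "L > 0"
    and m: "\<And>i. i \<in> I \<Longrightarrow> 0 < m i \<and> m i \<le> Q"
    and prim: "\<And>i. i \<in> I \<Longrightarrow> primitive_character (m i) (\<chi> i)"
    and inj: "inj_on (\<lambda>i. (m i, \<chi> i)) I"
  shows "(\<Sum>i\<in>I. (norm (\<Sum>a\<in>{0<..N}. b a * \<chi> i a))\<^sup>2)
       \<le> real (N + A * L) * (1 + real (card I) * (real Q ^ 2 / real L) ^ A) * (\<Sum>a\<in>{0<..N}. (norm (b a))\<^sup>2)"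
proof -
  define V where "V = (\<lambda>i. \<Sum>a\<in>{0<..N}. b a * \<chi> i a)"
  define T where "T = (\<Sum>i\<in>I. (norm (V i))\<^sup>2)"
  define \<Delta> where "\<Delta> = real (N + A * L) * (1 + real (card I) * (real Q ^ 2 / real L) ^ A)"
  have T0: "T \<ge> 0" by (simp add: T_def sum_nonneg)
  have "complex_of_real T = (\<Sum>i\<in>I. cnj (V i) * V i)"
    unfolding T_def of_real_sum complex_norm_square by (simp add: mult.commute)
  also have "\<dots> = (\<Sum>a\<in>{0<..N}. b a * (\<Sum>i\<in>I. cnj (V i) * \<chi> i a))"
    unfolding V_def sum_distrib_left by (subst sum.swap) (simp add: mult_ac)
  finally have "T\<^sup>2 = (norm (\<Sum>a\<in>{0<..N}. b a * (\<Sum>i\<in>I. cnj (V i) * \<chi> i a)))\<^sup>2"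
    by (metis norm_of_real power2_abs)
  also have "\<dots> \<le> (\<Sum>a\<in>{0<..N}. (norm (b a))\<^sup>2) * (\<Sum>a\<in>{0<..N}. (norm (\<Sum>i\<in>I. cnj (V i) * \<chi> i a))\<^sup>2)"
    by (rule norm_sum_mult_Cauchy_Schwarz)
  also have "\<dots> \<le> (\<Sum>a\<in>{0<..N}. (norm (b a))\<^sup>2) * (\<Delta> * (\<Sum>i\<in>I. (norm (cnj (V i)))\<^sup>2))"
    unfolding \<Delta>_def
    by (rule mult_left_mono[OF dual_large_sieve[OF assms] sum_nonneg]) auto
  also have "\<dots> = (\<Delta> * (\<Sum>a\<in>{0<..N}. (norm (b a))\<^sup>2)) * T" by (simp add: T_def)
  finally have le: "T * T \<le> (\<Delta> * (\<Sum>a\<in>{0<..N}. (norm (b a))\<^sup>2)) * T" by (simp add: power2_eq_square)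
  have "T \<le> \<Delta> * (\<Sum>a\<in>{0<..N}. (norm (b a))\<^sup>2)"
  proof (cases "T = 0")
    case True
    then show ?thesis by (simp add: \<Delta>_def sum_nonneg)
  next
    case False
    then show ?thesis using le T0 by simp
  qed
  then show ?thesis by (simp add: T_def V_def \<Delta>_def)
qed

section \<open>Divisor functions and factorization counts\<close>

lemma dvd_div_pos:
  fixes a d :: nat
  assumes "d dvd a" "a > 0"
  shows "a div d > 0"
  using assms by (metis dvd_div_eq_0_iff gr0I)

text \<open>The \<open>k\<close>-fold divisor function, as an iterated Dirichlet convolution. At
  \<open>a = 0\<close> the set of divisors is infinite and the value is 0.\<close>

fun divisor_count :: "nat \<Rightarrow> nat \<Rightarrow> nat" where
  "divisor_count 0 a = (if a = 1 then 1 else 0)"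
| "divisor_count (Suc k) a = (\<Sum>d | d dvd a. divisor_count k (a div d))"

text \<open>A divisor \<open>c\<close> of \<open>m * n\<close> is recovered from the pair of
  \<open>gcd c m\<close>, a divisor of \<open>m\<close>, and \<open>c div gcd c m\<close>, a divisor
  of \<open>n\<close>; the cofactors multiply accordingly.\<close>

lemma divisor_count_mult_le:
  assumes "m > 0" "n > 0"
  shows "divisor_count k (m * n) \<le> divisor_count k m * divisor_count k n"
  using assms
proof (induction k arbitrary: m n)
  case (Suc k)
  let ?D = "\<lambda>m::nat. {d. d dvd m}"
  let ?g = "\<lambda>(d, e). divisor_count k (m div d) * divisor_count k (n div e)"
  have fin: "finite (?D m)" "finite (?D n)" using Suc.prems by auto
  define s where "s = (\<lambda>c. (gcd c m, c div gcd c m))"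
  have sD: "s c \<in> ?D m \<times> ?D n" if "c dvd m * n" for c
  proof -
    have g: "gcd c m > 0" using Suc.prems by simp
    have "c div gcd c m dvd (m div gcd c m) * n"
    proof -
      have "c div gcd c m * gcd c m dvd ((m div gcd c m) * n) * gcd c m"
        using that by (metis dvd_div_mult_self gcd_dvd1 gcd_dvd2 mult.commute mult.left_commute)
      then have "c div gcd c m * gcd c m dvd (m div gcd c m * n) * gcd c m \<and> gcd c m \<noteq> 0"
        using g by blast
      then show ?thesis using dvd_times_right_cancel_iff by blast
    qed
    moreover have "coprime (c div gcd c m) (m div gcd c m)"
      using Suc.prems by (intro div_gcd_coprime) auto
    ultimately have "c div gcd c m dvd n" by (simp add: coprime_dvd_mult_right_iff)
    then show ?thesis by (simp add: s_def)
  qed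
  have inj: "inj_on s (?D (m * n))"
    by (rule inj_onI) (metis s_def dvd_div_mult_self gcd_dvd1 prod.inject)
  have le: "divisor_count k (m * n div c) \<le> ?g (s c)" if "c dvd m * n" for c
  proof -
    have d: "gcd c m dvd m" "c div gcd c m dvd n" using sD[OF that] by (auto simp: s_def)
    have "m * n div c = (m div gcd c m) * (n div (c div gcd c m))"
      using d by (metis div_mult_div_if_dvd dvd_mult_div_cancel gcd_dvd1)
    moreover have "m div gcd c m > 0" "n div (c div gcd c m) > 0"
      using d Suc.prems by (auto simp: dvd_div_pos)
    ultimately show ?thesis using Suc.IH by (simp add: s_def)
  qed
  have "divisor_count (Suc k) (m * n) \<le> (\<Sum>c\<in>?D (m * n). ?g (s c))"
    unfolding divisor_count.simps by (intro sum_mono le) auto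
  also have "\<dots> = (\<Sum>p\<in>s ` ?D (m * n). ?g p)" by (subst sum.reindex[OF inj]) simp
  also have "\<dots> \<le> (\<Sum>p\<in>?D m \<times> ?D n. ?g p)" proof (rule sum_mono2)
    show "finite (?D m \<times> ?D n)" using fin by simp
    show "s ` ?D (m * n) \<subseteq> ?D m \<times> ?D n" using sD by blast
  qed (simp add: case_prod_beta)
  also have "\<dots> = divisor_count (Suc k) m * divisor_count (Suc k) n"
    by (simp add: sum_product sum.cartesian_product)
  finally show ?case .
qed auto

text \<open>For \<open>a > 0\<close>, the number of ordered factorizations of \<open>a\<close> into
  \<open>k\<close> members of \<open>U\<close>: the coefficient at \<open>a\<close> of the
  \<open>k\<close>-th power of a Dirichlet polynomial on \<open>U\<close>. A set \<open>U\<close> in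
  place of an interval leaves room for a coprimality condition.\<close>

fun factorization_count :: "nat set \<Rightarrow> nat \<Rightarrow> nat \<Rightarrow> nat" where
  "factorization_count U 0 a = (if a = 1 then 1 else 0)"
| "factorization_count U (Suc k) a = (\<Sum>d\<in>{d \<in> U. d dvd a}. factorization_count U k (a div d))"

lemma factorization_count_le: "a > 0 \<Longrightarrow> factorization_count U k a \<le> divisor_count k a"
proof (induction k arbitrary: a)
  case (Suc k)
  have "factorization_count U (Suc k) a \<le> (\<Sum>d\<in>{d \<in> U. d dvd a}. divisor_count k (a div d))"
    using Suc unfolding factorization_count.simps by (intro sum_mono) (auto simp: dvd_div_pos)
  also have "\<dots> \<le> divisor_count (Suc k) a"
    unfolding divisor_count.simps using Suc.prems by (intro sum_mono2) auto
  finally show ?case .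
qed simp

text \<open>The substitution of \<open>d * a\<close> for \<open>a\<close>. As \<open>N\<close>
  bounds the support of the \<open>k\<close>-fold count, cutting the inner sum at \<open>N\<close>
  loses nothing.\<close>

lemma sum_factorization_count_Suc:
  fixes f :: "nat \<Rightarrow> 'a :: comm_semiring_1"
  assumes "U \<subseteq> {0<..Y}" "N * Y \<le> N'"
    and supp: "\<And>a. factorization_count U k a > 0 \<Longrightarrow> a > 0 \<Longrightarrow> a \<le> N"
  shows "(\<Sum>a\<in>{0<..N'}. of_nat (factorization_count U (Suc k) a) * f a) =
    (\<Sum>d\<in>U. \<Sum>a\<in>{0<..N}. of_nat (factorization_count U k a) * f (d * a))"
proof -
  have finU: "finite U" using assms(1) finite_subset by blast
  have "(\<Sum>a\<in>{0<..N'}. of_nat (factorization_count U (Suc k) a) * f a) =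
      (\<Sum>a\<in>{0<..N'}. \<Sum>d\<in>{d \<in> U. d dvd a}. of_nat (factorization_count U k (a div d)) * f a)"
    by (simp add: sum_distrib_right)
  also have "\<dots> = (\<Sum>d\<in>U. \<Sum>a\<in>{a \<in> {0<..N'}. d dvd a}. of_nat (factorization_count U k (a div d)) * f a)"
    by (rule sum.swap_restrict) (use finU in auto)
  also have "\<dots> = (\<Sum>d\<in>U. \<Sum>a\<in>{0<..N}. of_nat (factorization_count U k a) * f (d * a))"
  proof (rule sum.cong[OF refl])
    fix d assume "d \<in> U"
    then have d: "d > 0" "d \<le> Y" using assms(1) by auto
    have sub: "(\<lambda>a. d * a) ` {0<..N} \<subseteq> {a \<in> {0<..N'}. d dvd a}"
      using d assms(2) by (auto intro: order_trans[OF mult_le_mono] simp: mult.commute)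
    have "(\<Sum>a\<in>{0<..N}. of_nat (factorization_count U k a) * f (d * a)) =
        (\<Sum>a\<in>(\<lambda>a. d * a) ` {0<..N}. of_nat (factorization_count U k (a div d)) * f a)"
      using d by (subst sum.reindex) (auto simp: inj_on_def)
    also have "\<dots> = (\<Sum>a\<in>{a \<in> {0<..N'}. d dvd a}. of_nat (factorization_count U k (a div d)) * f a)"
    proof (rule sum.mono_neutral_left[OF _ sub])
      show "\<forall>a\<in>{a \<in> {0<..N'}. d dvd a} - (\<lambda>a. d * a) ` {0<..N}.
          of_nat (factorization_count U k (a div d)) * f a = 0"
      proof
        fix a assume a: "a \<in> {a \<in> {0<..N'}. d dvd a} - (\<lambda>a. d * a) ` {0<..N}"
        then obtain c where c: "a = d * c" by auto
        then have "c > 0" "c > N" using a by auto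
        then have "factorization_count U k c = 0" using supp[of c] by (metis gr0I not_le)
        then show "of_nat (factorization_count U k (a div d)) * f a = 0" using c d by simp
      qed
    qed simp
    finally show "(\<Sum>a\<in>{a \<in> {0<..N'}. d dvd a}. of_nat (factorization_count U k (a div d)) * f a) =
        (\<Sum>a\<in>{0<..N}. of_nat (factorization_count U k a) * f (d * a))" by simp
  qed
  finally show ?thesis .
qed

lemma factorization_count_support:
  assumes "U \<subseteq> {0<..Y}" "factorization_count U k a > 0"
  shows "a \<le> Y ^ k"
  using assms(2)
proof (induction k arbitrary: a)
  case (Suc k)
  then obtain d where d: "d \<in> U" "d dvd a" "factorization_count U k (a div d) > 0"
    by (metis (no_types, lifting) factorization_count.simps(2) gr0I mem_Collect_eq not_less0 sum.not_neutral_contains_not_neutral)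
  have "a = d * (a div d)" using d by simp
  also have "\<dots> \<le> Y * Y ^ k" using Suc.IH[OF d(3)] d(1) assms(1) by (intro mult_le_mono) auto
  finally show ?case by simp
qed (auto split: if_splits)

lemma sum_factorization_count:
  fixes f :: "nat \<Rightarrow> 'a :: comm_semiring_1"
  assumes "U \<subseteq> {0<..Y}"
  shows "(\<Sum>a\<in>{0<..Y ^ Suc k}. of_nat (factorization_count U (Suc k) a) * f a) =
    (\<Sum>d\<in>U. \<Sum>a\<in>{0<..Y ^ k}. of_nat (factorization_count U k a) * f (d * a))"
  by (rule sum_factorization_count_Suc[OF assms]) (auto dest: factorization_count_support[OF assms])

lemma power_sum_eq_factorization_sum:
  fixes f :: "nat \<Rightarrow> 'a :: comm_semiring_1"
  assumes U: "U \<subseteq> {0<..Y}" and Y: "Y > 0" and f: "f 1 = 1" "\<And>a b. f (a * b) = f a * f b"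
  shows "(\<Sum>a\<in>U. f a) ^ k = (\<Sum>a\<in>{0<..Y ^ k}. of_nat (factorization_count U k a) * f a)"
proof (induction k)
  case 0
  have "{0<..Y ^ 0} = {1::nat}" by auto
  then show ?case using f by simp
next
  case (Suc k)
  show ?case unfolding sum_factorization_count[OF U]
    unfolding power_Suc Suc f(2) sum_product by (simp add: mult_ac)
qed

text \<open>Splitting off one factor at a time by submultiplicativity. The index \<open>j\<close>
  stays apart from \<open>k\<close>, so the divisor function is fixed during the induction.\<close>

lemma sum_factorization_divisor_count_le:
  assumes U: "U \<subseteq> {0<..Y}" and Y: "Y > 0"
  shows "(\<Sum>a\<in>{0<..Y ^ k}. factorization_count U k a * divisor_count j a) \<le> (\<Sum>a\<in>U. divisor_count j a) ^ k"
proof (induction k)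
  case 0
  have "divisor_count j 1 = 1" by (induction j) auto
  moreover have "{0<..Y ^ 0} = {1::nat}" by auto
  ultimately show ?case by simp
next
  case (Suc k)
  have "(\<Sum>a\<in>{0<..Y ^ Suc k}. factorization_count U (Suc k) a * divisor_count j a)
      = (\<Sum>d\<in>U. \<Sum>a\<in>{0<..Y ^ k}. factorization_count U k a * divisor_count j (d * a))"
    using sum_factorization_count[OF U, of k "divisor_count j"] by (simp only: of_nat_id)
  also have "\<dots> \<le> (\<Sum>d\<in>U. \<Sum>a\<in>{0<..Y ^ k}. factorization_count U k a * (divisor_count j d * divisor_count j a))"
    using U by (intro sum_mono mult_left_mono divisor_count_mult_le) auto
  also have "\<dots> = (\<Sum>d\<in>U. divisor_count j d) * (\<Sum>a\<in>{0<..Y ^ k}. factorization_count U k a * divisor_count j a)"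
    by (simp add: sum_product mult_ac)
  also have "\<dots> \<le> (\<Sum>a\<in>U. divisor_count j a) ^ Suc k"
    using Suc by simp
  finally show ?case .
qed

text \<open>A product of \<open>k\<close> elements of \<open>U\<close> has at most as many factorizations into elements of \<open>U\<close> as the
  product of the \<open>k\<close>-fold divisor functions of its factors; hence the bound on coincidences.\<close>
lemma sum_factorization_count_square_le:
  assumes U: "U \<subseteq> {0<..Y}" and Y: "Y > 0"
  shows "(\<Sum>a\<in>{0<..Y ^ k}. (factorization_count U k a)\<^sup>2) \<le> (\<Sum>a\<in>{0<..Y}. divisor_count k a) ^ k"
proof -
  have "(\<Sum>a\<in>{0<..Y ^ k}. (factorization_count U k a)\<^sup>2)
      \<le> (\<Sum>a\<in>{0<..Y ^ k}. factorization_count U k a * divisor_count k a)"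
    unfolding power2_eq_square by (intro sum_mono mult_left_mono factorization_count_le) auto
  also have "\<dots> \<le> (\<Sum>a\<in>U. divisor_count k a) ^ k" by (rule sum_factorization_divisor_count_le[OF U Y])
  also have "\<dots> \<le> (\<Sum>a\<in>{0<..Y}. divisor_count k a) ^ k" using U by (intro power_mono sum_mono2) auto
  finally show ?thesis .
qed

text \<open>A truncated form of the fact that the Dirichlet series of the \<open>k\<close>-fold
  divisor function is the \<open>k\<close>-th power of zeta: a divisor and its cofactor stay below
  \<open>Y\<close> when their product does.\<close>

lemma sum_divisor_count_powr_le:
  fixes \<sigma> :: real
  shows "(\<Sum>a\<in>{0<..Y}. real (divisor_count k a) * real a powr - \<sigma>) \<le> (\<Sum>a\<in>{0<..Y}. real a powr - \<sigma>) ^ k"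
proof (induction k)
  case 0
  have "(\<Sum>a\<in>{0<..Y}. real (divisor_count 0 a) * real a powr - \<sigma>) = (\<Sum>a\<in>{0<..Y}. if a = 1 then 1 else 0)"
    by (intro sum.cong) auto
  also have "\<dots> \<le> 1" by (simp add: sum.delta)
  finally show ?case by simp
next
  case (Suc k)
  let ?w = "\<lambda>a::nat. real a powr - \<sigma>"
  let ?P = "Sigma {0<..Y} (\<lambda>a. {d. d dvd a})"
  have inj: "inj_on (\<lambda>(a, d). (d, a div d)) ?P"
    by (auto simp: inj_on_def)
  have "(\<Sum>a\<in>{0<..Y}. real (divisor_count (Suc k) a) * ?w a)
      = (\<Sum>a\<in>{0<..Y}. \<Sum>d | d dvd a. real (divisor_count k (a div d)) * ?w a)"
    by (simp add: sum_distrib_right)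
  also have "\<dots> = (\<Sum>(a, d)\<in>?P. real (divisor_count k (a div d)) * ?w a)"
    by (subst sum.Sigma) auto
  also have "\<dots> = (\<Sum>(a, d)\<in>?P. ?w d * (real (divisor_count k (a div d)) * ?w (a div d)))"
  proof (intro sum.cong refl, clarify)
    fix a d :: nat assume "d dvd a"
    then obtain e where "a = d * e" by auto
    then show "real (divisor_count k (a div d)) * ?w a = ?w d * (real (divisor_count k (a div d)) * ?w (a div d))"
      by (cases "d = 0") (auto simp: powr_mult)
  qed
  also have "\<dots> = (\<Sum>(d, e)\<in>(\<lambda>(a, d). (d, a div d)) ` ?P. ?w d * (real (divisor_count k e) * ?w e))"
    by (subst sum.reindex[OF inj]) (simp add: case_prod_beta)
  also have "\<dots> \<le> (\<Sum>(d, e)\<in>{0<..Y} \<times> {0<..Y}. ?w d * (real (divisor_count k e) * ?w e))"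
  proof (rule sum_mono2)
    show "(\<lambda>(a, d). (d, a div d)) ` ?P \<subseteq> {0<..Y} \<times> {0<..Y}"
      using dvd_imp_le[of _ "_ :: nat"]
      by (auto simp: dvd_div_pos intro: dvd_pos_nat order_trans[OF div_le_dividend] order_trans[OF dvd_imp_le])
  qed auto
  also have "\<dots> = (\<Sum>d\<in>{0<..Y}. ?w d) * (\<Sum>e\<in>{0<..Y}. real (divisor_count k e) * ?w e)"
    by (simp add: sum_product sum.cartesian_product)
  also have "\<dots> \<le> (\<Sum>d\<in>{0<..Y}. ?w d) ^ Suc k"
    using Suc by (simp add: mult_left_mono sum_nonneg)
  finally show ?case .
qed

text \<open>By the mean value theorem the term at \<open>a + 1\<close> is at most the decrease of
  \<open>a powr - s / s\<close>, and these decreases telescope.\<close>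

lemma sum_powr_minus_le:
  fixes s :: real
  assumes "s > 0"
  shows "(\<Sum>a\<in>{0<..Y}. real a powr - (1 + s)) \<le> 1 + 1 / s"
proof -
  have step: "real (Suc a) powr - (1 + s) \<le> (real a powr - s - real (Suc a) powr - s) / s" if "a > 0" for a
  proof -
    have "\<exists>z>real a. z < real (Suc a) \<and> - (real (Suc a) powr - s) - - (real a powr - s) = (real (Suc a) - real a) * (s * z powr (- s - 1))"
      by (rule MVT2) (use that in \<open>auto intro!: derivative_eq_intros\<close>)
    then obtain z where z: "real a < z" "z < real (Suc a)"
      "real a powr - s - real (Suc a) powr - s = s * z powr (- s - 1)" by auto
    have "real (Suc a) powr (- s - 1) \<le> z powr (- s - 1)"
      by (rule powr_mono2') (use assms z in auto)
    then have "real (Suc a) powr (- (1 + s)) \<le> z powr (- s - 1)" unfolding minus_add_distrib by (simp only: diff_conv_add_uminus add.commute)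
    then show ?thesis using assms z(3) by simp
  qed
  have *: "(\<Sum>a\<in>{0<..Suc Y}. real a powr - (1 + s)) \<le> 1 + (1 - real (Suc Y) powr - s) / s" for Y
  proof (induction Y)
    case 0
    have "{0<..Suc 0} = {1}" by auto
    then show ?case by simp
  next
    case (Suc Y)
    have "{0<..Suc (Suc Y)} = insert (Suc (Suc Y)) {0<..Suc Y}" by auto
    then have "(\<Sum>a\<in>{0<..Suc (Suc Y)}. real a powr - (1 + s))
        = real (Suc (Suc Y)) powr - (1 + s) + (\<Sum>a\<in>{0<..Suc Y}. real a powr - (1 + s))" by simp
    also have "\<dots> \<le> (real (Suc Y) powr - s - real (Suc (Suc Y)) powr - s) / s + (1 + (1 - real (Suc Y) powr - s) / s)"
      by (intro add_mono step Suc) simp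
    also have "\<dots> = 1 + (1 - real (Suc (Suc Y)) powr - s) / s" by (simp add: diff_divide_distrib)
    finally show ?case .
  qed
  show ?thesis
  proof (cases "Y = 0")
    case False
    then obtain n where n: "Y = Suc n" by (cases Y) auto
    have "1 + (1 - real (Suc n) powr - s) / s \<le> 1 + 1 / s"
      using assms by (simp add: divide_right_mono)
    then show ?thesis unfolding n by (rule order_trans[OF *])
  qed (use assms in simp)
qed

text \<open>Rankin's trick: every term is multiplied by (y/a)^(1+s), which is at least 1.\<close>

lemma sum_divisor_count_le:
  fixes y s :: real
  assumes "s > 0" "real Y \<le> y" "y > 0"
  shows "(\<Sum>a\<in>{0<..Y}. real (divisor_count k a)) \<le> y powr (1 + s) * (1 + 1 / s) ^ k"
proof -
  have "(\<Sum>a\<in>{0<..Y}. real (divisor_count k a)) \<le> (\<Sum>a\<in>{0<..Y}. y powr (1 + s) * (real (divisor_count k a) * real a powr - (1 + s)))"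
  proof (rule sum_mono)
    fix a assume a: "a \<in> {0<..Y}"
    have "1 = real a powr (1 + s) * real a powr - (1 + s)" using a by (simp flip: powr_add)
    also have "\<dots> \<le> y powr (1 + s) * real a powr - (1 + s)"
      using a assms by (intro mult_right_mono powr_mono2) auto
    finally have "real (divisor_count k a) * 1 \<le> real (divisor_count k a) * (y powr (1 + s) * real a powr - (1 + s))"
      by (intro mult_left_mono) auto
    then show "real (divisor_count k a) \<le> y powr (1 + s) * (real (divisor_count k a) * real a powr - (1 + s))"
      by (simp add: mult_ac)
  qed
  also have "\<dots> = y powr (1 + s) * (\<Sum>a\<in>{0<..Y}. real (divisor_count k a) * real a powr - (1 + s))"
    by (simp add: sum_distrib_left)
  also have "\<dots> \<le> y powr (1 + s) * (\<Sum>a\<in>{0<..Y}. real a powr - (1 + s)) ^ k"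
    by (intro mult_left_mono sum_divisor_count_powr_le) auto
  also have "\<dots> \<le> y powr (1 + s) * (1 + 1 / s) ^ k"
    by (intro mult_left_mono power_mono sum_powr_minus_le assms sum_nonneg) auto
  finally show ?thesis .
qed

section \<open>Moments of character sums\<close>

text \<open>The \<open>2 * k\<close>-th moment is the mean square of the \<open>k\<close>-th powers,
  which are Dirichlet polynomials of length \<open>Y ^ k\<close>. The number \<open>L\<close> bounds
  this length and is also the length of the boxes.\<close>

lemma amplified_large_sieve:
  fixes \<chi> :: "'i \<Rightarrow> nat \<Rightarrow> complex" and m :: "'i \<Rightarrow> nat"
  assumes fin: "finite I" and U: "U \<subseteq> {0<..Y}" and Y: "Y > 0" and L: "Y ^ k \<le> L"
    and m: "\<And>i. i \<in> I \<Longrightarrow> 0 < m i \<and> m i \<le> Q"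
    and prim: "\<And>i. i \<in> I \<Longrightarrow> primitive_character (m i) (\<chi> i)"
    and inj: "inj_on (\<lambda>i. (m i, \<chi> i)) I"
  shows "(\<Sum>i\<in>I. norm (\<Sum>a\<in>U. \<chi> i a) ^ (2 * k))
       \<le> real ((1 + A) * L) * (1 + real (card I) * (real Q ^ 2 / real L) ^ A) *
          (\<Sum>a\<in>{0<..Y}. real (divisor_count k a)) ^ k"
proof -
  have L0: "L > 0" using Y L by (metis gr0I less_nat_zero_code not_le zero_less_power)
  have "(\<Sum>i\<in>I. norm (\<Sum>a\<in>U. \<chi> i a) ^ (2 * k))
      = (\<Sum>i\<in>I. (norm (\<Sum>a\<in>{0<..Y ^ k}. of_nat (factorization_count U k a) * \<chi> i a))\<^sup>2)"
  proof (rule sum.cong[OF refl])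
    fix i assume "i \<in> I"
    then have d: "dcharacter (m i) (\<chi> i)" using prim by (simp add: primitive_character_def)
    have "norm (\<Sum>a\<in>U. \<chi> i a) ^ (2 * k) = (norm ((\<Sum>a\<in>U. \<chi> i a) ^ k))\<^sup>2"
      by (simp add: norm_power mult.commute flip: power_mult)
    then show "norm (\<Sum>a\<in>U. \<chi> i a) ^ (2 * k) =
        (norm (\<Sum>a\<in>{0<..Y ^ k}. of_nat (factorization_count U k a) * \<chi> i a))\<^sup>2"
      using power_sum_eq_factorization_sum[OF U Y dcharacter_1[OF d] dcharacterD(2)[OF d]] by simp
  qed
  also have "\<dots> \<le> real (Y ^ k + A * L) * (1 + real (card I) * (real Q ^ 2 / real L) ^ A) *
      (\<Sum>a\<in>{0<..Y ^ k}. (norm (of_nat (factorization_count U k a) :: complex))\<^sup>2)"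
    by (rule large_sieve[OF fin L0 m prim inj])
  also have "\<dots> = real (Y ^ k + A * L) * (1 + real (card I) * (real Q ^ 2 / real L) ^ A) *
      real (\<Sum>a\<in>{0<..Y ^ k}. (factorization_count U k a)\<^sup>2)"
    by simp
  also have "\<dots> \<le> real ((1 + A) * L) * (1 + real (card I) * (real Q ^ 2 / real L) ^ A) *
      real ((\<Sum>a\<in>{0<..Y}. divisor_count k a) ^ k)"
  proof (intro mult_mono)
    show "real (Y ^ k + A * L) \<le> real ((1 + A) * L)" using L by (subst of_nat_le_iff) simp
    show "real (\<Sum>a\<in>{0<..Y ^ k}. (factorization_count U k a)\<^sup>2) \<le> real ((\<Sum>a\<in>{0<..Y}. divisor_count k a) ^ k)"
      by (subst of_nat_le_iff) (rule sum_factorization_count_square_le[OF U Y])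
  qed (simp_all add: sum_nonneg)
  finally show ?thesis by simp
qed

section \<open>Conductors and moments over blocks of conductors\<close>

definition conductor_pair :: "nat \<Rightarrow> (nat \<Rightarrow> complex) \<Rightarrow> nat \<times> (nat \<Rightarrow> complex)" where
  "conductor_pair n \<chi> = (SOME (m, \<psi>). m dvd n \<and> primitive_character m \<psi> \<and> (\<forall>a. coprime a n \<longrightarrow> \<chi> a = \<psi> a))"

abbreviation conductor :: "nat \<Rightarrow> (nat \<Rightarrow> complex) \<Rightarrow> nat" where
  "conductor n \<chi> \<equiv> fst (conductor_pair n \<chi>)"

abbreviation primitivization :: "nat \<Rightarrow> (nat \<Rightarrow> complex) \<Rightarrow> nat \<Rightarrow> complex" where
  "primitivization n \<chi> \<equiv> snd (conductor_pair n \<chi>)"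

lemma conductor_pair:
  assumes "dcharacter n \<chi>" "n > 0"
  shows "conductor n \<chi> dvd n" "primitive_character (conductor n \<chi>) (primitivization n \<chi>)"
    "coprime a n \<Longrightarrow> \<chi> a = primitivization n \<chi> a"
    "conductor n \<chi> > 0" "conductor n \<chi> \<le> n" "dcharacter (conductor n \<chi>) (primitivization n \<chi>)"
proof -
  let ?P = "\<lambda>(m, \<psi>). m dvd n \<and> primitive_character m \<psi> \<and> (\<forall>a. coprime a n \<longrightarrow> \<chi> a = \<psi> a)"
  obtain m \<psi> where "m dvd n" "primitive_character m \<psi>" "\<And>a. coprime a n \<Longrightarrow> \<chi> a = \<psi> a"
    using induced_by_primitive[OF assms] by blast
  then have "?P (m, \<psi>)" by simp
  then have "\<exists>p. ?P p" by blast
  then have "?P (conductor_pair n \<chi>)" unfolding conductor_pair_def by (rule someI_ex)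
  then show 1: "conductor n \<chi> dvd n" "primitive_character (conductor n \<chi>) (primitivization n \<chi>)"
    "coprime a n \<Longrightarrow> \<chi> a = primitivization n \<chi> a"
    by (auto simp: case_prod_beta)
  show "conductor n \<chi> > 0" using 1(1) assms(2) by (metis dvd_0_left_iff gr0I)
  show "conductor n \<chi> \<le> n" using 1(1) assms(2) by (rule dvd_imp_le)
  show "dcharacter (conductor n \<chi>) (primitivization n \<chi>)" using 1(2) by (simp add: primitive_character_def)
qed

lemma dcharacter_eq_primitivization:
  assumes "dcharacter n \<chi>" "n > 0"
  shows "\<chi> = (\<lambda>a. if coprime a n then primitivization n \<chi> a else 0)"
  using conductor_pair(3)[OF assms] dcharacterD(1)[OF assms(1)] by auto

text \<open>The primitive character already vanishes at arguments not coprime to the conductor, so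
  only coprimality to the cofactor \<open>r\<close> remains. The range of summation is then common
  to all characters with the same cofactor.\<close>

lemma character_sum_eq_primitive_sum:
  assumes "dcharacter n \<chi>" "n > 0" "n = conductor n \<chi> * r"
  shows "(\<Sum>a\<in>{0<..Y}. \<chi> a) = (\<Sum>a\<in>{a \<in> {0<..Y}. coprime a r}. primitivization n \<chi> a)"
proof -
  let ?m = "conductor n \<chi>" and ?\<psi> = "primitivization n \<chi>"
  have "(\<Sum>a\<in>{0<..Y}. \<chi> a) = (\<Sum>a\<in>{0<..Y}. if coprime a r then ?\<psi> a else 0)"
  proof (rule sum.cong[OF refl])
    fix a
    have "coprime a n \<longleftrightarrow> coprime a ?m \<and> coprime a r" by (subst assms(3)) simp
    then show "\<chi> a = (if coprime a r then ?\<psi> a else 0)"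
      using conductor_pair(3)[OF assms(1,2), of a] dcharacterD(1)[OF assms(1), of a]
        dcharacterD(1)[OF conductor_pair(6)[OF assms(1,2)], of a] by auto
  qed
  then show ?thesis by (simp only: sum.inter_filter[OF finite_greaterThanAtMost])
qed

definition nonprincipal_pairs :: "nat \<Rightarrow> (nat \<Rightarrow> nat set) \<Rightarrow> (nat \<times> (nat \<Rightarrow> complex)) set" where
  "nonprincipal_pairs X H = (SIGMA n:{0<..X}. annihilator n (H n) - {principal_character n})"

lemma finite_nonprincipal_pairs: "finite (nonprincipal_pairs X H)"
  unfolding nonprincipal_pairs_def by (intro finite_SigmaI finite_Diff finite_annihilator) auto

lemma nonprincipal_pairsD:
  assumes "(n, \<chi>) \<in> nonprincipal_pairs X H"
  shows "0 < n" "n \<le> X" "dcharacter n \<chi>" "\<chi> \<noteq> principal_character n" "\<chi> \<in> annihilator n (H n)"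
  using assms by (auto simp: nonprincipal_pairs_def annihilator_def)

text \<open>The pairs are grouped by the cofactor \<open>r = n / m\<close>, which takes at most
  \<open>X / M\<close> values. For fixed \<open>r\<close> the primitive character determines the
  pair, and the range of summation is the same set, so the large sieve applies to each group. There
  are at most \<open>(2 * M)\<^sup>2\<close> characters of modulus up to
  \<open>2 * M\<close>.\<close>

lemma sum_conductor_block_le:
  fixes H :: "nat \<Rightarrow> nat set" and k X M L Y A :: nat
  assumes Y: "Y > 0" and L: "Y ^ k \<le> L" and M: "M > 0"
  defines "\<Omega> \<equiv> {p \<in> nonprincipal_pairs X H. M < conductor (fst p) (snd p) \<and> conductor (fst p) (snd p) \<le> 2 * M}"
  shows "(\<Sum>p\<in>\<Omega>. norm (\<Sum>a\<in>{0<..Y}. snd p a) ^ (2 * k))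
     \<le> real X / real M * (real ((1 + A) * L) * (1 + (2 * real M)\<^sup>2 * ((2 * real M)\<^sup>2 / real L) ^ A) *
          (\<Sum>a\<in>{0<..Y}. real (divisor_count k a)) ^ k)"
proof -
  define m where "m = (\<lambda>p. conductor (fst p) (snd p))"
  define \<psi> where "\<psi> = (\<lambda>p. primitivization (fst p) (snd p))"
  define r where "r = (\<lambda>p. fst p div m p)"
  define R where "R = X div M"
  have fin\<Omega>: "finite \<Omega>" unfolding \<Omega>_def by (rule finite_subset[OF _ finite_nonprincipal_pairs]) auto
  have \<Omega>D: "0 < fst p" "fst p \<le> X" "dcharacter (fst p) (snd p)" "M < m p" "m p \<le> 2 * M"
    "fst p = m p * r p" "m p > 0" "primitive_character (m p) (\<psi> p)" if "p \<in> \<Omega>" for p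
  proof -
    have p: "(fst p, snd p) \<in> nonprincipal_pairs X H" using that by (simp add: \<Omega>_def)
    note c = conductor_pair[OF nonprincipal_pairsD(3,1)[OF p]]
    show "0 < fst p" "fst p \<le> X" "dcharacter (fst p) (snd p)" using nonprincipal_pairsD[OF p] by auto
    show "M < m p" "m p \<le> 2 * M" using that by (auto simp: \<Omega>_def m_def)
    show "fst p = m p * r p" "m p > 0" "primitive_character (m p) (\<psi> p)"
      using c by (auto simp: m_def \<psi>_def r_def)
  qed
  have r: "r p \<in> {0<..R}" if "p \<in> \<Omega>" for p
  proof -
    have "M * r p \<le> X" using \<Omega>D(2,4,6)[OF that] by (metis le_trans less_imp_le mult_le_mono1)
    then have "r p \<le> R" using M by (simp add: R_def less_eq_div_iff_mult_less_eq mult.commute)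
    moreover have "r p > 0" using \<Omega>D(1,6)[OF that] by (metis gr0I mult_0_right)
    ultimately show ?thesis by simp
  qed
  let ?bd = "real ((1 + A) * L) * (1 + (2 * real M)\<^sup>2 * ((2 * real M)\<^sup>2 / real L) ^ A) *
          (\<Sum>a\<in>{0<..Y}. real (divisor_count k a)) ^ k"
  have fib: "(\<Sum>p\<in>{p \<in> \<Omega>. r p = s}. norm (\<Sum>a\<in>{0<..Y}. snd p a) ^ (2 * k)) \<le> ?bd" for s
  proof -
    let ?I = "{p \<in> \<Omega>. r p = s}"
    have finI: "finite ?I" using fin\<Omega> by simp
    have inj: "inj_on (\<lambda>p. (m p, \<psi> p)) ?I"
    proof (rule inj_onI)
      fix p q assume pq: "p \<in> ?I" "q \<in> ?I" "(m p, \<psi> p) = (m q, \<psi> q)"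
      then have f: "fst p = fst q" using \<Omega>D(6)[of p] \<Omega>D(6)[of q] by auto
      moreover have "snd p = snd q"
      proof -
        have a: "snd p = (\<lambda>a. if coprime a (fst p) then \<psi> p a else 0)"
          unfolding \<psi>_def by (rule dcharacter_eq_primitivization) (use \<Omega>D(1,3)[of p] pq(1) in simp_all)
        have b: "snd q = (\<lambda>a. if coprime a (fst q) then \<psi> q a else 0)"
          unfolding \<psi>_def by (rule dcharacter_eq_primitivization) (use \<Omega>D(1,3)[of q] pq(2) in simp_all)
        have "\<psi> p = \<psi> q" using pq(3) by simp
        then show ?thesis unfolding a b f by (simp only:)
      qed
      ultimately show "p = q" by (simp add: prod_eq_iff)
    qed
    have card: "card ?I \<le> (2 * M)\<^sup>2"
    proof -
      let ?F = "SIGMA m:{0<..2 * M}. {\<chi>. dcharacter m \<chi>}"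
      have finF: "finite ?F" by (intro finite_SigmaI finite_dcharacters) auto
      have "card ?I = card ((\<lambda>p. (m p, \<psi> p)) ` ?I)" by (simp add: card_image[OF inj])
      also have "\<dots> \<le> card ?F"
        using \<Omega>D(5,7,8) by (intro card_mono[OF finF]) (auto simp: primitive_character_def)
      also have "\<dots> = (\<Sum>m\<in>{0<..2 * M}. card {\<chi>. dcharacter m \<chi>})"
        by (intro card_SigmaI ballI finite_dcharacters) auto
      also have "\<dots> \<le> (\<Sum>m\<in>{0<..2 * M}. 2 * M)"
        by (intro sum_mono order_trans[OF card_dcharacters_le]) auto
      finally show ?thesis by (simp add: power2_eq_square)
    qed
    have "(\<Sum>p\<in>?I. norm (\<Sum>a\<in>{0<..Y}. snd p a) ^ (2 * k))
        = (\<Sum>p\<in>?I. norm (\<Sum>a\<in>{a \<in> {0<..Y}. coprime a s}. \<psi> p a) ^ (2 * k))"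
    proof (rule sum.cong[OF refl])
      fix p assume p: "p \<in> ?I"
      then have e: "fst p = conductor (fst p) (snd p) * s" using \<Omega>D(6)[of p] by (simp add: m_def)
      show "norm (\<Sum>a\<in>{0<..Y}. snd p a) ^ (2 * k) = norm (\<Sum>a\<in>{a \<in> {0<..Y}. coprime a s}. \<psi> p a) ^ (2 * k)"
        using character_sum_eq_primitive_sum[OF _ _ e] \<Omega>D(1,3)[of p] p by (simp add: \<psi>_def)
    qed
    also have "\<dots> \<le> real ((1 + A) * L) * (1 + real (card ?I) * (real (2 * M) ^ 2 / real L) ^ A) *
          (\<Sum>a\<in>{0<..Y}. real (divisor_count k a)) ^ k"
      by (rule amplified_large_sieve[OF finI _ Y L _ _ inj]) (use \<Omega>D(5,7,8) in auto)
    also have "\<dots> \<le> ?bd"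
    proof (intro mult_right_mono mult_left_mono add_left_mono zero_le_power sum_nonneg)
      have "real (card ?I) \<le> real ((2 * M)\<^sup>2)" using card by (subst of_nat_le_iff)
      then have "real (card ?I) \<le> (2 * real M)\<^sup>2" by simp
      then show "real (card ?I) * (real (2 * M) ^ 2 / real L) ^ A \<le> (2 * real M)\<^sup>2 * ((2 * real M)\<^sup>2 / real L) ^ A"
        by (auto intro: mult_right_mono)
    qed auto
    finally show ?thesis .
  qed
  have bd0: "?bd \<ge> 0" by (intro mult_nonneg_nonneg zero_le_power sum_nonneg add_nonneg_nonneg) auto
  have "(\<Sum>p\<in>\<Omega>. norm (\<Sum>a\<in>{0<..Y}. snd p a) ^ (2 * k))
      = (\<Sum>s\<in>{0<..R}. \<Sum>p\<in>{p \<in> \<Omega>. r p = s}. norm (\<Sum>a\<in>{0<..Y}. snd p a) ^ (2 * k))"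
    by (rule sum.group[symmetric]) (use fin\<Omega> r in auto)
  also have "\<dots> \<le> (\<Sum>s\<in>{0<..R}. ?bd)" by (intro sum_mono fib)
  also have "\<dots> = real R * ?bd" by simp
  also have "\<dots> \<le> (real X / real M) * ?bd"
    using bd0 by (intro mult_right_mono) (auto simp: R_def of_nat_div_le_of_nat)
  finally show ?thesis .
qed

text \<open>The sieved sum satisfies \<open>F\<^bsub>S \<union> {p}\<^esub>(z) = F\<^sub>S(z) - f(p) F\<^sub>S(z/p)\<close>, so each prime doubles the error.\<close>
lemma sieved_sum_approx:
  fixes f :: "nat \<Rightarrow> complex"
  assumes S: "finite S" "\<And>p. p \<in> S \<Longrightarrow> prime p"
    and f: "\<And>a b. f (a * b) = f a * f b" "\<And>a. norm (f a) \<le> 1"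
    and base: "\<And>z. z \<ge> 0 \<Longrightarrow> norm ((\<Sum>a | 0 < a \<and> real a \<le> z. f a) - of_real z * \<theta>) \<le> B"
    and z: "z \<ge> 0"
  shows "norm ((\<Sum>a | 0 < a \<and> real a \<le> z \<and> (\<forall>p\<in>S. \<not> p dvd a). f a)
      - of_real z * \<theta> * (\<Prod>p\<in>S. 1 - f p / of_nat p)) \<le> 2 ^ card S * B"
  using S z
proof (induction S arbitrary: z rule: finite_induct)
  case empty
  then show ?case using base by simp
next
  case (insert p S)
  define F where "F = (\<lambda>z::real. \<Sum>a | 0 < a \<and> real a \<le> z \<and> (\<forall>p\<in>S. \<not> p dvd a). f a)"
  define P where "P = (\<Prod>p\<in>S. 1 - f p / of_nat p)"
  have p: "prime p" using insert by auto
  then have p0: "p > 0" by (simp add: prime_gt_0_nat)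
  have fin: "finite {a. 0 < a \<and> real a \<le> z \<and> Q a}" for z Q
    by (rule finite_subset[of _ "{..nat \<lfloor>z\<rfloor>}"]) (auto simp: le_nat_floor)
  have IH: "norm (F z - of_real z * \<theta> * P) \<le> 2 ^ card S * B" if "z \<ge> 0" for z
    using insert that unfolding F_def P_def by auto
  have img: "{a. 0 < a \<and> real a \<le> z \<and> (\<forall>q\<in>S. \<not> q dvd a) \<and> p dvd a} =
      (\<lambda>b. p * b) ` {b. 0 < b \<and> real b \<le> z / real p \<and> (\<forall>q\<in>S. \<not> q dvd b)}" (is "?A = ?B")
  proof (intro equalityI subsetI)
    fix a assume a: "a \<in> ?A"
    then obtain b where b: "a = p * b" by auto
    then have "0 < b" "\<forall>q\<in>S. \<not> q dvd b" "real b \<le> z / real p" using a p0 by (auto simp: field_simps)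
    then show "a \<in> ?B" using b by blast
  next
    fix a assume "a \<in> ?B"
    then obtain b where b: "a = p * b" "0 < b" "real b \<le> z / real p" "\<forall>q\<in>S. \<not> q dvd b" by blast
    have "\<not> q dvd p * b" if "q \<in> S" for q
    proof -
      have "prime q" "q \<noteq> p" using insert that by auto
      then show ?thesis using b(4) that p by (metis prime_dvd_multD primes_dvd_imp_eq)
    qed
    then show "a \<in> ?A" using b p0 by (auto simp: field_simps)
  qed
  have split: "{a. 0 < a \<and> real a \<le> z \<and> (\<forall>q\<in>insert p S. \<not> q dvd a)} =
      {a. 0 < a \<and> real a \<le> z \<and> (\<forall>q\<in>S. \<not> q dvd a)} - ?A" by auto
  have "(\<Sum>a | 0 < a \<and> real a \<le> z \<and> (\<forall>q\<in>insert p S. \<not> q dvd a). f a) = F z - (\<Sum>a\<in>?A. f a)"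
    unfolding split F_def by (rule sum_diff[OF fin]) auto
  also have "(\<Sum>a\<in>?A. f a) = f p * F (z / real p)"
    unfolding img F_def using p0 by (subst sum.reindex) (auto simp: inj_on_def f(1) sum_distrib_left)
  finally have e: "(\<Sum>a | 0 < a \<and> real a \<le> z \<and> (\<forall>q\<in>insert p S. \<not> q dvd a). f a)
      = F z - f p * F (z / real p)" .
  have "norm ((\<Sum>a | 0 < a \<and> real a \<le> z \<and> (\<forall>q\<in>insert p S. \<not> q dvd a). f a)
      - of_real z * \<theta> * ((1 - f p / of_nat p) * P))
      = norm ((F z - of_real z * \<theta> * P) - f p * (F (z / real p) - of_real (z / real p) * \<theta> * P))"
    unfolding e by (simp add: algebra_simps)
  also have "\<dots> \<le> norm (F z - of_real z * \<theta> * P) + norm (f p) * norm (F (z / real p) - of_real (z / real p) * \<theta> * P)"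
    using norm_triangle_ineq4 unfolding norm_mult[symmetric] .
  also have "\<dots> \<le> 2 ^ card S * B + 1 * (2 ^ card S * B)"
    using insert.prems by (intro add_mono mult_mono IH f) auto
  finally show ?case using insert.hyps by (simp add: P_def mult_ac)
qed

lemma coprime_iff_no_prime_factor:
  fixes a n :: nat
  assumes "n > 0"
  shows "coprime a n \<longleftrightarrow> (\<forall>p\<in>prime_factors n. \<not> p dvd a)"
proof
  assume "coprime a n"
  then show "\<forall>p\<in>prime_factors n. \<not> p dvd a"
    by (metis coprime_common_divisor in_prime_factors_iff not_prime_unit)
next
  assume h: "\<forall>p\<in>prime_factors n. \<not> p dvd a"
  show "coprime a n"
  proof (rule ccontr)
    assume "\<not> coprime a n"
    then obtain p where "prime p" "p dvd a" "p dvd n"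
      by (metis prime_factor_nat coprime_iff_gcd_eq_1 gcd_dvd1 gcd_dvd2 dvd_trans)
    then show False using h assms by (simp add: in_prime_factors_iff)
  qed
qed

lemma greaterThanAtMost_floor_eq:
  "{0<..nat \<lfloor>z\<rfloor>} = {a::nat. 0 < a \<and> real a \<le> z}"
  by (auto simp: le_nat_floor) linarith

text \<open>The sieve estimate for the constant function 1, which has mean 1 and error at most 1
  before sieving.\<close>

lemma coprime_count_approx:
  assumes "n > 0" "z \<ge> 0"
  shows "\<bar>real (card {a \<in> {0<..nat \<lfloor>z\<rfloor>}. coprime a n}) - z * real (totient n) / real n\<bar> \<le> 2 ^ card (prime_factors n)"
proof -
  let ?S = "prime_factors n"
  have "norm ((\<Sum>a | 0 < a \<and> real a \<le> z \<and> (\<forall>p\<in>?S. \<not> p dvd a). 1 :: complex)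
      - of_real z * 1 * (\<Prod>p\<in>?S. 1 - 1 / of_nat p)) \<le> 2 ^ card ?S * (1 :: real)"
  proof (rule sieved_sum_approx[where f = "\<lambda>_. 1"])
    fix z :: real assume z: "z \<ge> 0"
    have "(\<Sum>a | 0 < a \<and> real a \<le> z. 1 :: complex) - of_real z * 1 = complex_of_real (real (nat \<lfloor>z\<rfloor>) - z)"
      unfolding greaterThanAtMost_floor_eq[symmetric] by simp
    moreover have "\<bar>real (nat \<lfloor>z\<rfloor>) - z\<bar> \<le> 1" using z by linarith
    ultimately show "norm ((\<Sum>a | 0 < a \<and> real a \<le> z. 1 :: complex) - of_real z * 1) \<le> (1 :: real)"
      by (simp only: norm_of_real)
  qed (use assms in auto)
  moreover have "{a. 0 < a \<and> real a \<le> z \<and> (\<forall>p\<in>?S. \<not> p dvd a)} = {a \<in> {0<..nat \<lfloor>z\<rfloor>}. coprime a n}"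
    unfolding greaterThanAtMost_floor_eq coprime_iff_no_prime_factor[OF assms(1)] by auto
  moreover have "of_real (real (totient n) / real n) = (\<Prod>p\<in>?S. 1 - 1 / of_nat p :: complex)"
    using assms(1) by (simp add: totient_formula2)
  ultimately have "norm (of_nat (card {a \<in> {0<..nat \<lfloor>z\<rfloor>}. coprime a n}) - complex_of_real z * of_real (real (totient n) / real n))
      \<le> 2 ^ card ?S" by simp
  then have "norm (complex_of_real (real (card {a \<in> {0<..nat \<lfloor>z\<rfloor>}. coprime a n}) - z * real (totient n) / real n))
      \<le> 2 ^ card ?S" by simp
  then show ?thesis by (simp only: norm_of_real)
qed

text \<open>The sieve by the primes of \<open>n\<close> is applied to the primitive character, which
  has mean 0 and partial sums bounded by the conductor.\<close>

lemma character_sum_small_conductor: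
  assumes "dcharacter n \<chi>" "n > 0" "\<chi> \<noteq> principal_character n"
  shows "norm (\<Sum>a\<in>{0<..Y}. \<chi> a) \<le> 2 ^ card (prime_factors n) * real (conductor n \<chi>)"
proof -
  let ?m = "conductor n \<chi>" and ?\<psi> = "primitivization n \<chi>" and ?S = "prime_factors n"
  note c = conductor_pair[OF assms(1,2)]
  obtain b where b: "coprime b n" "\<chi> b \<noteq> 1" using nonprincipal_witness[OF assms(1,3)] by blast
  have bm: "coprime b ?m" using b(1) c(1) by (metis coprime_divisors dvd_refl)
  have mz: "mean_zero_periodic ?m ?\<psi>"
    by (rule mean_zero_periodic_dcharacter[OF c(6,4) bm]) (use b c(3) in auto)
  have "norm ((\<Sum>a | 0 < a \<and> real a \<le> real Y \<and> (\<forall>p\<in>?S. \<not> p dvd a). ?\<psi> a)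
      - of_real (real Y) * 0 * (\<Prod>p\<in>?S. 1 - ?\<psi> p / of_nat p)) \<le> 2 ^ card ?S * real ?m"
  proof (rule sieved_sum_approx)
    fix z :: real assume "z \<ge> 0"
    have "{0<..nat \<lfloor>z\<rfloor>} = Suc ` {..<nat \<lfloor>z\<rfloor>}" by (simp add: image_Suc_lessThan atLeastSucAtMost_greaterThanAtMost)
    then have "(\<Sum>a | 0 < a \<and> real a \<le> z. ?\<psi> a) = (\<Sum>u<nat \<lfloor>z\<rfloor>. ?\<psi> (1 + u))"
      unfolding greaterThanAtMost_floor_eq[symmetric] by (simp add: sum.reindex)
    then show "norm ((\<Sum>a | 0 < a \<and> real a \<le> z. ?\<psi> a) - of_real z * 0) \<le> real ?m"
      using norm_sum_mean_zero_periodic[OF mz c(4) dcharacter_norm_le[OF c(6,4)], where s = 1] by simp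
  qed (use dcharacterD(2)[OF c(6)] dcharacter_norm_le[OF c(6,4)] in auto)
  moreover have "(\<Sum>a\<in>{0<..Y}. \<chi> a) = (\<Sum>a | 0 < a \<and> real a \<le> real Y \<and> (\<forall>p\<in>?S. \<not> p dvd a). ?\<psi> a)"
  proof -
    have "(\<Sum>a\<in>{0<..Y}. \<chi> a) = (\<Sum>a\<in>{0<..Y}. if coprime a n then ?\<psi> a else 0)"
      using dcharacter_eq_primitivization[OF assms(1,2)] by metis
    also have "\<dots> = (\<Sum>a\<in>{a \<in> {0<..Y}. coprime a n}. ?\<psi> a)" by (simp only: sum.inter_filter[OF finite_greaterThanAtMost])
    also have "{a \<in> {0<..Y}. coprime a n} = {a. 0 < a \<and> real a \<le> real Y \<and> (\<forall>p\<in>?S. \<not> p dvd a)}"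
      unfolding coprime_iff_no_prime_factor[OF assms(2)] by auto
    finally show ?thesis .
  qed
  ultimately show ?thesis by simp
qed

section \<open>Harmonic sums and the average of 2^omega(n)\<close>

lemma sum_inverse_le_ln:
  "(\<Sum>d\<in>{0<..X}. 1 / real d) \<le> 1 + ln (real X)" if "X > 0"
  using that
proof (induction X rule: nat_induct_non_zero)
  case 1
  have "{0<..1::nat} = {1}" by auto
  then show ?case by simp
next
  case (Suc n)
  have "{0<..Suc n} = insert (Suc n) {0<..n}" by auto
  then have "(\<Sum>d\<in>{0<..Suc n}. 1 / real d) \<le> 1 / real (Suc n) + (1 + ln (real n))" using Suc by simp
  moreover have "ln (real n / real (Suc n)) \<le> real n / real (Suc n) - 1"
    using Suc by (intro ln_le_minus_one) simp
  moreover have "real n / real (Suc n) - 1 = - (1 / real (Suc n))" by (simp add: field_simps)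
  ultimately show ?case using Suc by (simp add: ln_div)
qed

lemma prod_prime_factors_dvd:
  fixes n :: nat
  assumes "D \<subseteq> prime_factors n"
  shows "\<Prod>D dvd n"
proof -
  have "finite D" using assms finite_subset by blast
  then show ?thesis using assms
  proof (induction D rule: finite_induct)
    case (insert p D)
    have "coprime p (\<Prod>D)"
    proof (rule prod_coprime_right)
      fix q assume "q \<in> D"
      then have "prime p" "prime q" "p \<noteq> q" using insert by auto
      then show "coprime p q" by (rule primes_coprime)
    qed
    moreover have "p dvd n" "\<Prod>D dvd n" using insert by auto
    ultimately show ?case using insert by (simp add: divides_mult)
  qed simp
qed

lemma inj_on_prod_primes:
  fixes P :: "nat set"
  assumes "finite P" "\<And>p. p \<in> P \<Longrightarrow> prime p"
  shows "inj_on \<Prod> (Pow P)"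
proof (rule inj_onI)
  have mem: "p \<in> D \<longleftrightarrow> p dvd \<Prod>D" if "D \<subseteq> P" "p \<in> P" for D p
  proof -
    have "finite D" using that assms finite_subset by blast
    then have "p dvd \<Prod>D \<longleftrightarrow> (\<exists>q\<in>D. p dvd q)"
      using prime_dvd_prod_iff[of D p "\<lambda>x. x"] assms(2)[OF that(2)] by auto
    then show ?thesis using that assms(2) by (metis dvd_refl primes_dvd_imp_eq subsetD)
  qed
  fix D E assume "D \<in> Pow P" "E \<in> Pow P" "\<Prod>D = \<Prod>E"
  then show "D = E" using mem[of D] mem[of E] by auto
qed

text \<open>Distinct sets of prime factors have distinct products, and each product divides
  \<open>n\<close>.\<close>

lemma two_power_prime_factors_le:
  fixes n :: nat
  assumes "n > 0"
  shows "2 ^ card (prime_factors n) \<le> card {d. d dvd n}"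
proof -
  have "2 ^ card (prime_factors n) = card (Pow (prime_factors n))" by (simp add: card_Pow)
  also have "\<dots> = card (\<Prod> ` Pow (prime_factors n))"
    by (rule card_image[OF inj_on_prod_primes, symmetric]) auto
  also have "\<dots> \<le> card {d. d dvd n}"
    using assms prod_prime_factors_dvd by (intro card_mono) auto
  finally show ?thesis .
qed

lemma sum_two_power_prime_factors_le:
  assumes "X > 0"
  shows "(\<Sum>n\<in>{0<..X}. 2 ^ card (prime_factors n)) \<le> real X * (1 + ln (real X))"
proof -
  have "real (\<Sum>n\<in>{0<..X}. 2 ^ card (prime_factors n)) \<le> real (\<Sum>n\<in>{0<..X}. card {d. d dvd n})"
    by (subst of_nat_le_iff) (intro sum_mono two_power_prime_factors_le, auto)
  also have "(\<Sum>n\<in>{0<..X}. card {d. d dvd n}) = (\<Sum>n\<in>{0<..X}. \<Sum>d\<in>{d \<in> {0<..X}. d dvd n}. 1)"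
  proof (rule sum.cong[OF refl])
    fix n assume "n \<in> {0<..X}"
    then have "{d. d dvd n} = {d \<in> {0<..X}. d dvd n}"
      by (auto intro: dvd_pos_nat order_trans[OF dvd_imp_le])
    then show "card {d. d dvd n} = (\<Sum>d\<in>{d \<in> {0<..X}. d dvd n}. 1)" by simp
  qed
  also have "\<dots> = (\<Sum>d\<in>{0<..X}. card {n \<in> {0<..X}. d dvd n})"
    by (subst sum.swap_restrict) auto
  also have "real \<dots> \<le> (\<Sum>d\<in>{0<..X}. real X * (1 / real d))"
    unfolding of_nat_sum
  proof (rule sum_mono)
    fix d assume d: "d \<in> {0<..X}"
    have "{n \<in> {0<..X}. d dvd n} \<subseteq> (\<lambda>e. d * e) ` {0<..X div d}"
    proof
      fix n assume n: "n \<in> {n \<in> {0<..X}. d dvd n}"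
      then obtain e where "n = d * e" by auto
      then show "n \<in> (\<lambda>e. d * e) ` {0<..X div d}"
        using n d by (auto simp: less_eq_div_iff_mult_less_eq mult.commute)
    qed
    then have "card {n \<in> {0<..X}. d dvd n} \<le> card ((\<lambda>e. d * e) ` {0<..X div d})" by (intro card_mono) auto
    also have "\<dots> \<le> X div d" using card_image_le[of "{0<..X div d}" "\<lambda>e. d * e"] by simp
    finally have "real (card {n \<in> {0<..X}. d dvd n}) \<le> real (X div d)" by simp
    also have "\<dots> \<le> real X / real d" by (rule of_nat_div_le_of_nat)
    finally show "real (card {n \<in> {0<..X}. d dvd n}) \<le> real X * (1 / real d)" by simp
  qed
  also have "\<dots> \<le> real X * (1 + ln (real X))"
    unfolding sum_distrib_left[symmetric] by (intro mult_left_mono sum_inverse_le_ln assms) auto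
  finally show ?thesis by simp
qed

text \<open>The comparison is with the actual number of \<open>a \<le> Y\<close> coprime to
  \<open>n\<close>, so that the principal character contributes nothing to the difference.\<close>

definition discrepancy :: "nat \<Rightarrow> nat \<Rightarrow> nat set \<Rightarrow> real" where
  "discrepancy Y n H = \<bar>real (card {a \<in> {0<..Y}. a \<in> H}) -
     real (card (totatives n \<inter> H)) / real (totient n) * real (card {a \<in> {0<..Y}. coprime a n})\<bar>"

text \<open>Orthogonality detects membership in \<open>H\<close>, and the principal character yields
  exactly the subtracted term because the density of \<open>H\<close> is one over the size of the
  annihilator. That size stays inside the sum, as the later weight of each character.\<close>

lemma discrepancy_le:
  assumes H: "mod_subgroup n H" and n: "n > 0"
  shows "discrepancy Y n H \<le> (\<Sum>\<chi>\<in>annihilator n H - {principal_character n}.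
    norm (\<Sum>a\<in>{0<..Y}. \<chi> a) / real (card (annihilator n H)))"
proof -
  let ?X = "annihilator n H" and ?p = "principal_character n"
  define K where "K = real (card ?X)"
  have K0: "K > 0" unfolding K_def
    using principal_in_annihilator[OF H] finite_annihilator[OF n] by (auto simp: card_gt_0_iff)
  have "real (card ?X) * real (card (totatives n \<inter> H)) = real (totient n)"
    using card_annihilator[OF H n] by (metis of_nat_mult)
  then have idx: "real (card (totatives n \<inter> H)) / real (totient n) = 1 / K"
    using K0 n unfolding K_def by (auto simp: field_simps)
  have "complex_of_real (K * real (card {a \<in> {0<..Y}. a \<in> H})) = (\<Sum>a\<in>{0<..Y}. if a \<in> H then of_real K else 0)"
    by (simp add: sum.If_cases Int_def mult.commute)
  also have "\<dots> = (\<Sum>a\<in>{0<..Y}. \<Sum>\<chi>\<in>?X. \<chi> a)"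
    by (intro sum.cong refl) (simp add: sum_annihilator[OF H n] K_def)
  also have "\<dots> = (\<Sum>\<chi>\<in>?X. \<Sum>a\<in>{0<..Y}. \<chi> a)" by (rule sum.swap)
  also have "\<dots> = (\<Sum>a\<in>{0<..Y}. ?p a) + (\<Sum>\<chi>\<in>?X - {?p}. \<Sum>a\<in>{0<..Y}. \<chi> a)"
    by (rule sum.remove[OF finite_annihilator[OF n] principal_in_annihilator[OF H]])
  also have "(\<Sum>a\<in>{0<..Y}. ?p a) = complex_of_real (real (card {a \<in> {0<..Y}. coprime a n}))"
    by (simp add: principal_character_def sum.If_cases Int_def)
  finally have e: "complex_of_real (K * real (card {a \<in> {0<..Y}. a \<in> H}) - real (card {a \<in> {0<..Y}. coprime a n}))
      = (\<Sum>\<chi>\<in>?X - {?p}. \<Sum>a\<in>{0<..Y}. \<chi> a)" by simp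
  have "K * discrepancy Y n H = \<bar>K * real (card {a \<in> {0<..Y}. a \<in> H}) - real (card {a \<in> {0<..Y}. coprime a n})\<bar>"
    unfolding discrepancy_def idx using K0 by (simp add: abs_mult_pos' right_diff_distrib)
  also have "\<dots> = norm (\<Sum>\<chi>\<in>?X - {?p}. \<Sum>a\<in>{0<..Y}. \<chi> a)" unfolding e[symmetric] norm_of_real ..
  also have "\<dots> \<le> (\<Sum>\<chi>\<in>?X - {?p}. norm (\<Sum>a\<in>{0<..Y}. \<chi> a))" by (rule norm_sum)
  finally have "discrepancy Y n H \<le> (\<Sum>\<chi>\<in>?X - {?p}. norm (\<Sum>a\<in>{0<..Y}. \<chi> a)) / K"
    using K0 by (simp add: field_simps)
  then show ?thesis unfolding K_def by (simp add: sum_divide_distrib)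
qed

lemma sum_Un_le:
  fixes f :: "'i \<Rightarrow> real"
  assumes "finite A" "finite B" "\<And>i. f i \<ge> 0"
  shows "sum f (A \<union> B) \<le> sum f A + sum f B"
proof -
  have "sum f (A \<union> B) + sum f (A \<inter> B) = sum f A + sum f B" by (rule sum.union_inter[OF assms(1,2)])
  moreover have "sum f (A \<inter> B) \<ge> 0" by (intro sum_nonneg assms)
  ultimately show ?thesis by linarith
qed

lemma sum_UNION_le:
  fixes f :: "'i \<Rightarrow> real"
  assumes "finite J" "\<And>j. finite (A j)" "\<And>i. f i \<ge> 0"
  shows "sum f (\<Union>j\<in>J. A j) \<le> (\<Sum>j\<in>J. sum f (A j))"
  using assms(1)
proof (induction J rule: finite_induct)
  case (insert j J)
  have "sum f (A j \<union> (\<Union>j\<in>J. A j)) \<le> sum f (A j) + sum f (\<Union>j\<in>J. A j)"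
    using insert assms by (intro sum_Un_le) auto
  then show ?case using insert by simp
qed simp

text \<open>In place of Hoelder's inequality: \<open>t \<le> \<eta> + \<eta> (t/\<eta>)\<^sup>l\<close> for every threshold \<open>\<eta>\<close>.\<close>
lemma le_threshold_power:
  fixes t \<eta> :: real
  assumes "\<eta> > 0" "t \<ge> 0" "l > 0"
  shows "t \<le> \<eta> + \<eta> * (t / \<eta>) ^ l"
proof (cases "t \<le> \<eta>")
  case False
  then have "t / \<eta> \<le> (t / \<eta>) ^ l" using assms by (intro self_le_power) auto
  then have "\<eta> * (t / \<eta>) \<le> \<eta> * (t / \<eta>) ^ l" using assms by (intro mult_left_mono) auto
  then show ?thesis using assms by simp
next
  case True
  moreover have "\<eta> * (t / \<eta>) ^ l \<ge> 0" using assms by (intro mult_nonneg_nonneg zero_le_power) auto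
  ultimately show ?thesis by linarith
qed

text \<open>Conductors up to \<open>T\<close> are handled by periodicity and the average of
  \<open>2 ^ card (prime_factors n)\<close>, the others in dyadic blocks indexed by
  \<open>J\<close>. The hypothesis \<open>bound\<close> says that in each block the moment is small
  against the threshold \<open>\<eta>\<close>.\<close>

lemma sum_discrepancy_le:
  fixes H :: "nat \<Rightarrow> nat set" and k :: "nat \<Rightarrow> nat" and L :: "nat \<Rightarrow> nat"
  assumes X: "X > 0" and Y: "Y > 0" and T: "T \<ge> 1" and \<eta>: "\<eta> > 0"
    and H: "\<And>n. n \<in> {0<..X} \<Longrightarrow> mod_subgroup n (H n)"
    and J: "finite J" "\<And>j. T < real (2 ^ Suc j) \<Longrightarrow> 2 ^ j \<le> X \<Longrightarrow> j \<in> J"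
    and kL: "\<And>j. j \<in> J \<Longrightarrow> k j > 0 \<and> Y ^ k j \<le> L j"
    and bound: "\<And>j. j \<in> J \<Longrightarrow> (real ((1 + A) * L j) * (1 + (2 * 2 ^ j)\<^sup>2 * ((2 * 2 ^ j)\<^sup>2 / real (L j)) ^ A) *
          (\<Sum>a\<in>{0<..Y}. real (divisor_count (k j) a)) ^ k j) / 2 ^ j \<le> C * \<eta> ^ (2 * k j)"
  shows "(\<Sum>n\<in>{0<..X}. discrepancy Y n (H n)) \<le> T * (real X * (1 + ln (real X))) + real (card J) * ((1 + C) * \<eta> * real X)"
proof -
  let ?\<Omega> = "nonprincipal_pairs X H"
  define S where "S = (\<lambda>p :: nat \<times> (nat \<Rightarrow> complex). norm (\<Sum>a\<in>{0<..Y}. snd p a))"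
  define w where "w = (\<lambda>n. 1 / real (card (annihilator n (H n))))"
  define m where "m = (\<lambda>p. conductor (fst p) (snd p))"
  have w: "0 \<le> w n" "w n \<le> 1" for n
    unfolding w_def by (auto simp: divide_le_eq_1 Suc_leI intro: Nat.gr0I)
  have fin: "finite ?\<Omega>" by (rule finite_nonprincipal_pairs)
  \<comment> \<open>The weights of the characters of one modulus add up to at most 1, so a bound
    depending only on \<open>n\<close> costs no factor for the number of characters.\<close>
  have wsum: "(\<Sum>p\<in>?\<Omega>. g (fst p) * w (fst p)) \<le> (\<Sum>n\<in>{0<..X}. g n)" if g: "\<And>n. g n \<ge> 0" for g :: "nat \<Rightarrow> real"
  proof -
    have "(\<Sum>p\<in>?\<Omega>. g (fst p) * w (fst p)) =
        (\<Sum>n\<in>{0<..X}. \<Sum>\<chi>\<in>annihilator n (H n) - {principal_character n}. g n * w n)"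
      unfolding nonprincipal_pairs_def
      by (subst sum.Sigma) (auto intro!: finite_Diff finite_annihilator simp: case_prod_beta)
    also have "\<dots> \<le> (\<Sum>n\<in>{0<..X}. g n)"
    proof (rule sum_mono)
      fix n assume "n \<in> {0<..X}"
      then have "card (annihilator n (H n) - {principal_character n}) \<le> card (annihilator n (H n))"
        by (intro card_mono finite_annihilator) auto
      then have "real (card (annihilator n (H n) - {principal_character n})) * w n \<le> real (card (annihilator n (H n))) * w n"
        by (intro mult_right_mono w) auto
      also have "\<dots> \<le> 1" by (simp add: w_def)
      finally have "g n * (real (card (annihilator n (H n) - {principal_character n})) * w n) \<le> g n * 1"
        by (intro mult_left_mono g)
      then show "(\<Sum>\<chi>\<in>annihilator n (H n) - {principal_character n}. g n * w n) \<le> g n" by (simp add: mult_ac)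
    qed
    finally show ?thesis .
  qed
  have "(\<Sum>n\<in>{0<..X}. discrepancy Y n (H n)) \<le>
      (\<Sum>n\<in>{0<..X}. \<Sum>\<chi>\<in>annihilator n (H n) - {principal_character n}. norm (\<Sum>a\<in>{0<..Y}. \<chi> a) * w n)"
    unfolding w_def by (rule sum_mono) (use discrepancy_le[OF H] in auto)
  also have "\<dots> = (\<Sum>p\<in>?\<Omega>. S p * w (fst p))"
    unfolding nonprincipal_pairs_def S_def
    by (subst sum.Sigma) (auto intro!: finite_Diff finite_annihilator simp: case_prod_beta)
  also have "\<dots> \<le> (\<Sum>p\<in>{p \<in> ?\<Omega>. real (m p) \<le> T}. S p * w (fst p)) +
      (\<Sum>j\<in>J. \<Sum>p\<in>{p \<in> ?\<Omega>. 2 ^ j < m p \<and> m p \<le> 2 * 2 ^ j}. S p * w (fst p))"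
  proof -
    have Sw: "S p * w (fst p) \<ge> 0" for p :: "nat \<times> (nat \<Rightarrow> complex)" using w by (simp add: S_def)
    have sub: "?\<Omega> \<subseteq> {p \<in> ?\<Omega>. real (m p) \<le> T} \<union> (\<Union>j\<in>J. {p \<in> ?\<Omega>. 2 ^ j < m p \<and> m p \<le> 2 * 2 ^ j})"
    proof
      fix p assume p: "p \<in> ?\<Omega>"
      show "p \<in> {p \<in> ?\<Omega>. real (m p) \<le> T} \<union> (\<Union>j\<in>J. {p \<in> ?\<Omega>. 2 ^ j < m p \<and> m p \<le> 2 * 2 ^ j})"
      proof (cases "real (m p) \<le> T")
        case False
        have p': "(fst p, snd p) \<in> ?\<Omega>" using p by simp
        have mX: "m p \<le> X" unfolding m_def
          using conductor_pair(5)[OF nonprincipal_pairsD(3,1)[OF p']] nonprincipal_pairsD(2)[OF p'] by linarith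
        have m2: "m p \<ge> 2" using False T by linarith
        obtain j where j: "2 ^ j < m p" "m p \<le> 2 * 2 ^ j"
        proof -
          define i where "i = (LEAST i. m p \<le> 2 ^ i)"
          have i: "m p \<le> 2 ^ i" unfolding i_def by (rule LeastI[of _ "m p"]) (simp add: less_imp_le)
          have "i \<noteq> 0" using i m2 by (intro notI) simp
          then obtain j where j: "i = Suc j" by (cases i) auto
          have "\<not> m p \<le> 2 ^ j" using not_less_Least[of j "\<lambda>i. m p \<le> 2 ^ i"] j i_def by simp
          then show ?thesis using that[of j] i j by simp
        qed
        have "real (m p) \<le> real (2 ^ Suc j)" using j(2) by (subst of_nat_le_iff) simp
        then have "j \<in> J" using False j(1) mX by (intro J(2)) auto
        then show ?thesis using p j by auto
      qed (use p in simp)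
    qed
    have "(\<Sum>p\<in>?\<Omega>. S p * w (fst p)) \<le>
        (\<Sum>p\<in>{p \<in> ?\<Omega>. real (m p) \<le> T} \<union> (\<Union>j\<in>J. {p \<in> ?\<Omega>. 2 ^ j < m p \<and> m p \<le> 2 * 2 ^ j}). S p * w (fst p))"
      using fin J(1) by (intro sum_mono2[OF _ sub]) (auto intro: Sw)
    also have "\<dots> \<le> (\<Sum>p\<in>{p \<in> ?\<Omega>. real (m p) \<le> T}. S p * w (fst p)) +
        (\<Sum>p\<in>(\<Union>j\<in>J. {p \<in> ?\<Omega>. 2 ^ j < m p \<and> m p \<le> 2 * 2 ^ j}). S p * w (fst p))"
      using fin J(1) by (intro sum_Un_le) (auto intro: Sw)
    also have "(\<Sum>p\<in>(\<Union>j\<in>J. {p \<in> ?\<Omega>. 2 ^ j < m p \<and> m p \<le> 2 * 2 ^ j}). S p * w (fst p))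
        \<le> (\<Sum>j\<in>J. \<Sum>p\<in>{p \<in> ?\<Omega>. 2 ^ j < m p \<and> m p \<le> 2 * 2 ^ j}. S p * w (fst p))"
      using fin J(1) by (intro sum_UNION_le) (auto intro: Sw)
    finally show ?thesis by simp
  qed
  also have "\<dots> \<le> T * (real X * (1 + ln (real X))) + (\<Sum>j\<in>J. (1 + C) * \<eta> * real X)"
  proof (intro add_mono sum_mono)
    have "(\<Sum>p\<in>{p \<in> ?\<Omega>. real (m p) \<le> T}. S p * w (fst p)) \<le>
        (\<Sum>p\<in>{p \<in> ?\<Omega>. real (m p) \<le> T}. (T * 2 ^ card (prime_factors (fst p))) * w (fst p))"
    proof (intro sum_mono mult_right_mono w)
      fix p assume p: "p \<in> {p \<in> ?\<Omega>. real (m p) \<le> T}"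
      then have p': "(fst p, snd p) \<in> ?\<Omega>" by simp
      have "S p \<le> 2 ^ card (prime_factors (fst p)) * real (m p)"
        unfolding S_def m_def
        by (rule character_sum_small_conductor[OF nonprincipal_pairsD(3,1,4)[OF p']])
      also have "\<dots> \<le> 2 ^ card (prime_factors (fst p)) * T" using p by (intro mult_left_mono) auto
      finally show "S p \<le> T * 2 ^ card (prime_factors (fst p))" by (simp add: mult.commute)
    qed
    also have "\<dots> \<le> (\<Sum>p\<in>?\<Omega>. (T * 2 ^ card (prime_factors (fst p))) * w (fst p))"
      using fin T w by (intro sum_mono2) auto
    also have "\<dots> \<le> (\<Sum>n\<in>{0<..X}. T * 2 ^ card (prime_factors n))"
      by (rule wsum) (use T in auto)
    also have "\<dots> = T * (\<Sum>n\<in>{0<..X}. 2 ^ card (prime_factors n))" by (simp add: sum_distrib_left)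
    also have "\<dots> \<le> T * (real X * (1 + ln (real X)))"
      using T by (intro mult_left_mono sum_two_power_prime_factors_le X) auto
    finally show "(\<Sum>p\<in>{p \<in> ?\<Omega>. real (m p) \<le> T}. S p * w (fst p)) \<le> T * (real X * (1 + ln (real X)))" .
  next
    fix j assume j: "j \<in> J"
    let ?\<Omega>j = "{p \<in> ?\<Omega>. 2 ^ j < m p \<and> m p \<le> 2 * 2 ^ j}"
    have "(\<Sum>p\<in>?\<Omega>j. S p * w (fst p)) \<le> (\<Sum>p\<in>?\<Omega>j. \<eta> * w (fst p) + \<eta> * (S p / \<eta>) ^ (2 * k j))"
    proof (rule sum_mono)
      fix p
      \<comment> \<open>The weight is kept on the threshold term, where \<open>wsum\<close> needs
        it, and is bounded by 1 on the moment term, where the large sieve runs over all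
        characters.\<close>
      have "S p * w (fst p) \<le> (\<eta> + \<eta> * (S p / \<eta>) ^ (2 * k j)) * w (fst p)"
        using kL[OF j] by (intro mult_right_mono le_threshold_power \<eta> w) (auto simp: S_def)
      also have "\<dots> = \<eta> * w (fst p) + \<eta> * (S p / \<eta>) ^ (2 * k j) * w (fst p)" by (simp add: algebra_simps)
      also have "\<eta> * (S p / \<eta>) ^ (2 * k j) * w (fst p) \<le> \<eta> * (S p / \<eta>) ^ (2 * k j) * 1"
        using \<eta> by (intro mult_left_mono w) (auto simp: S_def)
      finally show "S p * w (fst p) \<le> \<eta> * w (fst p) + \<eta> * (S p / \<eta>) ^ (2 * k j)" by simp
    qed
    also have "\<dots> = (\<Sum>p\<in>?\<Omega>j. \<eta> * w (fst p)) + \<eta> * ((\<Sum>p\<in>?\<Omega>j. S p ^ (2 * k j)) / \<eta> ^ (2 * k j))"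
      by (simp add: sum.distrib power_divide sum_distrib_left sum_divide_distrib)
    also have "\<dots> \<le> \<eta> * real X + \<eta> * (C * real X)"
    proof (intro add_mono mult_left_mono)
      have "(\<Sum>p\<in>?\<Omega>j. \<eta> * w (fst p)) \<le> (\<Sum>p\<in>?\<Omega>. \<eta> * w (fst p))"
        using fin \<eta> w by (intro sum_mono2) auto
      also have "\<dots> \<le> (\<Sum>n\<in>{0<..X}. \<eta>)" using \<eta> by (intro wsum) auto
      finally show "(\<Sum>p\<in>?\<Omega>j. \<eta> * w (fst p)) \<le> \<eta> * real X" by (simp add: mult.commute)
      have "(\<Sum>p\<in>?\<Omega>j. S p ^ (2 * k j)) \<le> real X / real (2 ^ j) * (real ((1 + A) * L j) *
          (1 + (2 * real (2 ^ j))\<^sup>2 * ((2 * real (2 ^ j))\<^sup>2 / real (L j)) ^ A) *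
          (\<Sum>a\<in>{0<..Y}. real (divisor_count (k j) a)) ^ k j)"
        unfolding S_def m_def by (rule sum_conductor_block_le) (use Y kL[OF j] in auto)
      also have "\<dots> = real X * ((real ((1 + A) * L j) * (1 + (2 * 2 ^ j)\<^sup>2 * ((2 * 2 ^ j)\<^sup>2 / real (L j)) ^ A) *
          (\<Sum>a\<in>{0<..Y}. real (divisor_count (k j) a)) ^ k j) / 2 ^ j)" by simp
      also have "\<dots> \<le> real X * (C * \<eta> ^ (2 * k j))" by (intro mult_left_mono bound j) simp
      finally show "(\<Sum>p\<in>?\<Omega>j. S p ^ (2 * k j)) / \<eta> ^ (2 * k j) \<le> C * real X"
        using \<eta> by (simp add: divide_le_eq mult_ac)
    qed (use \<eta> in simp)
    finally show "(\<Sum>p\<in>?\<Omega>j. S p * w (fst p)) \<le> (1 + C) * \<eta> * real X" by (simp add: algebra_simps)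
  qed
  finally show ?thesis by simp
qed

section \<open>Discrepancy on average over the moduli\<close>

text \<open>The number 23/3 is 1 + 1/s for s = 0.15. The quadratic Taylor bound is accurate enough
  at 2.04/32 = 0.06375, and the 32nd power is taken afterwards.\<close>

lemma exp_204_ge: "23 / 3 \<le> exp (2.04 :: real)"
proof -
  have "(1.06578 :: real) \<le> 1 + 0.06375 + 0.06375 ^ 2 / 2" by (simp add: power2_eq_square)
  also have "\<dots> \<le> exp 0.06375" by (rule exp_lower_Taylor_quadratic) simp
  finally have "(1.06578 :: real) ^ 32 \<le> exp 0.06375 ^ 32" by (intro power_mono) auto
  also have "exp (0.06375 :: real) ^ 32 = exp 2.04" by (simp flip: exp_of_nat_mult)
  finally have "(1.06578 :: real) ^ 32 \<le> exp 2.04" .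
  moreover have "23 / 3 \<le> (1.06578 :: real) ^ 32" by (simp add: power_divide)
  ultimately show ?thesis by linarith
qed

text \<open>With \<open>\<nu> = ln y\<close>, \<open>\<mu> = ln M\<close> and \<open>L\<^sup>2 = ln x\<close>; this is the place where the constant 3.42 enters.\<close>
lemma exponent_inequality:
  fixes \<nu> \<mu> L :: real and k :: nat
  assumes \<nu>: "\<nu> \<ge> 1000000" "\<nu> \<ge> 3.42 * L" and L: "L \<ge> 0" "\<mu> \<le> L\<^sup>2" and \<mu>: "\<mu> \<ge> \<nu> / 2"
    and k: "2.0001 * \<mu> + ln 4 \<le> real k * \<nu>" "(real k - 1) * \<nu> \<le> 2.0001 * \<mu> + ln 4"
  shows "real k * (0.15 * \<nu> + 2.04 * real k + L / 2000) \<le> \<mu>"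
proof -
  have ln4: "0 < ln (4 :: real)" "ln (4 :: real) \<le> 1.4"
  proof -
    have "(4 :: real) \<le> exp 0.7 ^ 2"
    proof -
      have "(2 :: real) \<le> exp 0.7"
      proof -
        have "(1.19 :: real) \<le> 1 + 0.175 + 0.175 ^ 2 / 2" by (simp add: power2_eq_square)
        also have "\<dots> \<le> exp 0.175" by (rule exp_lower_Taylor_quadratic) simp
        finally have "(1.19 :: real) ^ 4 \<le> exp 0.175 ^ 4" by (intro power_mono) auto
        also have "exp (0.175 :: real) ^ 4 = exp 0.7" by (simp flip: exp_of_nat_mult)
        finally show ?thesis by (simp add: power_divide)
      qed
      then have "(2 :: real) ^ 2 \<le> exp 0.7 ^ 2" by (intro power_mono) auto
      then show ?thesis by simp
    qed
    also have "exp (0.7 :: real) ^ 2 = exp 1.4" by (simp flip: exp_of_nat_mult)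
    finally have "ln (4 :: real) \<le> ln (exp 1.4)" by (subst ln_le_cancel_iff) auto
    then show "ln (4 :: real) \<le> 1.4" by (simp only: ln_exp)
  qed simp
  have "L \<le> \<nu> / 3.42" using \<nu> by simp
  then have "L\<^sup>2 \<le> (\<nu> / 3.42)\<^sup>2" using L(1) by (intro power_mono)
  then have \<mu>le: "\<mu> \<le> \<nu> * \<nu> / 11.6964" using L(2) by (simp add: power2_eq_square)
  \<comment> \<open>Here 11.6964 = 3.42^2 and 2.0001/11.6964 < 0.171002; the additive terms are
    absorbed by the size of \<nu>.\<close>
  have k1: "real k - 1 \<le> 0.171002 * \<nu> + 0.01"
  proof -
    have "(real k - 1) * \<nu> \<le> 2.0001 * (\<nu> * \<nu> / 11.6964) + 1.4" using k(2) ln4 mult_left_mono[OF \<mu>le, of "2.0001"] by simp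
    also have "\<dots> \<le> (0.171002 * \<nu> + 0.01) * \<nu>"
    proof -
      obtain q where q: "q = \<nu> * \<nu>" "q \<ge> 0" by simp
      have "2.0001 * (q / 11.6964) + 1.4 \<le> 0.171002 * q + 0.01 * \<nu>" using q(2) \<nu>(1) by simp
      also have "\<dots> = (0.171002 * \<nu> + 0.01) * \<nu>" unfolding q(1) by (simp add: algebra_simps)
      finally show ?thesis unfolding q(1) .
    qed
    finally show ?thesis using \<nu> by (simp add: mult_le_cancel_right)
  qed
  have "\<nu> < 2.0001 * \<mu>" using \<mu> \<nu>(1) by simp
  also have "\<dots> \<le> 2.0001 * \<mu> + ln 4" by simp
  finally have "\<nu> < 2.0001 * \<mu> + ln 4" .
  then have "1 * \<nu> < real k * \<nu>" using k(1) by (simp only: mult_1 less_le_trans)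
  then have "1 < real k" using \<nu> by (subst (asm) mult_less_cancel_right) auto
  then have k2: "real k \<ge> 2" by simp
  \<comment> \<open>The factor 0.499975 is just below 1/2.0001.\<close>
  have \<mu>ge: "0.499975 * ((real k - 1) * \<nu> - 1.4) \<le> \<mu>"
  proof -
    have "(real k - 1) * \<nu> - 1.4 \<le> 2.0001 * \<mu>" using k(2) ln4 by linarith
    moreover have "\<mu> \<ge> 0" using \<mu> \<nu>(1) by simp
    ultimately show ?thesis by simp
  qed
  \<comment> \<open>Rounding \<open>k\<close> up loses a factor (k - 1)/k. For k \<ge> 600 this is
    harmless, since 0.499975 times 599/600 still exceeds 0.49901. For smaller k the term 2.04 k is
    negligible against \<nu>, and k \<ge> 2 leaves 0.2499 against 0.152.\<close>
  show ?thesis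
  proof (cases "real k \<ge> 600")
    case True
    have "0.15 * \<nu> + 2.04 * real k + L / 2000 \<le> 0.49901 * \<nu>" using k1 \<nu> by simp
    then have "real k * (0.15 * \<nu> + 2.04 * real k + L / 2000) \<le> real k * (0.49901 * \<nu>)"
      by (intro mult_left_mono) auto
    also have "\<dots> \<le> 0.499975 * ((real k - 1) * \<nu> - 1.4)"
    proof -
      obtain w where w: "w = real k * \<nu>" by simp
      have "600 * \<nu> \<le> w" unfolding w using True \<nu> by (intro mult_right_mono) auto
      then have "0.49901 * w \<le> 0.499975 * (w - \<nu> - 1.4)" using \<nu>(1) by simp
      moreover have "real k * (0.49901 * \<nu>) = 0.49901 * w" "(real k - 1) * \<nu> = w - \<nu>"
        by (simp_all add: w algebra_simps)
      ultimately show ?thesis by (simp only:)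
    qed
    finally show ?thesis using \<mu>ge by (rule order_trans)
  next
    case False
    have "0.15 * \<nu> + 2.04 * real k + L / 2000 \<le> 0.152 * \<nu>" using False \<nu> by simp
    then have "real k * (0.15 * \<nu> + 2.04 * real k + L / 2000) \<le> real k * (0.152 * \<nu>)"
      by (intro mult_left_mono) auto
    also have "\<dots> \<le> 0.499975 * ((real k - 1) * \<nu> - 1.4)"
    proof -
      obtain w where w: "w = real k * \<nu>" by simp
      have "2 * \<nu> \<le> w" unfolding w using k2 \<nu> by (intro mult_right_mono) auto
      then have "0.152 * w \<le> 0.499975 * (w - \<nu> - 1.4)" using \<nu>(1) by simp
      moreover have "real k * (0.152 * \<nu>) = 0.152 * w" "(real k - 1) * \<nu> = w - \<nu>"
        by (simp_all add: w algebra_simps)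
      ultimately show ?thesis by (simp only:)
    qed
    finally show ?thesis using \<mu>ge by (rule order_trans)
  qed
qed

text \<open>With M = 2^j, \<open>k\<close> is the least integer such that y^k is at least 4
  M^2.0001, and \<open>L\<close> is y^k rounded up. The factor 4 reflects that the conductors of the
  block reach 2 M.\<close>

lemma block_parameters:
  fixes x y :: real and j :: nat
  assumes y: "ln y \<ge> 1000000" "y > exp (3.42 * sqrt (ln x))" and x: "x \<ge> 1"
    and j: "y powr (2/3) < 2 ^ Suc j" "2 ^ j \<le> x"
  obtains k L :: nat where "k > 0" "nat \<lfloor>y\<rfloor> ^ k \<le> L"
    "(real ((1 + 20000) * L) * (1 + (2 * 2 ^ j)\<^sup>2 * ((2 * 2 ^ j)\<^sup>2 / real L) ^ 20000) *
       (\<Sum>a\<in>{0<..nat \<lfloor>y\<rfloor>}. real (divisor_count k a)) ^ k) / 2 ^ j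
     \<le> 200010 * (y * exp (- sqrt (ln x) / 4000)) ^ (2 * k)"
proof -
  define \<nu> where "\<nu> = ln y"
  define \<mu> where "\<mu> = real j * ln 2"
  define R where "R = sqrt (ln x)"
  have y0: "y > 0" using y(2) by (meson exp_gt_zero less_trans)
  have y\<nu>: "y = exp \<nu>" using y0 by (simp add: \<nu>_def)
  have M: "2 ^ j = exp \<mu>" by (simp add: \<mu>_def exp_of_nat_mult)
  have R0: "R \<ge> 0" using x by (simp add: R_def)
  have \<nu>R: "\<nu> \<ge> 3.42 * R" using y(2) y0 unfolding \<nu>_def R_def by (simp only: ln_ge_iff less_imp_le)
  have \<mu>R: "\<mu> \<le> R\<^sup>2"
  proof -
    have "exp \<mu> \<le> x" using j(2) M by simp
    then have "\<mu> \<le> ln x" using x by (simp add: ln_ge_iff)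
    then show ?thesis using x by (simp add: R_def)
  qed
  \<comment> \<open>Conductors up to y^(2/3) are treated elsewhere; the bound below on M is what
    forces k \<ge> 2 in \<open>exponent_inequality\<close>.\<close>
  have \<mu>\<nu>: "\<mu> \<ge> \<nu> / 2"
  proof -
    have "exp (2/3 * \<nu>) < 2 * exp \<mu>" using j(1) M y0 by (simp add: powr_def \<nu>_def)
    also have "\<dots> \<le> exp 1 * exp \<mu>" using exp_ge_add_one_self[of 1] by (intro mult_right_mono) auto
    also have "\<dots> = exp (1 + \<mu>)" by (simp add: exp_add)
    finally have "2/3 * \<nu> < 1 + \<mu>" by simp
    then show ?thesis using y(1) unfolding \<nu>_def[symmetric] by linarith
  qed
  have \<nu>0: "\<nu> > 0" using y(1) by (simp add: \<nu>_def)
  define t where "t = (2.0001 * \<mu> + ln 4) / \<nu>"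
  have t0: "t > 0" using \<mu>\<nu> \<nu>0 unfolding t_def by (intro divide_pos_pos add_nonneg_pos) auto
  define k where "k = nat \<lceil>t\<rceil>"
  define L where "L = nat \<lceil>y ^ k\<rceil>"
  have kt: "t \<le> real k" "real k - 1 \<le> t" using t0 unfolding k_def by linarith+
  have k0: "k > 0" using kt t0 by (intro gr0I) auto
  have kl: "2.0001 * \<mu> + ln 4 \<le> real k * \<nu>" "(real k - 1) * \<nu> \<le> 2.0001 * \<mu> + ln 4"
    using kt \<nu>0 by (simp_all add: t_def field_simps)
  have key: "real k * (0.15 * \<nu> + 2.04 * real k + R / 2000) \<le> \<mu>"
    by (rule exponent_inequality[OF _ \<nu>R R0 \<mu>R \<mu>\<nu> kl]) (use y(1) in \<open>simp add: \<nu>_def\<close>)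
  have yk1: "y ^ k \<ge> 1" using \<nu>0 y\<nu> by (intro one_le_power) simp
  have Lge: "y ^ k \<le> real L" unfolding L_def by (rule real_nat_ceiling_ge)
  have Lle: "real L \<le> 2 * y ^ k" using yk1 unfolding L_def by linarith
  have Y: "real (nat \<lfloor>y\<rfloor>) \<le> y" using y0 by simp
  have 1: "nat \<lfloor>y\<rfloor> ^ k \<le> L"
  proof -
    have "real (nat \<lfloor>y\<rfloor> ^ k) \<le> y ^ k" using Y by (simp add: power_mono)
    then have "real (nat \<lfloor>y\<rfloor> ^ k) \<le> real L" using Lge by linarith
    then show ?thesis by (simp only: of_nat_le_iff)
  qed
  have M2: "(2 * 2 ^ j)\<^sup>2 = 4 * exp (2 * \<mu>)"
    unfolding M power_mult_distrib by (simp add: power2_eq_square flip: exp_add)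
  have "(2 * 2 ^ j)\<^sup>2 / real L \<le> exp (- 0.0001 * \<mu>)"
  proof -
    have "4 * exp (2.0001 * \<mu>) = exp (2.0001 * \<mu> + ln 4)" by (simp add: exp_add)
    also have "\<dots> \<le> exp (real k * \<nu>)" using kl(1) by simp
    also have "\<dots> = y ^ k" by (simp add: y\<nu> exp_of_nat_mult)
    finally have "4 * exp (2.0001 * \<mu>) \<le> real L" using Lge by linarith
    then have "4 * exp (2.0001 * \<mu>) * exp (- 0.0001 * \<mu>) \<le> real L * exp (- 0.0001 * \<mu>)" by (intro mult_right_mono) auto
    moreover have "4 * exp (2.0001 * \<mu>) * exp (- 0.0001 * \<mu>) = 4 * exp (2 * \<mu>)"
      unfolding mult.assoc mult_exp_exp by simp
    ultimately have "4 * exp (2 * \<mu>) \<le> real L * exp (- 0.0001 * \<mu>)" by linarith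
    moreover have "real L > 0" using Lge yk1 by linarith
    ultimately show ?thesis unfolding M2 by (simp add: divide_le_eq mult.commute)
  qed
  \<comment> \<open>The 20000 box sums turn the saving M^(-0.0001) into M^(-2), which cancels the
    factor 4 M^2 from the number of characters.\<close>
  then have "((2 * 2 ^ j)\<^sup>2 / real L) ^ 20000 \<le> exp (- 0.0001 * \<mu>) ^ 20000" by (rule power_mono) simp
  also have "\<dots> = exp (- 2 * \<mu>)" by (simp flip: exp_of_nat_mult)
  finally have "(2 * 2 ^ j)\<^sup>2 * ((2 * 2 ^ j)\<^sup>2 / real L) ^ 20000 \<le> (4 * exp (2 * \<mu>)) * exp (- 2 * \<mu>)"
    unfolding M2 by (intro mult_left_mono) auto
  also have "\<dots> = 4" by (simp flip: exp_add)
  finally have F: "1 + (2 * 2 ^ j)\<^sup>2 * ((2 * 2 ^ j)\<^sup>2 / real L) ^ 20000 \<le> 5" by simp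
  have D: "(\<Sum>a\<in>{0<..nat \<lfloor>y\<rfloor>}. real (divisor_count k a)) \<le> exp (1.15 * \<nu> + 2.04 * real k)"
  proof -
    have "(\<Sum>a\<in>{0<..nat \<lfloor>y\<rfloor>}. real (divisor_count k a)) \<le> y powr (1 + 0.15) * (1 + 1 / 0.15) ^ k"
      by (rule sum_divisor_count_le[OF _ Y y0]) simp
    also have "\<dots> \<le> y powr (1 + 0.15) * exp 2.04 ^ k"
      using exp_204_ge by (intro mult_left_mono power_mono) auto
    also have "\<dots> = exp (1.15 * \<nu> + 2.04 * real k)"
      using y0 by (simp add: powr_def \<nu>_def exp_add mult.commute flip: exp_of_nat_mult)
    finally show ?thesis .
  qed
  have "(real ((1 + 20000) * L) * (1 + (2 * 2 ^ j)\<^sup>2 * ((2 * 2 ^ j)\<^sup>2 / real L) ^ 20000) *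
       (\<Sum>a\<in>{0<..nat \<lfloor>y\<rfloor>}. real (divisor_count k a)) ^ k) / 2 ^ j
     \<le> ((20001 * (2 * y ^ k)) * 5 * exp (1.15 * \<nu> + 2.04 * real k) ^ k) / 2 ^ j"
    using Lle F D by (intro divide_right_mono mult_mono power_mono) (auto simp: sum_nonneg)
  also have "\<dots> = 200010 * (exp (real k * \<nu>) * exp (real k * (1.15 * \<nu> + 2.04 * real k)) / exp \<mu>)"
    unfolding M y\<nu> by (simp add: exp_of_nat_mult)
  also have "\<dots> = 200010 * exp (real k * \<nu> + real k * (1.15 * \<nu> + 2.04 * real k) - \<mu>)"
    by (simp add: exp_add exp_diff)
  \<comment> \<open>This is \<open>key\<close>: the term k R/2000 there is distributed as R/4000
    over the 2 k factors.\<close>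
  also have "\<dots> \<le> 200010 * exp (real (2 * k) * (\<nu> - R / 4000))"
    using key by (simp add: algebra_simps)
  also have "\<dots> = 200010 * (y * exp (- R / 4000)) ^ (2 * k)"
    unfolding y\<nu> exp_of_nat_mult by (simp flip: exp_add)
  finally show ?thesis using that[OF k0 1] unfolding R_def by blast
qed

lemma discrepancy_average:
  "\<exists>x0. \<forall>x\<ge>x0. \<forall>y::real. y > exp (3.42 * sqrt (ln x)) \<longrightarrow>
     (\<forall>H. (\<forall>n\<in>{0<..nat \<lfloor>x\<rfloor>}. mod_subgroup n (H n)) \<longrightarrow>
        (\<Sum>n\<in>{0<..nat \<lfloor>x\<rfloor>}. discrepancy (nat \<lfloor>y\<rfloor>) n (H n)) \<le> x * y * exp (- (1/8000) * sqrt (ln x)))"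
proof -
  \<comment> \<open>With R = sqrt(ln x), the first summand belongs to the conductors up to y^(2/3),
    as 3.42/3 = 1.14. The second belongs to at most 1 + 2 R^2 dyadic blocks, with 200011 = 1 +
    200010.\<close>
  have "eventually (\<lambda>x::real. x \<ge> 1 \<and> 3.42 * sqrt (ln x) \<ge> 1000000 \<and>
     (1 + sqrt (ln x) ^ 2) * exp (- 1.14 * sqrt (ln x)) + (1 + 2 * sqrt (ln x) ^ 2) * (200011 * exp (- sqrt (ln x) / 4000))
       \<le> exp (- (1/8000) * sqrt (ln x))) at_top"
    by (intro eventually_conj; real_asymp)
  then obtain x0 where x0: "\<And>x::real. x \<ge> x0 \<Longrightarrow> x \<ge> 1 \<and> 3.42 * sqrt (ln x) \<ge> 1000000 \<and>
     (1 + sqrt (ln x) ^ 2) * exp (- 1.14 * sqrt (ln x)) + (1 + 2 * sqrt (ln x) ^ 2) * (200011 * exp (- sqrt (ln x) / 4000))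
       \<le> exp (- (1/8000) * sqrt (ln x))"
    unfolding eventually_at_top_linorder by blast
  have "(\<Sum>n\<in>{0<..nat \<lfloor>x\<rfloor>}. discrepancy (nat \<lfloor>y\<rfloor>) n (H n)) \<le> x * y * exp (- (1/8000) * sqrt (ln x))"
    if x: "x \<ge> x0" and y: "y > exp (3.42 * sqrt (ln x))" and H: "\<forall>n\<in>{0<..nat \<lfloor>x\<rfloor>}. mod_subgroup n (H n)" for x y H
  proof -
    define R where "R = sqrt (ln x)"
    note xx = x0[OF x, folded R_def]
    have y0: "y > 0" using y by (meson exp_gt_zero less_trans)
    have lny: "ln y \<ge> 3.42 * R" using y y0 by (simp only: ln_ge_iff less_imp_le R_def)
    have lny': "ln y \<ge> 1000000" using lny xx by linarith
    have R2: "R ^ 2 = ln x" using xx by (simp add: R_def)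
    have y1: "y \<ge> 1" using lny' y0 by (metis ln_ge_zero_iff order_trans zero_le_numeral)
    \<comment> \<open>For very large y there may be no such block; periodicity then covers all
      conductors up to x.\<close>
    define J where "J = {j. y powr (2/3) < 2 ^ Suc j \<and> (2::nat) ^ j \<le> nat \<lfloor>x\<rfloor>}"
    have jx: "(2::real) ^ j \<le> x" if "j \<in> J" for j
    proof -
      have "real (2 ^ j) \<le> real (nat \<lfloor>x\<rfloor>)" using that unfolding J_def by (subst of_nat_le_iff) simp
      also have "\<dots> \<le> x" using xx by simp
      finally show ?thesis by simp
    qed
    have Jsub: "J \<subseteq> {..nat \<lfloor>2 * R ^ 2\<rfloor>}"
    proof
      fix j assume j: "j \<in> J"
      have "real j * ln 2 \<le> ln x" using jx[OF j] xx by (simp add: ln_ge_iff exp_of_nat_mult)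
      moreover have "1/2 \<le> ln (2 :: real)" using exp_half_le2 by (simp only: ln_ge_iff zero_less_numeral)
      then have "real j * (1/2) \<le> real j * ln 2" by (intro mult_left_mono) auto
      ultimately have "real j \<le> 2 * R ^ 2" unfolding R2 by linarith
      then show "j \<in> {..nat \<lfloor>2 * R ^ 2\<rfloor>}" by (simp add: le_nat_floor)
    qed
    then have finJ: "finite J" by (rule finite_subset) simp
    have "card J \<le> Suc (nat \<lfloor>2 * R ^ 2\<rfloor>)" using card_mono[OF _ Jsub] by simp
    then have "real (card J) \<le> 1 + real (nat \<lfloor>2 * R ^ 2\<rfloor>)" by linarith
    also have "\<dots> \<le> 1 + 2 * R ^ 2" by simp
    finally have cardJ: "real (card J) \<le> 1 + 2 * R ^ 2" .
    have "\<exists>k L. k > 0 \<and> nat \<lfloor>y\<rfloor> ^ k \<le> L \<and>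
        (real ((1 + 20000) * L) * (1 + (2 * 2 ^ j)\<^sup>2 * ((2 * 2 ^ j)\<^sup>2 / real L) ^ 20000) *
       (\<Sum>a\<in>{0<..nat \<lfloor>y\<rfloor>}. real (divisor_count k a)) ^ k) / 2 ^ j
     \<le> 200010 * (y * exp (- sqrt (ln x) / 4000)) ^ (2 * k)" if "j \<in> J" for j
    proof -
      have "y powr (2/3) < 2 ^ Suc j" using that by (simp add: J_def)
      from block_parameters[OF lny' y _ this jx[OF that]] xx show ?thesis by metis
    qed
    then obtain k L where kL: "\<And>j. j \<in> J \<Longrightarrow> k j > 0 \<and> nat \<lfloor>y\<rfloor> ^ k j \<le> L j \<and>
        (real ((1 + 20000) * L j) * (1 + (2 * 2 ^ j)\<^sup>2 * ((2 * 2 ^ j)\<^sup>2 / real (L j)) ^ 20000) *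
       (\<Sum>a\<in>{0<..nat \<lfloor>y\<rfloor>}. real (divisor_count (k j) a)) ^ k j) / 2 ^ j
     \<le> 200010 * (y * exp (- sqrt (ln x) / 4000)) ^ (2 * k j)" by metis
    have "(\<Sum>n\<in>{0<..nat \<lfloor>x\<rfloor>}. discrepancy (nat \<lfloor>y\<rfloor>) n (H n)) \<le>
        y powr (2/3) * (real (nat \<lfloor>x\<rfloor>) * (1 + ln (real (nat \<lfloor>x\<rfloor>)))) +
        real (card J) * ((1 + 200010) * (y * exp (- sqrt (ln x) / 4000)) * real (nat \<lfloor>x\<rfloor>))"
    proof (rule sum_discrepancy_le[where k = k and L = L and A = 20000])
      show "nat \<lfloor>x\<rfloor> > 0" using xx by simp
      show "nat \<lfloor>y\<rfloor> > 0" using y1 by simp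
      show "y powr (2/3) \<ge> 1" using y1 by (simp add: ge_one_powr_ge_zero)
      show "j \<in> J" if "y powr (2/3) < real (2 ^ Suc j)" "2 ^ j \<le> nat \<lfloor>x\<rfloor>" for j
        using that by (simp add: J_def)
      show "k j > 0 \<and> nat \<lfloor>y\<rfloor> ^ k j \<le> L j" if "j \<in> J" for j using kL[OF that] by blast
    qed (use H kL finJ y0 in \<open>simp_all only: mult_pos_pos exp_gt_zero\<close>)
    also have "\<dots> \<le> y powr (2/3) * (x * (1 + R ^ 2)) + (1 + 2 * R ^ 2) * (200011 * (y * exp (- R / 4000)) * x)"
    proof -
      have "1 \<le> nat \<lfloor>x\<rfloor>" using xx by (simp add: le_nat_floor)
      then have X: "real (nat \<lfloor>x\<rfloor>) \<le> x" "real (nat \<lfloor>x\<rfloor>) \<ge> 1" using xx by auto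
      then have "ln (real (nat \<lfloor>x\<rfloor>)) \<le> R ^ 2" unfolding R2 by (subst ln_le_cancel_iff) auto
      then show ?thesis using X y0 cardJ xx unfolding R_def[symmetric]
        by (intro add_mono mult_mono) (auto intro!: add_nonneg_nonneg)
    qed
    also have "y powr (2/3) \<le> y * exp (- 1.14 * R)"
    proof -
      have "y powr (2/3) = exp (2/3 * ln y)" using y0 by (simp add: powr_def)
      also have "\<dots> \<le> exp (ln y + - 1.14 * R)" using lny by simp
      also have "\<dots> = y * exp (- 1.14 * R)" using y0 by (simp only: exp_add exp_ln)
      finally show ?thesis .
    qed
    then have "y powr (2/3) * (x * (1 + R ^ 2)) \<le> y * exp (- 1.14 * R) * (x * (1 + R ^ 2))"
      using xx by (intro mult_right_mono) auto
    then have "y powr (2/3) * (x * (1 + R ^ 2)) + (1 + 2 * R ^ 2) * (200011 * (y * exp (- R / 4000)) * x)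
        \<le> x * y * ((1 + R ^ 2) * exp (- 1.14 * R) + (1 + 2 * R ^ 2) * (200011 * exp (- R / 4000)))"
      by (simp add: algebra_simps)
    also have "\<dots> \<le> x * y * exp (- (1/8000) * R)"
      using xx y0 by (intro mult_left_mono) auto
    finally show ?thesis unfolding R_def .
  qed
  then show ?thesis by blast
qed

section \<open>Primitive roots by inclusion and exclusion\<close>

text \<open>The order of \<open>a\<close> divides \<open>Carmichael n\<close>, and a proper divisor
  of a number divides the quotient of that number by one of its primes.\<close>

lemma primroot_iff:
  assumes n: "n > 0" and a: "coprime a n"
  shows "lambda_primroot n a \<longleftrightarrow> (\<forall>q\<in>prime_factors (Carmichael n). \<not> [a ^ (Carmichael n div q) = 1] (mod n))"
proof -
  let ?c = "Carmichael n"
  have dvd: "ord n a dvd ?c"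
    using a n ord_dvd_Carmichael[of n a] by (cases "n = 1") (auto simp: coprime_commute)
  have pos: "ord n a > 0" using a by (simp add: coprime_commute)
  have "ord n a = ?c \<longleftrightarrow> (\<forall>q\<in>prime_factors ?c. \<not> ord n a dvd ?c div q)"
  proof
    assume e: "ord n a = ?c"
    show "\<forall>q\<in>prime_factors ?c. \<not> ord n a dvd ?c div q"
    proof
      fix q assume q: "q \<in> prime_factors ?c"
      then have "prime q" "q dvd ?c" by auto
      then have "q > 1" "q dvd ?c" using prime_gt_1_nat by auto
      then have "?c div q < ?c" "?c div q > 0" by (auto simp: dvd_div_pos)
      then show "\<not> ord n a dvd ?c div q" unfolding e by (metis dvd_imp_le not_le)
    qed
  next
    assume h: "\<forall>q\<in>prime_factors ?c. \<not> ord n a dvd ?c div q"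
    show "ord n a = ?c"
    proof (rule ccontr)
      assume ne: "ord n a \<noteq> ?c"
      obtain d where d: "?c = ord n a * d" using dvd by auto
      then have "d \<noteq> 1" using ne by auto
      then obtain q where q: "prime q" "q dvd d" using prime_factor_nat by blast
      then obtain e where e: "d = q * e" by auto
      have "q \<in> prime_factors ?c" using q d Carmichael_pos[of n] by (simp only: in_prime_factors_iff dvd_mult) simp
      moreover have "?c div q = ord n a * e" unfolding d e using q(1) by (simp add: prime_gt_0_nat)
      ultimately show False using h by auto
    qed
  qed
  then show ?thesis using a by (simp add: lambda_primroot_def ord_divides' ord_divides coprime_commute)
qed

text \<open>For a set \<open>D\<close> of prime factors of \<open>Carmichael n\<close>, these are
  the residues whose order divides \<open>Carmichael n div \<Prod>D\<close>: the intersection over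
  \<open>q \<in> D\<close> of the subgroups to be avoided.\<close>

definition power_residues :: "nat \<Rightarrow> nat set \<Rightarrow> nat set" where
  "power_residues n D = {a. coprime a n \<and> (\<forall>q\<in>D. [a ^ (Carmichael n div q) = 1] (mod n))}"

lemma mod_subgroup_power_residues: "mod_subgroup n (power_residues n D)"
  unfolding mod_subgroup_def
proof (intro conjI ballI allI impI)
  show "power_residues n D \<subseteq> {a. coprime a n}" "1 \<in> power_residues n D" by (auto simp: power_residues_def)
next
  fix a b assume ab: "a \<in> power_residues n D" "b \<in> power_residues n D"
  have "[(a * b) ^ (Carmichael n div q) = 1] (mod n)" if "q \<in> D" for q
    using cong_mult[of "a ^ (Carmichael n div q)" 1 n "b ^ (Carmichael n div q)" 1] ab that
    by (simp add: power_residues_def power_mult_distrib)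
  then show "a * b \<in> power_residues n D" using ab by (auto simp: power_residues_def)
next
  fix a b assume ab: "a \<in> power_residues n D" "[a = b] (mod n)"
  have "[b ^ (Carmichael n div q) = 1] (mod n)" if "q \<in> D" for q
    using ab that cong_pow[OF ab(2), of "Carmichael n div q"] unfolding power_residues_def
    by (metis (mono_tags, lifting) cong_sym cong_trans mem_Collect_eq)
  then show "b \<in> power_residues n D" using ab cong_imp_coprime by (auto simp: power_residues_def)
qed

text \<open>If \<open>g\<close> has order \<open>\<lambda>(n)\<close>, the cosets of the subgroup by \<open>g\<^sup>i\<close> with \<open>i < \<Prod>D\<close> are distinct.\<close>
lemma card_power_residues:
  assumes n: "n > 0" and D: "D \<subseteq> prime_factors (Carmichael n)"
  shows "card (totatives n \<inter> power_residues n D) * \<Prod>D \<le> totient n"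
proof -
  let ?c = "Carmichael n" and ?H = "power_residues n D"
  obtain g where g: "coprime g n" "ord n g = ?c"
    using Carmichael_root_exists[OF n] by (metis in_totatives_iff)
  have finD: "finite D" using D finite_subset by blast
  \<comment> \<open>Representatives in 1..n, as for \<open>totatives\<close>; the residue 0 becomes
    \<open>n\<close>.\<close>
  define r where "r = (\<lambda>a. if a mod n = 0 then n else a mod n)"
  have r: "[r a = a] (mod n)" for a by (simp add: r_def Cong.cong_def)
  have rtot: "r a \<in> totatives n" if "coprime a n" for a
  proof -
    have "coprime (r a) n" using that r cong_imp_coprime[OF cong_sym[OF r]] by blast
    moreover have "r a > 0" "r a \<le> n" using n by (auto simp: r_def less_imp_le)
    ultimately show ?thesis by (simp add: totatives_def)
  qed
  let ?f = "\<lambda>(h, i). r (h * g ^ i)"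
  have *: "h = h' \<and> i = j" if h: "h \<in> totatives n \<inter> ?H" "h' \<in> totatives n \<inter> ?H"
    and ij: "i < \<Prod>D" "j \<le> i" and e: "r (h * g ^ i) = r (h' * g ^ j)" for h h' i j
  proof -
    have cop: "coprime h n" "coprime h' n" using h by (auto simp: power_residues_def)
    have "[h * g ^ i = h' * g ^ j] (mod n)" using e r by (metis cong_sym cong_trans)
    moreover have "g ^ i = g ^ (i - j) * g ^ j" using ij by (simp flip: power_add)
    ultimately have "[(h * g ^ (i - j)) * g ^ j = h' * g ^ j] (mod n)" by (simp add: mult.assoc)
    then have c: "[h * g ^ (i - j) = h'] (mod n)"
      using g(1) by (simp add: cong_mult_rcancel_nat coprime_commute)
    then have "h * g ^ (i - j) \<in> ?H"
      using h mod_subgroupD(4)[OF mod_subgroup_power_residues, of h'] by (meson IntD2 cong_sym)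
    then have gH: "g ^ (i - j) \<in> ?H"
      using mod_subgroup_cancel[OF mod_subgroup_power_residues n] h by blast
    have "q dvd i - j" if q: "q \<in> D" for q
    proof -
      have "q \<in> prime_factors ?c" using q D by blast
      then have "prime q" "q dvd ?c" by auto
      then have qc: "q dvd ?c" "q > 0" using prime_gt_0_nat by auto
      have "[g ^ ((i - j) * (?c div q)) = 1] (mod n)" using gH q by (simp add: power_residues_def power_mult)
      then have "?c dvd (i - j) * (?c div q)" using g(2) by (simp add: ord_divides')
      then have "(?c div q) * q dvd (?c div q) * (i - j)" using qc by (simp add: mult.commute)
      moreover have "?c div q > 0" using qc by (simp add: dvd_div_pos)
      ultimately show ?thesis by simp
    qed
    then have "\<Prod>D dvd i - j"
    proof -
      have "\<Prod>D dvd m" if "\<And>q. q \<in> D \<Longrightarrow> q dvd m" for m :: nat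
      proof (cases "m = 0")
        case False
        then have "D \<subseteq> prime_factors m" using D that by (auto simp: in_prime_factors_iff)
        then show ?thesis by (rule prod_prime_factors_dvd)
      qed simp
      then show ?thesis using \<open>\<And>q. q \<in> D \<Longrightarrow> q dvd i - j\<close> by blast
    qed
    then have ij': "i = j" using ij by (metis diff_is_0_eq dvd_imp_le le_antisym le_less_trans less_irrefl gr0I diff_le_self)
    then have "[h = h'] (mod n)" using c by simp
    then have "h = h'" using h
      by (metis IntD1 Cong.cong_def totatives_less in_totatives_iff mod_less mod_self le_neq_implies_less less_irrefl)
    then show ?thesis using ij' by simp
  qed
  have "inj_on ?f ((totatives n \<inter> ?H) \<times> {..<\<Prod>D})"
  proof (rule inj_onI)
    fix p q assume pq: "p \<in> (totatives n \<inter> ?H) \<times> {..<\<Prod>D}" "q \<in> (totatives n \<inter> ?H) \<times> {..<\<Prod>D}" "?f p = ?f q"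
    obtain h i h' j where hi: "p = (h, i)" "q = (h', j)" by (cases p, cases q) auto
    show "p = q"
      using *[of h h' i j] *[of h' h j i] pq unfolding hi by (cases "j \<le> i") auto
  qed
  then have "card ((totatives n \<inter> ?H) \<times> {..<\<Prod>D}) = card (?f ` ((totatives n \<inter> ?H) \<times> {..<\<Prod>D}))"
    by (rule card_image[symmetric])
  also have "\<dots> \<le> card (totatives n)"
  proof (rule card_mono)
    show "?f ` ((totatives n \<inter> ?H) \<times> {..<\<Prod>D}) \<subseteq> totatives n"
      using g(1) by (auto intro!: rtot simp: power_residues_def)
  qed simp
  finally show ?thesis by (simp add: card_cartesian_product totient_def)
qed

section \<open>Truncated inclusion and exclusion\<close>

lemma alternating_binomial_sum:
  "N > 0 \<Longrightarrow> (\<Sum>j\<le>t. (-1) ^ j * real (N choose j)) = (-1) ^ t * real ((N - 1) choose t)"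
proof (induction t)
  case (Suc t)
  obtain M where M: "N = Suc M" using Suc.prems by (cases N) auto
  have "(\<Sum>j\<le>Suc t. (-1) ^ j * real (N choose j)) = (-1) ^ t * real (M choose t) + (-1) ^ Suc t * real (N choose Suc t)"
    using Suc M by simp
  also have "\<dots> = (-1) ^ Suc t * real (M choose Suc t)" by (simp add: M algebra_simps)
  finally show ?case using M by simp
qed simp

text \<open>For nonempty \<open>B\<close> the truncated sum is, up to sign, the binomial coefficient
  of \<open>card B - 1\<close> over \<open>t\<close>, which is at most the number of
  \<open>t\<close>-subsets of \<open>B\<close>. Written as a sum over \<open>D\<close>, this error
  can be averaged over \<open>a\<close> like the main term.\<close>

lemma bonferroni:
  assumes P: "finite P" "B \<subseteq> P" and t: "t > 0"
  shows "\<bar>(if B = {} then 1 else 0) - (\<Sum>D | D \<subseteq> P \<and> card D \<le> t. (-1) ^ card D * (if D \<subseteq> B then 1 else 0))\<bar>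
    \<le> (\<Sum>D | D \<subseteq> P \<and> card D = t. if D \<subseteq> B then 1 else 0 :: real)"
proof -
  have finB: "finite B" using P finite_subset by blast
  have cnt: "(\<Sum>D | D \<subseteq> P \<and> card D = j. if D \<subseteq> B then 1 else 0 :: real) = real (card B choose j)" for j
  proof -
    have "(\<Sum>D | D \<subseteq> P \<and> card D = j. if D \<subseteq> B then 1 else 0 :: real) = real (card {D. D \<subseteq> B \<and> card D = j})"
    proof -
      have "{D. (D \<subseteq> P \<and> card D = j) \<and> D \<subseteq> B} = {D. D \<subseteq> B \<and> card D = j}" using P by auto
      then show ?thesis using P(1) by (simp add: sum.If_cases Int_def)
    qed
    then show ?thesis using n_subsets[OF finB] by simp
  qed
  have "(\<Sum>D | D \<subseteq> P \<and> card D \<le> t. (-1) ^ card D * (if D \<subseteq> B then 1 else 0 :: real))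
      = (\<Sum>j\<le>t. \<Sum>D\<in>{D \<in> {D. D \<subseteq> P \<and> card D \<le> t}. card D = j}. (-1) ^ card D * (if D \<subseteq> B then 1 else 0))"
    by (rule sum.group[symmetric]) (use P in auto)
  also have "\<dots> = (\<Sum>j\<le>t. (-1) ^ j * real (card B choose j))"
  proof (rule sum.cong[OF refl])
    fix j assume "j \<in> {..t}"
    then have e: "{D \<in> {D. D \<subseteq> P \<and> card D \<le> t}. card D = j} = {D. D \<subseteq> P \<and> card D = j}" by auto
    have "(\<Sum>D\<in>{D \<in> {D. D \<subseteq> P \<and> card D \<le> t}. card D = j}. (-1) ^ card D * (if D \<subseteq> B then 1 else 0 :: real))
       = (\<Sum>D | D \<subseteq> P \<and> card D = j. (-1) ^ j * (if D \<subseteq> B then 1 else 0))"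
      unfolding e by (intro sum.cong refl) auto
    then show "(\<Sum>D\<in>{D \<in> {D. D \<subseteq> P \<and> card D \<le> t}. card D = j}. (-1) ^ card D * (if D \<subseteq> B then 1 else 0 :: real))
       = (-1) ^ j * real (card B choose j)"
      unfolding cnt[symmetric] by (simp add: sum_distrib_left)
  qed
  finally have main: "(\<Sum>D | D \<subseteq> P \<and> card D \<le> t. (-1) ^ card D * (if D \<subseteq> B then 1 else 0 :: real))
    = (\<Sum>j\<le>t. (-1) ^ j * real (card B choose j))" .
  show ?thesis
  proof (cases "B = {}")
    case True
    have "(\<Sum>j\<le>t. (-1) ^ j * real (0 choose j)) = (\<Sum>j\<le>t. if j = 0 then 1 else 0)"
      by (intro sum.cong refl) auto
    then show ?thesis unfolding main cnt using True t by simp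
  next
    case False
    then have c: "card B > 0" using finB by (simp add: card_gt_0_iff)
    have "(card B - 1) choose t \<le> card B choose t" by (rule binomial_right_mono) simp
    then show ?thesis unfolding main cnt alternating_binomial_sum[OF c] using False by (simp add: abs_mult)
  qed
qed

lemma sum_Pow_prod:
  fixes f :: "'i \<Rightarrow> real"
  assumes "finite Q"
  shows "(\<Sum>D\<in>Pow Q. \<Prod>q\<in>D. f q) = (\<Prod>q\<in>Q. 1 + f q)"
  using prod_add[OF assms, of f "\<lambda>_. 1"] by (simp add: add.commute)

lemma prod_one_plus_le_exp:
  fixes f :: "'i \<Rightarrow> real"
  assumes "\<And>q. q \<in> Q \<Longrightarrow> f q \<ge> 0"
  shows "(\<Prod>q\<in>Q. 1 + f q) \<le> exp (\<Sum>q\<in>Q. f q)"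
proof (cases "finite Q")
  case True
  have "(\<Prod>q\<in>Q. 1 + f q) \<le> (\<Prod>q\<in>Q. exp (f q))"
    using assms exp_ge_add_one_self by (intro prod_mono) (auto simp: add_nonneg_nonneg)
  then show ?thesis by (simp add: exp_sum True)
qed simp

text \<open>Every counted set gets the weight V^(t - card D), which is at least 1. Extended to all
  subsets, the weighted sum factors as a product over \<open>Q\<close>.\<close>

lemma card_bounded_subsets_le:
  fixes V :: real
  assumes Q: "finite Q" and V: "V \<ge> 1"
  shows "real (card {D. D \<subseteq> Q \<and> card D \<le> t}) \<le> V ^ t * exp (real (card Q) / V)"
proof -
  have "real (card {D. D \<subseteq> Q \<and> card D \<le> t}) = (\<Sum>D | D \<subseteq> Q \<and> card D \<le> t. 1)" by simp
  also have "\<dots> \<le> (\<Sum>D | D \<subseteq> Q \<and> card D \<le> t. V ^ t * (\<Prod>q\<in>D. 1 / V))"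
  proof (rule sum_mono)
    fix D assume D: "D \<in> {D. D \<subseteq> Q \<and> card D \<le> t}"
    have "V ^ card D \<le> V ^ t" using D V by (intro power_increasing) auto
    then show "1 \<le> V ^ t * (\<Prod>q\<in>D. 1 / V)" using V by (simp add: power_divide field_simps)
  qed
  also have "\<dots> \<le> (\<Sum>D\<in>Pow Q. V ^ t * (\<Prod>q\<in>D. 1 / V))"
    using Q V by (intro sum_mono2) (auto intro!: mult_nonneg_nonneg prod_nonneg)
  also have "\<dots> = V ^ t * (\<Prod>q\<in>Q. 1 + 1 / V)"
    unfolding sum_distrib_left[symmetric] sum_Pow_prod[OF Q] ..
  also have "\<dots> \<le> V ^ t * exp (\<Sum>q\<in>Q. 1 / V)"
    using V by (intro mult_left_mono prod_one_plus_le_exp) auto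
  finally show ?thesis by simp
qed

text \<open>The left side is the coefficient of u^t in the product of the factors 1 + u/q, hence at
  most the whole product divided by u^t.\<close>

lemma sum_inverse_prod_le:
  fixes u :: real and Q :: "nat set"
  assumes Q: "finite Q" and u: "u > 0"
  shows "(\<Sum>D | D \<subseteq> Q \<and> card D = t. 1 / real (\<Prod>D)) \<le> exp (u * (\<Sum>q\<in>Q. 1 / real q)) / u ^ t"
proof -
  have "(\<Sum>D | D \<subseteq> Q \<and> card D = t. 1 / real (\<Prod>D)) = (\<Sum>D | D \<subseteq> Q \<and> card D = t. (\<Prod>q\<in>D. u * (1 / real q)) / u ^ t)"
  proof (rule sum.cong[OF refl])
    fix D assume D: "D \<in> {D. D \<subseteq> Q \<and> card D = t}"
    have "(\<Prod>q\<in>D. u * (1 / real q)) = u ^ t * (1 / real (\<Prod>D))"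
      using D by (simp add: prod.distrib prod_dividef)
    then show "1 / real (\<Prod>D) = (\<Prod>q\<in>D. u * (1 / real q)) / u ^ t" using u by simp
  qed
  also have "\<dots> \<le> (\<Sum>D\<in>Pow Q. (\<Prod>q\<in>D. u * (1 / real q)) / u ^ t)"
    using Q u by (intro sum_mono2) (auto intro!: divide_nonneg_nonneg prod_nonneg)
  also have "\<dots> = (\<Prod>q\<in>Q. 1 + u * (1 / real q)) / u ^ t"
    unfolding sum_divide_distrib[symmetric] sum_Pow_prod[OF Q] ..
  also have "\<dots> \<le> exp (\<Sum>q\<in>Q. u * (1 / real q)) / u ^ t"
    using u by (intro divide_right_mono prod_one_plus_le_exp) auto
  finally show ?thesis by (simp add: sum_distrib_left)
qed

text \<open>Elements up to \<open>c\<close> are bounded by the harmonic sum, larger ones by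
  \<open>1 / c\<close> each. With \<open>c\<close> comparable to \<open>card Q\<close> this gives a
  logarithm of \<open>card Q\<close>, here of order log log x.\<close>

lemma sum_inverse_finite_set_le:
  fixes Q :: "nat set"
  assumes Q: "finite Q" "0 \<notin> Q" and c: "c > 0"
  shows "(\<Sum>q\<in>Q. 1 / real q) \<le> 1 + ln (real c) + real (card Q) / real c"
proof -
  have "(\<Sum>q\<in>Q. 1 / real q) = (\<Sum>q\<in>Q \<inter> {0<..c}. 1 / real q) + (\<Sum>q\<in>Q - {0<..c}. 1 / real q)"
    using Q by (subst sum.union_disjoint[symmetric]) (auto intro!: sum.cong)
  also have "(\<Sum>q\<in>Q \<inter> {0<..c}. 1 / real q) \<le> (\<Sum>q\<in>{0<..c}. 1 / real q)" by (intro sum_mono2) auto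
  also have "\<dots> \<le> 1 + ln (real c)" by (rule sum_inverse_le_ln[OF c])
  also have "(\<Sum>q\<in>Q - {0<..c}. 1 / real q) \<le> (\<Sum>q\<in>Q - {0<..c}. 1 / real c)"
    using Q c by (intro sum_mono divide_left_mono) (auto simp: Suc_le_eq intro: Nat.gr0I)
  also have "\<dots> \<le> real (card Q) / real c"
    using Q by (simp add: divide_right_mono card_mono)
  finally show ?thesis by simp
qed

lemma card_prime_factors_Carmichael_le:
  assumes "n > 0"
  shows "2 ^ card (prime_factors (Carmichael n)) \<le> n"
proof -
  let ?Q = "prime_factors (Carmichael n)"
  have "2 ^ card ?Q = (\<Prod>q\<in>?Q. 2 :: nat)" by simp
  also have "\<dots> \<le> \<Prod>?Q" by (intro prod_mono) (auto dest!: in_prime_factors_imp_prime simp: prime_ge_2_nat)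
  also have "\<dots> \<le> Carmichael n" by (intro dvd_imp_le prod_prime_factors_dvd) auto
  also have "\<dots> \<le> totient n" using assms by (intro dvd_imp_le Carmichael_dvd_totient) auto
  also have "\<dots> \<le> n" by (rule totient_le)
  finally show ?thesis .
qed

text \<open>Stated for any finite set of integers coprime to \<open>n\<close>, because it is applied
  both to such integers up to \<open>Y\<close> and to the totatives, and the two expansions are then
  compared.\<close>

lemma primroot_count_bonferroni:
  assumes n: "n > 0" and A: "finite A" "\<And>a. a \<in> A \<Longrightarrow> coprime a n" and t: "t > 0"
  defines "Q \<equiv> prime_factors (Carmichael n)"
  shows "\<bar>real (card {a \<in> A. lambda_primroot n a}) -
      (\<Sum>D | D \<subseteq> Q \<and> card D \<le> t. (-1) ^ card D * real (card (A \<inter> power_residues n D)))\<bar>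
    \<le> (\<Sum>D | D \<subseteq> Q \<and> card D = t. real (card (A \<inter> power_residues n D)))"
proof -
  define B where "B = (\<lambda>a. {q \<in> Q. [a ^ (Carmichael n div q) = 1] (mod n)})"
  have finQ: "finite Q" by (simp add: Q_def)
  have mem: "D \<subseteq> B a \<longleftrightarrow> a \<in> power_residues n D" if "a \<in> A" "D \<subseteq> Q" for a D
    using that A(2) by (auto simp: B_def power_residues_def)
  have pr: "lambda_primroot n a \<longleftrightarrow> B a = {}" if "a \<in> A" for a
    using primroot_iff[OF n A(2)[OF that]] by (auto simp: B_def Q_def)
  have cardD: "real (card (A \<inter> power_residues n D)) = (\<Sum>a\<in>A. if D \<subseteq> B a then 1 else 0)" if "D \<subseteq> Q" for D
  proof -
    have "(\<Sum>a\<in>A. if D \<subseteq> B a then 1 else 0 :: real) = (\<Sum>a\<in>A. if a \<in> power_residues n D then 1 else 0)"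
      using mem that by (intro sum.cong refl) auto
    then show ?thesis using A(1) by (simp add: sum.If_cases)
  qed
  have "real (card {a \<in> A. lambda_primroot n a}) = (\<Sum>a\<in>A. if B a = {} then 1 else 0)"
  proof -
    have "(\<Sum>a\<in>A. if B a = {} then 1 else 0 :: real) = (\<Sum>a\<in>A. if lambda_primroot n a then 1 else 0)"
      using pr by (intro sum.cong refl) auto
    then show ?thesis using A(1) by (simp add: sum.If_cases Int_def)
  qed
  moreover have "(\<Sum>D | D \<subseteq> Q \<and> card D \<le> t. (-1) ^ card D * real (card (A \<inter> power_residues n D)))
      = (\<Sum>a\<in>A. \<Sum>D | D \<subseteq> Q \<and> card D \<le> t. (-1) ^ card D * (if D \<subseteq> B a then 1 else 0))"
    by (subst sum.swap) (intro sum.cong refl, simp only: mem_Collect_eq cardD sum_distrib_left)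
  moreover have "(\<Sum>D | D \<subseteq> Q \<and> card D = t. real (card (A \<inter> power_residues n D)))
      = (\<Sum>a\<in>A. \<Sum>D | D \<subseteq> Q \<and> card D = t. if D \<subseteq> B a then 1 else 0)"
    by (subst sum.swap) (intro sum.cong refl, simp only: mem_Collect_eq cardD)
  moreover have "\<bar>(\<Sum>a\<in>A. (if B a = {} then 1 else 0) -
        (\<Sum>D | D \<subseteq> Q \<and> card D \<le> t. (-1) ^ card D * (if D \<subseteq> B a then 1 else 0)))\<bar>
      \<le> (\<Sum>a\<in>A. \<Sum>D | D \<subseteq> Q \<and> card D = t. if D \<subseteq> B a then 1 else 0 :: real)"
    by (rule order_trans[OF sum_abs]) (intro sum_mono bonferroni finQ t, auto simp: B_def)
  ultimately show ?thesis by (simp only: sum_subtractf)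
qed

text \<open>The expansion for the integers up to \<open>Y\<close> and the one for the totatives,
  scaled by \<open>g / \<phi>\<close>, differ term by term by discrepancies. The tail of the former
  is at most that of the latter plus discrepancies, whence the factors 2, and
  \<open>card_power_residues\<close> bounds the latter. Passing from \<open>g / \<phi>\<close> to
  \<open>y / n\<close> costs \<open>2 ^ card (prime_factors n)\<close>.\<close>

lemma primroot_count_approx:
  assumes n: "n > 0" and t: "t > 0" and y: "y > 0" and Y: "Y = nat \<lfloor>y\<rfloor>"
  defines "Q \<equiv> prime_factors (Carmichael n)"
  shows "\<exists>D \<subseteq> Q. \<bar>real (card {a \<in> {0<..Y}. lambda_primroot n a}) - y * (real (R_count n) / real n)\<bar>
    \<le> 2 * real (card {D. D \<subseteq> Q \<and> card D \<le> t}) * discrepancy Y n (power_residues n D) +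
       2 * y * (\<Sum>D | D \<subseteq> Q \<and> card D = t. 1 / real (\<Prod>D)) + 2 ^ card (prime_factors n)"
proof -
  define W where "W = {D. D \<subseteq> Q \<and> card D \<le> t}"
  define E where "E = {D. D \<subseteq> Q \<and> card D = t}"
  define d where "d = (\<lambda>D. discrepancy Y n (power_residues n D))"
  define A where "A = {a \<in> {0<..Y}. coprime a n}"
  define g where "g = real (card A)"
  define \<phi> where "\<phi> = real (totient n)"
  define h where "h = (\<lambda>D. real (card (A \<inter> power_residues n D)))"
  define e where "e = (\<lambda>D. real (card (totatives n \<inter> power_residues n D)))"
  define p where "p = real (card {a \<in> {0<..Y}. lambda_primroot n a})"
  define r where "r = real (R_count n)"
  have finW: "finite W" unfolding W_def Q_def by (rule finite_subset[of _ "Pow (prime_factors (Carmichael n))"]) auto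
  have EW: "E \<subseteq> W" by (auto simp: E_def W_def)
  have finE: "finite E" using EW finW finite_subset by blast
  have \<phi>0: "\<phi> > 0" using n by (simp add: \<phi>_def)
  have g: "g \<ge> 0" "g \<le> y"
  proof -
    have "card A \<le> card {0<..Y}" unfolding A_def by (intro card_mono) auto
    then have "g \<le> real Y" by (simp add: g_def)
    moreover have "real Y \<le> y" using y unfolding Y by (intro of_nat_floor) simp
    ultimately show "g \<le> y" by linarith
  qed (simp add: g_def)
  have d: "d D = \<bar>h D - e D / \<phi> * g\<bar>" for D
  proof -
    have "{a \<in> {0<..Y}. a \<in> power_residues n D} = A \<inter> power_residues n D"
      by (auto simp: A_def power_residues_def)
    then show ?thesis by (simp add: d_def discrepancy_def h_def e_def \<phi>_def g_def A_def)
  qed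
  have P: "\<bar>p - (\<Sum>D\<in>W. (-1) ^ card D * h D)\<bar> \<le> (\<Sum>D\<in>E. h D)"
  proof -
    have eq: "{a \<in> {0<..Y}. lambda_primroot n a} = {a \<in> A. lambda_primroot n a}"
      by (auto simp: A_def lambda_primroot_def)
    show ?thesis unfolding p_def eq h_def W_def E_def Q_def
      by (rule primroot_count_bonferroni[OF n _ _ t]) (auto simp: A_def)
  qed
  have R: "\<bar>r - (\<Sum>D\<in>W. (-1) ^ card D * e D)\<bar> \<le> (\<Sum>D\<in>E. e D)"
    unfolding r_def e_def W_def E_def Q_def R_count_def
    by (rule primroot_count_bonferroni[OF n _ _ t]) (auto simp: totatives_def)
  have "(\<Sum>D\<in>W. (-1) ^ card D * h D) - (\<Sum>D\<in>W. (-1) ^ card D * e D) * (g / \<phi>) =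
      (\<Sum>D\<in>W. (-1) ^ card D * (h D - e D / \<phi> * g))"
    by (simp add: sum_distrib_right right_diff_distrib sum_subtractf sum_divide_distrib mult.assoc)
  also have "\<bar>\<dots>\<bar> \<le> (\<Sum>D\<in>W. d D)"
    by (rule order_trans[OF sum_abs]) (auto simp: abs_mult d intro!: sum_mono)
  finally have M: "\<bar>(\<Sum>D\<in>W. (-1) ^ card D * h D) - (\<Sum>D\<in>W. (-1) ^ card D * e D) * (g / \<phi>)\<bar> \<le> (\<Sum>D\<in>W. d D)" .
  have R': "\<bar>r * (g / \<phi>) - (\<Sum>D\<in>W. (-1) ^ card D * e D) * (g / \<phi>)\<bar> \<le> (\<Sum>D\<in>E. e D) * (g / \<phi>)"
  proof -
    have "\<bar>r - (\<Sum>D\<in>W. (-1) ^ card D * e D)\<bar> * (g / \<phi>) \<le> (\<Sum>D\<in>E. e D) * (g / \<phi>)"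
      using R g \<phi>0 by (intro mult_right_mono) auto
    moreover have "\<bar>g / \<phi>\<bar> = g / \<phi>" using g \<phi>0 by simp
    ultimately show ?thesis unfolding left_diff_distrib[symmetric] abs_mult by simp
  qed
  have hE: "(\<Sum>D\<in>E. h D) \<le> (\<Sum>D\<in>W. d D) + (\<Sum>D\<in>E. e D) * (g / \<phi>)"
  proof -
    have "(\<Sum>D\<in>E. h D) \<le> (\<Sum>D\<in>E. d D + e D * (g / \<phi>))" unfolding d by (intro sum_mono) auto
    also have "\<dots> = (\<Sum>D\<in>E. d D) + (\<Sum>D\<in>E. e D) * (g / \<phi>)" by (simp add: sum.distrib sum_distrib_right sum_divide_distrib)
    also have "(\<Sum>D\<in>E. d D) \<le> (\<Sum>D\<in>W. d D)" using finW EW by (intro sum_mono2) (auto simp: d)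
    finally show ?thesis by simp
  qed
  have eE: "(\<Sum>D\<in>E. e D) * (g / \<phi>) \<le> y * (\<Sum>D\<in>E. 1 / real (\<Prod>D))"
  proof -
    have "e D * (g / \<phi>) \<le> y * (1 / real (\<Prod>D))" if "D \<in> E" for D
    proof -
      have DQ: "D \<subseteq> prime_factors (Carmichael n)" using that by (simp add: E_def Q_def)
      have "\<Prod>D > 0" using DQ by (intro prod_pos) (auto dest!: subsetD in_prime_factors_imp_prime simp: prime_gt_0_nat)
      moreover have "real (card (totatives n \<inter> power_residues n D) * \<Prod>D) \<le> real (totient n)"
        using card_power_residues[OF n DQ] by (subst of_nat_le_iff)
      then have "e D * real (\<Prod>D) \<le> \<phi>" by (simp add: e_def \<phi>_def)
      moreover have "e D \<le> \<phi> / real m" if "e D * real m \<le> \<phi>" "m > 0" for m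
        using that by (simp add: field_simps)
      ultimately have "e D \<le> \<phi> / real (\<Prod>D)" by blast
      from divide_right_mono[OF this, of \<phi>] have "e D / \<phi> \<le> 1 / real (\<Prod>D)" using \<phi>0 by simp
      then have "(e D / \<phi>) * g \<le> (1 / real (\<Prod>D)) * y"
        using g by (intro mult_mono) (auto intro: prod_nonneg)
      then show ?thesis by (simp add: mult.commute)
    qed
    then show ?thesis unfolding sum_distrib_right sum_distrib_left by (intro sum_mono)
  qed
  have "W \<noteq> {}" by (auto simp: W_def)
  \<comment> \<open>The worst set: all discrepancies are bounded by the largest one, so a single
    subgroup per modulus remains.\<close>
  define D where "D = (SOME D. D \<in> W \<and> d D = Max (d ` W))"
  have "Max (d ` W) \<in> d ` W" using finW \<open>W \<noteq> {}\<close> by (intro Max_in) auto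
  then have "\<exists>D. D \<in> W \<and> d D = Max (d ` W)" by auto
  then have D: "D \<in> W" "d D = Max (d ` W)" unfolding D_def by (metis (mono_tags, lifting) someI_ex)+
  have dsum: "(\<Sum>D\<in>W. d D) \<le> real (card W) * d D"
    by (rule sum_bounded_above) (use finW D(2) in auto)
  have c: "\<bar>r * (g / \<phi>) - y * (r / real n)\<bar> \<le> 2 ^ card (prime_factors n)"
  proof -
    have "r \<le> \<phi>" unfolding r_def \<phi>_def R_count_def totient_def by (simp add: card_mono)
    then have q: "r / \<phi> \<le> 1" "r / \<phi> \<ge> 0" using \<phi>0 by (auto simp: r_def)
    have "r * (g / \<phi>) - y * (r / real n) = (r / \<phi>) * (g - y * \<phi> / real n)"
      using \<phi>0 by (simp add: field_simps)
    then have "\<bar>r * (g / \<phi>) - y * (r / real n)\<bar> = (r / \<phi>) * \<bar>g - y * \<phi> / real n\<bar>"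
      using q by (simp only: abs_mult abs_of_nonneg)
    also have "\<dots> \<le> 1 * 2 ^ card (prime_factors n)"
      using q coprime_count_approx[OF n, of y] y
      unfolding g_def A_def Y \<phi>_def by (intro mult_mono) auto
    finally show ?thesis by simp
  qed
  have "\<bar>p - y * (r / real n)\<bar> \<le> 2 * (\<Sum>D\<in>W. d D) + 2 * (y * (\<Sum>D\<in>E. 1 / real (\<Prod>D))) + 2 ^ card (prime_factors n)"
  proof -
    have "\<bar>p - v\<bar> \<le> 2 * w + 2 * z' + m"
      if "\<bar>p - a\<bar> \<le> s" "\<bar>a - b\<bar> \<le> w" "\<bar>u - b\<bar> \<le> z" "s \<le> w + z" "z \<le> z'" "\<bar>u - v\<bar> \<le> m"
      for a b s u v w z z' m :: real
      using that by linarith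
    from this[OF P M R' hE eE c] show ?thesis .
  qed
  also have "\<dots> \<le> 2 * real (card W) * d D + 2 * y * (\<Sum>D\<in>E. 1 / real (\<Prod>D)) + 2 ^ card (prime_factors n)"
    using dsum by simp
  finally show ?thesis using D(1) unfolding p_def r_def W_def E_def d_def by blast
qed

lemma sum_N_count:
  "(\<Sum>a\<in>{1..Y}. real (N_count a x)) = (\<Sum>n\<in>{0<..nat \<lfloor>x\<rfloor>}. real (card {a \<in> {0<..Y}. lambda_primroot n a}))"
proof -
  have N: "N_count a x = card {n \<in> {0<..nat \<lfloor>x\<rfloor>}. lambda_primroot n a}" for a
    unfolding N_count_def greaterThanAtMost_floor_eq by (rule arg_cong[of _ _ card]) auto
  have "(\<Sum>a\<in>{1..Y}. real (N_count a x)) = (\<Sum>a\<in>{0<..Y}. \<Sum>n\<in>{n \<in> {0<..nat \<lfloor>x\<rfloor>}. lambda_primroot n a}. 1)"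
    unfolding N by (intro sum.cong) auto
  also have "\<dots> = (\<Sum>n\<in>{0<..nat \<lfloor>x\<rfloor>}. \<Sum>a\<in>{a \<in> {0<..Y}. lambda_primroot n a}. 1)"
    by (rule sum.swap_restrict) auto
  finally show ?thesis by simp
qed

theorem theorem1p5:
  shows "\<exists>c2 > 0. \<exists>C x0. \<forall>x \<ge> x0. \<forall>y::real. y > exp (3.42 * sqrt (ln x)) \<longrightarrow>
    \<bar>(1 / y) * (\<Sum>a\<in>{1..nat \<lfloor>y\<rfloor>}. real (N_count a x))
      - (\<Sum>n\<in>{1..nat \<lfloor>x\<rfloor>}. real (R_count n) / real n)\<bar>
    \<le> C * x * exp (- c2 * sqrt (ln x))"
proof -
  obtain x1 where x1: "\<And>x y H. x \<ge> x1 \<Longrightarrow> y > exp (3.42 * sqrt (ln x)) \<Longrightarrow>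
      (\<And>n. n \<in> {0<..nat \<lfloor>x\<rfloor>} \<Longrightarrow> mod_subgroup n (H n)) \<Longrightarrow>
      (\<Sum>n\<in>{0<..nat \<lfloor>x\<rfloor>}. discrepancy (nat \<lfloor>y\<rfloor>) n (H n)) \<le> x * y * exp (- (1/8000) * sqrt (ln x))"
    using discrepancy_average by blast
  \<comment> \<open>The summands are the discrepancies times the number of truncated sets, the tail
    of the inclusion-exclusion, and the error in counting integers coprime to
    \<open>n\<close>.\<close>
  have "eventually (\<lambda>x::real. x \<ge> 1 \<and> sqrt (ln x) \<ge> 3 \<and>
      2 * exp (2 + 2 * ln (sqrt (ln x)) + 1/16000 * sqrt (ln x)) * exp (- (1/8000) * sqrt (ln x)) +
      2 * exp (sqrt (sqrt (ln x)) * (3 + ln (sqrt (ln x) ^ 2 + 1)) - 1/64000 * sqrt (ln x)) +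
      (1 + sqrt (ln x) ^ 2) * exp (- 3.42 * sqrt (ln x)) \<le> exp (- (1/128000) * sqrt (ln x))) at_top"
    by (intro eventually_conj; real_asymp)
  then obtain x2 where x2: "\<And>x::real. x \<ge> x2 \<Longrightarrow> x \<ge> 1 \<and> sqrt (ln x) \<ge> 3 \<and>
      2 * exp (2 + 2 * ln (sqrt (ln x)) + 1/16000 * sqrt (ln x)) * exp (- (1/8000) * sqrt (ln x)) +
      2 * exp (sqrt (sqrt (ln x)) * (3 + ln (sqrt (ln x) ^ 2 + 1)) - 1/64000 * sqrt (ln x)) +
      (1 + sqrt (ln x) ^ 2) * exp (- 3.42 * sqrt (ln x)) \<le> exp (- (1/128000) * sqrt (ln x))"
    unfolding eventually_at_top_linorder by blast
  have "\<bar>(1 / y) * (\<Sum>a\<in>{1..nat \<lfloor>y\<rfloor>}. real (N_count a x))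
      - (\<Sum>n\<in>{1..nat \<lfloor>x\<rfloor>}. real (R_count n) / real n)\<bar> \<le> 1 * x * exp (- (1/128000) * sqrt (ln x))"
    if x: "x \<ge> max x1 x2" and y: "y > exp (3.42 * sqrt (ln x))" for x y :: real
  proof -
    define L where "L = sqrt (ln x)"
    define X where "X = nat \<lfloor>x\<rfloor>"
    define Y where "Y = nat \<lfloor>y\<rfloor>"
    \<comment> \<open>With this \<open>t\<close>, the power \<open>L ^ (2 * t)\<close> that bounds
      the number of truncated sets uses up only half of the exponent L/8000 saved on
      average.\<close>
    define t where "t = nat \<lceil>1/32000 * L / ln L\<rceil>"
    define Q where "Q = (\<lambda>n. prime_factors (Carmichael n))"
    define Wb where "Wb = exp (2 + 2 * ln L + 1/16000 * L)"
    define Eb where "Eb = exp (sqrt L * (3 + ln (L ^ 2 + 1)) - 1/64000 * L)"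
    have xx: "x \<ge> 1" "L \<ge> 3" and fin: "2 * Wb * exp (- (1/8000) * L) + 2 * Eb + (1 + L ^ 2) * exp (- 3.42 * L)
        \<le> exp (- (1/128000) * L)"
      using x2[of x] x unfolding L_def Wb_def Eb_def by auto
    have L2: "L ^ 2 = ln x" using xx by (simp add: L_def)
    have y0: "y > 0" using y by (meson exp_gt_zero less_trans)
    have X0: "X > 0" "real X \<le> x" using xx(1) by (auto simp: X_def le_nat_floor Suc_le_eq[symmetric])
    have lnL: "ln L > 0" using xx by simp
    have tpos: "1/32000 * L / ln L > 0" using xx lnL by simp
    then have t: "t > 0" "1/32000 * L / ln L \<le> real t" "real t \<le> 1/32000 * L / ln L + 1"
      unfolding t_def by linarith+
    have t': "1/32000 * L \<le> real t * ln L" "real t * ln L \<le> 1/32000 * L + ln L"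
      using t lnL by (simp_all add: field_simps)
    have cardQ: "real (card (Q n)) \<le> 2 * L ^ 2" if n: "n \<in> {0<..X}" for n
    proof -
      have "real (2 ^ card (Q n)) \<le> real n"
        using card_prime_factors_Carmichael_le[of n] n unfolding Q_def by (subst of_nat_le_iff) auto
      moreover have "real n \<le> real X" using n by simp
      ultimately have "real (2 ^ card (Q n)) \<le> x" using X0(2) by linarith
      then have "2 ^ card (Q n) \<le> x" by simp
      then have "exp (real (card (Q n)) * ln 2) \<le> x" by (simp add: exp_of_nat_mult)
      then have "real (card (Q n)) * ln 2 \<le> ln x" using xx(1) by (subst ln_ge_iff) auto
      moreover have "1/2 \<le> ln (2 :: real)" using exp_half_le2 by (simp only: ln_ge_iff zero_less_numeral)
      then have "real (card (Q n)) * (1/2) \<le> real (card (Q n)) * ln 2" by (intro mult_left_mono) auto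
      ultimately show ?thesis unfolding L2 by linarith
    qed
    have W: "real (card {D. D \<subseteq> Q n \<and> card D \<le> t}) \<le> Wb" if n: "n \<in> {0<..X}" for n
    proof -
      have "real (card {D. D \<subseteq> Q n \<and> card D \<le> t}) \<le> (L ^ 2) ^ t * exp (real (card (Q n)) / L ^ 2)"
        using xx by (intro card_bounded_subsets_le) (auto simp: Q_def one_le_power)
      also have "(L ^ 2) ^ t = exp (2 * (real t * ln L))"
      proof -
        have "(L ^ 2) ^ t = L ^ (2 * t)" by (rule power_mult[symmetric])
        also have "\<dots> = exp (ln L) ^ (2 * t)" using xx by simp
        finally show ?thesis by (simp add: mult.assoc flip: exp_of_nat_mult)
      qed
      also have "\<dots> * exp (real (card (Q n)) / L ^ 2) \<le> exp (2 * (1/32000 * L + ln L)) * exp 2"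
        using t' cardQ[OF n] xx by (intro mult_mono) (auto simp: divide_le_eq)
      also have "\<dots> = Wb" by (simp add: Wb_def algebra_simps flip: exp_add)
      finally show ?thesis .
    qed
    have E: "(\<Sum>D | D \<subseteq> Q n \<and> card D = t. 1 / real (\<Prod>D)) \<le> Eb" if n: "n \<in> {0<..X}" for n
    proof -
      define c where "c = nat \<lceil>L ^ 2\<rceil>"
      have L1: "L ^ 2 \<ge> 1" using xx by (simp add: one_le_power)
      have c: "real c \<ge> L ^ 2" "real c \<le> L ^ 2 + 1" unfolding c_def using L1 by linarith+
      then have c0: "c > 0" using L1 by (intro gr0I) auto
      have "0 \<notin> Q n" by (auto simp: Q_def dest: in_prime_factors_imp_prime)
      then have "(\<Sum>q\<in>Q n. 1 / real q) \<le> 1 + ln (real c) + real (card (Q n)) / real c"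
        by (intro sum_inverse_finite_set_le c0) (auto simp: Q_def)
      also have "\<dots> \<le> 1 + ln (L ^ 2 + 1) + 2"
      proof (intro add_mono order_refl)
        show "ln (real c) \<le> ln (L ^ 2 + 1)" using c c0 by (subst ln_le_cancel_iff) (auto simp: add_nonneg_pos)
        show "real (card (Q n)) / real c \<le> 2" using cardQ[OF n] c c0 by (simp add: divide_le_eq)
      qed
      finally have S: "(\<Sum>q\<in>Q n. 1 / real q) \<le> 3 + ln (L ^ 2 + 1)" by simp
      \<comment> \<open>The choice u = sqrt L makes u^t at least exp(L/64000), while the exponent in
        the numerator is only of order sqrt L times log L.\<close>
      have "(\<Sum>D | D \<subseteq> Q n \<and> card D = t. 1 / real (\<Prod>D)) \<le> exp (sqrt L * (\<Sum>q\<in>Q n. 1 / real q)) / sqrt L ^ t"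
        using xx by (intro sum_inverse_prod_le) (auto simp: Q_def)
      also have "sqrt L ^ t = exp (real t * ln L / 2)"
      proof -
        have "sqrt L = exp (ln L / 2)" using xx by (simp add: ln_sqrt[symmetric])
        then show ?thesis by (simp flip: exp_of_nat_mult)
      qed
      also have "exp (sqrt L * (\<Sum>q\<in>Q n. 1 / real q)) / exp (real t * ln L / 2)
          = exp (sqrt L * (\<Sum>q\<in>Q n. 1 / real q) - real t * ln L / 2)" by (simp add: exp_diff)
      also have "\<dots> \<le> Eb"
      proof -
        have "sqrt L * (\<Sum>q\<in>Q n. 1 / real q) \<le> sqrt L * (3 + ln (L ^ 2 + 1))" using S xx by (intro mult_left_mono) auto
        then show ?thesis unfolding Eb_def exp_le_cancel_iff using t'(1) by linarith
      qed
      finally show ?thesis .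
    qed
    define bd where "bd = (\<lambda>n D. \<bar>real (card {a \<in> {0<..Y}. lambda_primroot n a}) - y * (real (R_count n) / real n)\<bar>
        \<le> 2 * Wb * discrepancy Y n (power_residues n D) + 2 * y * Eb + 2 ^ card (prime_factors n))"
    have "\<exists>D. bd n D" if n: "n \<in> {0<..X}" for n
    proof -
      obtain D where D: "\<bar>real (card {a \<in> {0<..Y}. lambda_primroot n a}) - y * (real (R_count n) / real n)\<bar>
          \<le> 2 * real (card {D. D \<subseteq> Q n \<and> card D \<le> t}) * discrepancy Y n (power_residues n D) +
          2 * y * (\<Sum>D | D \<subseteq> Q n \<and> card D = t. 1 / real (\<Prod>D)) + 2 ^ card (prime_factors n)"
        using primroot_count_approx[OF _ t(1) y0 Y_def, of n] n unfolding Q_def by auto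
      also have "\<dots> \<le> 2 * Wb * discrepancy Y n (power_residues n D) + 2 * y * Eb + 2 ^ card (prime_factors n)"
        using W[OF n] E[OF n] y0 by (intro add_mono mult_mono order_refl) (auto simp: discrepancy_def Wb_def intro!: sum_nonneg prod_nonneg)
      finally show ?thesis unfolding bd_def by (rule exI)
    qed
    then obtain D where "\<And>n. n \<in> {0<..X} \<Longrightarrow> bd n (D n)" by metis
    note D = this[unfolded bd_def]
    have "\<bar>(\<Sum>n\<in>{0<..X}. real (card {a \<in> {0<..Y}. lambda_primroot n a})) - y * (\<Sum>n\<in>{0<..X}. real (R_count n) / real n)\<bar>
        = \<bar>\<Sum>n\<in>{0<..X}. real (card {a \<in> {0<..Y}. lambda_primroot n a}) - y * (real (R_count n) / real n)\<bar>"
      by (simp add: sum_subtractf sum_distrib_left)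
    also have "\<dots> \<le> (\<Sum>n\<in>{0<..X}. 2 * Wb * discrepancy Y n (power_residues n (D n)) + 2 * y * Eb + 2 ^ card (prime_factors n))"
      by (rule order_trans[OF sum_abs]) (intro sum_mono D)
    also have "\<dots> = 2 * Wb * (\<Sum>n\<in>{0<..X}. discrepancy Y n (power_residues n (D n))) + 2 * y * Eb * real X +
        (\<Sum>n\<in>{0<..X}. 2 ^ card (prime_factors n))"
      by (simp add: sum.distrib sum_distrib_left mult_ac)
    also have "\<dots> \<le> 2 * Wb * (x * y * exp (- (1/8000) * L)) + 2 * y * Eb * x + x * (1 + L ^ 2)"
    proof (intro add_mono mult_left_mono)
      show "(\<Sum>n\<in>{0<..X}. discrepancy Y n (power_residues n (D n))) \<le> x * y * exp (- (1/8000) * L)"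
        unfolding X_def Y_def L_def using x y by (intro x1 mod_subgroup_power_residues) auto
      have "(\<Sum>n\<in>{0<..X}. 2 ^ card (prime_factors n)) \<le> real X * (1 + ln (real X))"
        by (rule sum_two_power_prime_factors_le[OF X0(1)])
      also have "\<dots> \<le> x * (1 + L ^ 2)"
        unfolding L2 using X0 xx by (intro mult_mono add_left_mono) (auto simp: ln_ge_zero Suc_leI)
      finally show "(\<Sum>n\<in>{0<..X}. 2 ^ card (prime_factors n)) \<le> x * (1 + L ^ 2)" .
    qed (use X0 y0 in \<open>auto simp: Wb_def Eb_def\<close>)
    \<comment> \<open>The error from coprimality is free of y, so the lower bound on y turns it into
      a saving once the sum is divided by y.\<close>
    also have "x * (1 + L ^ 2) \<le> x * (1 + L ^ 2) * (y * exp (- 3.42 * L))"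
    proof -
      have "1 = exp (3.42 * L) * exp (- 3.42 * L)" by (simp flip: exp_add)
      also have "\<dots> \<le> y * exp (- 3.42 * L)"
        using y unfolding L_def by (intro mult_right_mono) auto
      finally have "1 \<le> y * exp (- 3.42 * L)" .
      then have "x * (1 + L ^ 2) * 1 \<le> x * (1 + L ^ 2) * (y * exp (- 3.42 * L))"
        using xx by (intro mult_left_mono) auto
      then show ?thesis by simp
    qed
    then have "2 * Wb * (x * y * exp (- (1/8000) * L)) + 2 * y * Eb * x + x * (1 + L ^ 2) \<le>
        x * y * (2 * Wb * exp (- (1/8000) * L) + 2 * Eb + (1 + L ^ 2) * exp (- 3.42 * L))"
      by (simp add: algebra_simps)
    also have "\<dots> \<le> x * y * exp (- (1/128000) * L)" using fin xx y0 by (intro mult_left_mono) auto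
    finally have main: "\<bar>(\<Sum>n\<in>{0<..X}. real (card {a \<in> {0<..Y}. lambda_primroot n a})) -
        y * (\<Sum>n\<in>{0<..X}. real (R_count n) / real n)\<bar> \<le> x * y * exp (- (1/128000) * L)" .
    have set: "{1..X} = {0<..X}" by auto
    have scale: "\<bar>1 / y * a - b\<bar> * y = \<bar>a - y * b\<bar>" for a b
    proof -
      have "\<bar>1 / y * a - b\<bar> * y = \<bar>(1 / y * a - b) * y\<bar>" using y0 by (simp only: abs_mult abs_of_pos)
      also have "(1 / y * a - b) * y = a - y * b" using y0 by (simp add: field_simps)
      finally show ?thesis .
    qed
    have "\<bar>(1 / y) * (\<Sum>a\<in>{1..Y}. real (N_count a x)) - (\<Sum>n\<in>{1..X}. real (R_count n) / real n)\<bar> * y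
        = \<bar>(\<Sum>n\<in>{0<..X}. real (card {a \<in> {0<..Y}. lambda_primroot n a})) -
        y * (\<Sum>n\<in>{0<..X}. real (R_count n) / real n)\<bar>"
      unfolding sum_N_count set X_def[symmetric] by (rule scale)
    then have "\<bar>(1 / y) * (\<Sum>a\<in>{1..Y}. real (N_count a x)) - (\<Sum>n\<in>{1..X}. real (R_count n) / real n)\<bar> * y
        \<le> (x * exp (- (1/128000) * L)) * y" using main by (simp add: mult_ac)
    then show ?thesis using y0 unfolding X_def Y_def L_def by (simp only: mult_le_cancel_right_pos mult_1)
  qed
  then show ?thesis by (intro exI[of _ "1/128000"] conjI exI[of _ 1] exI[of _ "max x1 x2"]) auto
qed

end
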